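(* Let $N\ge1$, $l=2+4/N$, and let $f$ satisfy: (F1) $f\in C(\mathbb{C},\mathbb{C})$ and $f(0)=0$; (F2) $f(r)\in\mathbb{R}$ for $r\in\mathbb{R}$, $f(e^{i\theta}z)=e^{i\theta}f(z)$ for all $\theta\in\mathbb{R}$, $z\in\mathbb{C}$, and $F(s)=\int_0^sf(\tau)\,d\tau$; (F3) $\lim_{z\to0}f(z)/|z|=0$; (F4) $\lim_{|z|\to\infty}f(z)/|z|^{l-1}=0$. Suppose moreover: (E1) $E_\alpha<0$ for all $\alpha>0$. Then the subadditivity condition $$E_{\alpha+\beta}<E_\alpha+E_\beta\qquad\text{for all }\alpha,\beta>0$$ holds. Moreover, for every $\alpha>0$, any minimizing sequence $\{u_n\}_{n\in\mathbb{N}}\subset M_\alpha$ with respect to $E_\alpha$ is precompact; that is, after passing to a subsequence, there exist $u\in M_\alpha$ and $\{y_n\}_{n\in\mathbb{N}}\subset\mathbb{R}^N$ such that $u_n(\cdot-y_n)\to u$ in $H^1(\mathbb{R}^N)$ as $n\to\infty$. In particular, $u$ is a global minimizer, i.e. $I[u]=E_\alpha$.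
   Context: For $\alpha>0$ set $$M_\alpha=\{u\in H^1(\mathbb{R}^N):\ \|u\|_{L^2(\mathbb{R}^N)}^2=\alpha\},\quad I[u]=\frac12\int_{\mathbb{R}^N}|\nabla u|^2dx-\int_{\mathbb{R}^N}F(u)\,dx,\quad E_\alpha=\inf_{u\in M_\alpha}I[u].$$ Elements of $H^1(\mathbb{R}^N)$ are complex-valued, and for $z\in\mathbb{C}$ one sets $F(z)=F(|z|)=\int_0^{|z|}f(\tau)\,d\tau$ (consistent with (F2), which makes $f$ odd on $\mathbb{R}$ and hence $F$ even on $\mathbb{R}$). A minimizing sequence with respect to $E_\alpha$ is a sequence $\{u_n\}\subset M_\alpha$ with $I[u_n]\to E_\alpha$. *)

theory Defs
  imports "HOL-Analysis.Analysis"
begin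

primrec C_k :: "nat \<Rightarrow> (real ^ 'n \<Rightarrow> real) \<Rightarrow> bool" where
  "C_k 0 \<phi> \<longleftrightarrow> continuous_on UNIV \<phi>"
| "C_k (Suc k) \<phi> \<longleftrightarrow>
     (\<forall>x. \<phi> differentiable (at x)) \<and> (\<forall>v. C_k k (\<lambda>x. frechet_derivative \<phi> (at x) v))"

definition test_function :: "(real ^ 'n \<Rightarrow> real) \<Rightarrow> bool" where
  "test_function \<phi> \<longleftrightarrow> (\<forall>k. C_k k \<phi>) \<and> compact (closure {x. \<phi> x \<noteq> 0})"

definition locally_integrable :: "(real ^ 'n \<Rightarrow> 'b::euclidean_space) \<Rightarrow> bool" where
  "locally_integrable u \<longleftrightarrow> (\<forall>K. compact K \<longrightarrow> set_integrable lborel K u)"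

definition is_weak_gradient :: "(real ^ 'n \<Rightarrow> complex) \<Rightarrow> (real ^ 'n \<Rightarrow> complex ^ 'n) \<Rightarrow> bool" where
  "is_weak_gradient u g \<longleftrightarrow> locally_integrable u \<and> locally_integrable g \<and>
     (\<forall>\<phi> i. test_function \<phi> \<longrightarrow>
        (LINT x|lborel. frechet_derivative \<phi> (at x) (axis i 1) *\<^sub>R u x)
          = - (LINT x|lborel. \<phi> x *\<^sub>R (g x $ i)))"

text \<open>
  Elements of Lebesgue and Sobolev spaces are represented by Borel measurable functions; every
  almost-everywhere class of Lebesgue measurable functions has such a representative, and all
  notions below are invariant under changing a function on a null set.
\<close>

definition L2 :: "(real ^ 'n \<Rightarrow> 'b::euclidean_space) set" where
  "L2 = {u \<in> borel_measurable lborel. integrable lborel (\<lambda>x. (norm (u x))\<^sup>2)}"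

definition H1 :: "(real ^ 'n \<Rightarrow> complex) set" where
  "H1 = {u \<in> L2. \<exists>g\<in>L2. is_weak_gradient u g}"

text \<open>
  A weak gradient is unique up to null sets, so the choice does not affect integrals of it.
\<close>

definition weak_gradient :: "(real ^ 'n \<Rightarrow> complex) \<Rightarrow> real ^ 'n \<Rightarrow> complex ^ 'n" where
  "weak_gradient u = (SOME g. is_weak_gradient u g)"

definition H1_norm :: "(real ^ 'n \<Rightarrow> complex) \<Rightarrow> real" where
  "H1_norm u = sqrt ((LINT x|lborel. (norm (u x))\<^sup>2) + (LINT x|lborel. (norm (weak_gradient u x))\<^sup>2))"

definition M :: "real \<Rightarrow> (real ^ 'n \<Rightarrow> complex) set" where
  "M \<alpha> = {u \<in> H1. (LINT x|lborel. (norm (u x))\<^sup>2) = \<alpha>}"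

text \<open>
  \<open>Re\<close> only changes the type: in the situation of interest \<open>f\<close> is real on the real axis.
\<close>

definition F :: "(complex \<Rightarrow> complex) \<Rightarrow> complex \<Rightarrow> real" where
  "F f z = integral {0..norm z} (\<lambda>\<tau>. Re (f (of_real \<tau>)))"

definition energy :: "(complex \<Rightarrow> complex) \<Rightarrow> (real ^ 'n \<Rightarrow> complex) \<Rightarrow> real" where
  "energy f u = 1/2 * (LINT x|lborel. (norm (weak_gradient u x))\<^sup>2) - (LINT x|lborel. F f (u x))"

text \<open>
  The infimum is taken in the extended reals, so that no lower bound on the energy is built in.
  The first argument only fixes the dimension \<open>CARD('n)\<close>.
\<close>

definition E_inf :: "'n::finite itself \<Rightarrow> (complex \<Rightarrow> complex) \<Rightarrow> real \<Rightarrow> ereal" where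
  "E_inf N f \<alpha> = (INF u\<in>(M \<alpha> :: (real ^ 'n \<Rightarrow> complex) set). ereal (energy f u))"

definition minimizing_sequence ::
    "(complex \<Rightarrow> complex) \<Rightarrow> real \<Rightarrow> (nat \<Rightarrow> real ^ 'n \<Rightarrow> complex) \<Rightarrow> bool" where
  "minimizing_sequence f \<alpha> u \<longleftrightarrow>
     (\<forall>n. u n \<in> M \<alpha>) \<and> (\<lambda>n. ereal (energy f (u n))) \<longlonglongrightarrow> E_inf TYPE('n) f \<alpha>"

end

theory Submission
  imports Defs "HOL-Complex_Analysis.Great_Picard"
begin

text \<open>
  Write \<open>E \<alpha>\<close> for the infimum of the energy at mass \<open>\<alpha>\<close>, \<open>N\<close> for the dimension and \<open>l = 2 + 4 / N\<close>. The proof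
  is a form of Lions' concentration-compactness argument that avoids weak limits. The
  inequality for the critical power and the compactness both rest on \<open>translation_estimate\<close>: if \<open>u\<close> has the square-integrable
  weak gradient \<open>g\<close>, then the integral of \<open>|u (x + h) - u x|\<^sup>2\<close> is at most \<open>|h|\<^sup>2\<close> times that of \<open>|g|\<^sup>2\<close>.

  The analytic core is \<open>lions_inequality\<close>: if every ball of radius \<open>R\<close> carries at most the mass \<open>\<eta>\<close> of
  \<open>u\<close>, then the integral of \<open>|u|\<^sup>l\<close> is at most \<open>C \<eta>\<^bsup>2/N\<^esup> (\<integral>|g|\<^sup>2 + R\<^bsup>-2\<^esup> \<integral>|u|\<^sup>2)\<close>. Its choices of \<open>\<eta>\<close> and \<open>R\<close> do
  three different jobs. With \<open>\<eta>\<close> the total mass and \<open>R = 1\<close>, the slower growth of \<open>f\<close> than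
  \<open>|z|\<^bsup>l-1\<^esup>\<close> at infinity makes the energy coercive, so \<open>E \<alpha>\<close> is finite (\<open>coercive\<close>). With \<open>R\<close> large it
  shows that a function of negative energy cannot have a small gradient, because \<open>f z / |z|\<close> vanishes
  at the origin (\<open>kinetic_lower_bound\<close>). With \<open>R = 1\<close> and \<open>\<eta>\<close> small it shows that a function of
  negative energy has a fixed amount of mass in some unit ball (\<open>nonvanishing\<close>).

  Subadditivity comes from scaling. Replacing \<open>u x\<close> by \<open>u (t\<^bsup>-1/N\<^esup> x)\<close> with \<open>t > 1\<close> multiplies the mass and
  the potential energy by \<open>t\<close>, but the kinetic energy by a smaller factor. As the kinetic energy of
  almost minimizers is bounded below, \<open>E (t \<alpha>) < t E \<alpha>\<close>. So \<open>E \<alpha> / \<alpha>\<close> is strictly decreasing, and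
  \<open>E (\<alpha> + \<beta>) = \<alpha> E (\<alpha> + \<beta>) / (\<alpha> + \<beta>) + \<beta> E (\<alpha> + \<beta>) / (\<alpha> + \<beta>) < E \<alpha> + E \<beta>\<close>.

  For the compactness, translate a minimizing sequence so that the unit ball at the origin keeps a
  fixed mass. If mass also stayed away from the origin, a smooth cutoff whose transition shell
  carries little energy would split \<open>u\<close> into two pieces, both of mass at most some \<open>\<alpha>' < \<alpha>\<close>, whose
  energies add up to almost \<open>E \<alpha>\<close>; but they are at least \<open>\<alpha> E \<alpha>' / \<alpha>' > E \<alpha>\<close> (\<open>tightness\<close>). Tight
  sequences with bounded gradients have subsequences converging in the space of square-integrable
  functions (\<open>L2_compactness\<close>, from Poincare inequalities on the cells of a grid). The parallelogram
  identity then gives convergence of the gradients: the midpoint of two late members has energy at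
  least \<open>E \<alpha>\<close>, which bounds the gradient of their difference (\<open>gradient_difference_le\<close>). The
  limit in the Sobolev norm is the minimizer.
\<close>

section \<open>Smooth functions\<close>

definition smooth :: "(real ^ 'n \<Rightarrow> real) \<Rightarrow> bool" where
  "smooth \<phi> \<longleftrightarrow> (\<forall>k. C_k k \<phi>)"

lemma smooth_differentiable: "smooth \<phi> \<Longrightarrow> \<phi> differentiable (at x)"
  unfolding smooth_def by (metis C_k.simps(2))

lemma smooth_has_derivative:
  "smooth \<phi> \<Longrightarrow> (\<phi> has_derivative frechet_derivative \<phi> (at x)) (at x)"
  by (simp add: frechet_derivative_works[symmetric] smooth_differentiable)

lemma smooth_continuous: "smooth \<phi> \<Longrightarrow> continuous_on UNIV \<phi>"
  unfolding smooth_def by (metis C_k.simps(1))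

lemma smooth_frechet_derivative:
  "smooth \<phi> \<Longrightarrow> smooth (\<lambda>x. frechet_derivative \<phi> (at x) v)"
  unfolding smooth_def by (metis C_k.simps(2))

text \<open>
  Smoothness is a coinductive notion: a class of differentiable functions that is stable under
  directional derivatives consists of smooth functions.
\<close>

lemma smooth_coinduct:
  assumes "P \<phi>"
    and step: "\<And>\<psi>. P \<psi> \<Longrightarrow> \<exists>D. (\<forall>x. (\<psi> has_derivative (\<lambda>v. D v x)) (at x)) \<and> (\<forall>v. P (D v))"
  shows "smooth \<phi>"
proof -
  have "C_k k \<psi>" if "P \<psi>" for k \<psi>
    using that
  proof (induction k arbitrary: \<psi>)
    case 0
    then obtain D where "\<forall>x. (\<psi> has_derivative (\<lambda>v. D v x)) (at x)" using step by blast
    then show ?case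
      by (auto intro!: continuous_at_imp_continuous_on dest: has_derivative_continuous)
  next
    case (Suc k)
    then obtain D where D: "\<And>x. (\<psi> has_derivative (\<lambda>v. D v x)) (at x)" "\<And>v. P (D v)"
      using step by blast
    have "frechet_derivative \<psi> (at x) v = D v x" for x v
      using frechet_derivative_at[OF D(1)[of x]] by metis
    then show ?case using D Suc.IH by (auto simp: differentiable_def)
  qed
  then show ?thesis using \<open>P \<phi>\<close> by (simp add: smooth_def)
qed

text \<open>
  The powers of \<open>t\<close> in the denominator make the family closed under differentiation, up to linear combinations.
\<close>

definition exp_flat :: "nat \<Rightarrow> real \<Rightarrow> real" where
  "exp_flat m t = (if t > 0 then exp (- 1 / t) / t ^ m else 0)"

lemma exp_flat_tendsto_0: "(exp_flat m \<longlongrightarrow> 0) (at 0)"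
proof -
  have "((\<lambda>x::real. x ^ m / exp x) \<longlongrightarrow> 0) at_top"
    by (rule tendsto_power_div_exp_0)
  then have "((\<lambda>t::real. inverse t ^ m / exp (inverse t)) \<longlongrightarrow> 0) (at_right 0)"
    by (rule filterlim_compose[OF _ filterlim_inverse_at_top_right])
  then have right: "(exp_flat m \<longlongrightarrow> 0) (at_right 0)"
    by (rule Lim_transform_eventually)
      (auto simp: exp_flat_def eventually_at_filter exp_minus field_simps intro!: always_eventually)
  have "((\<lambda>t::real. 0::real) \<longlongrightarrow> 0) (at_left 0)" by simp
  then have left: "(exp_flat m \<longlongrightarrow> 0) (at_left 0)"
    by (rule Lim_transform_eventually) (auto simp: exp_flat_def eventually_at_filter)
  show ?thesis using left right by (simp add: filterlim_split_at)
qed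

lemma DERIV_exp_flat:
  "(exp_flat m has_real_derivative (exp_flat (m + 2) t - real m * exp_flat (m + 1) t)) (at t)"
proof -
  consider "t > 0" | "t < 0" | "t = 0" by linarith
  then show ?thesis
  proof cases
    case 1
    have "((\<lambda>t. exp (- 1 / t) / t ^ m) has_real_derivative
        (exp (- 1 / t) * (1 / t\<^sup>2) * t ^ m - exp (- 1 / t) * (real m * t ^ (m - 1))) / (t ^ m * t ^ m)) (at t)"
      using 1 by (auto intro!: derivative_eq_intros simp: power2_eq_square)
    moreover have "(exp (- 1 / t) * (1 / t\<^sup>2) * t ^ m - exp (- 1 / t) * (real m * t ^ (m - 1))) / (t ^ m * t ^ m)
        = exp_flat (m + 2) t - real m * exp_flat (m + 1) t"
    proof -
      have pow: "real m * t ^ (m - 1) = real m * t ^ m / t" using 1 by (cases m) auto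
      show ?thesis unfolding pow using 1 by (simp add: exp_flat_def field_simps power2_eq_square)
    qed
    ultimately have "((\<lambda>t. exp (- 1 / t) / t ^ m) has_real_derivative
        (exp_flat (m + 2) t - real m * exp_flat (m + 1) t)) (at t)" by simp
    then show ?thesis
      by (rule has_field_derivative_transform_within_open[where S = "{0<..}"])
        (use 1 in \<open>auto simp: exp_flat_def\<close>)
  next
    case 2
    have "((\<lambda>t. 0) has_real_derivative 0) (at t)" by simp
    then have "(exp_flat m has_real_derivative 0) (at t)"
      by (rule has_field_derivative_transform_within_open[where S = "{..<0}"])
        (use 2 in \<open>auto simp: exp_flat_def\<close>)
    then show ?thesis using 2 by (simp add: exp_flat_def)
  next
    case 3
    have "((\<lambda>h. (exp_flat m (0 + h) - exp_flat m 0) / h) \<longlongrightarrow> 0) (at 0)"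
      using exp_flat_tendsto_0[of "Suc m"]
      by (rule Lim_transform_eventually) (auto simp: exp_flat_def fun_eq_iff)
    then show ?thesis using 3 by (simp add: DERIV_def exp_flat_def)
  qed
qed

lemma exp_flat_nonneg: "exp_flat 0 t \<ge> 0"
  and exp_flat_le_1: "exp_flat 0 t \<le> 1"
  and exp_flat_pos_iff: "exp_flat 0 t > 0 \<longleftrightarrow> t > 0"
  and exp_flat_nonpos: "t \<le> 0 \<Longrightarrow> exp_flat m t = 0"
  by (auto simp: exp_flat_def)

text \<open>
  A single inductive closure of the smooth functions under all the operations used below. Each
  rule commutes with differentiation up to other members of the closure, so by coinduction the
  closure adds nothing new.
\<close>

inductive smooth_closure :: "(real ^ 'n \<Rightarrow> real) \<Rightarrow> bool" where
  base: "smooth a \<Longrightarrow> smooth_closure a"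
| const: "smooth_closure (\<lambda>_. c)"
| coord: "smooth_closure (\<lambda>x. x $ i)"
| add: "smooth_closure a \<Longrightarrow> smooth_closure b \<Longrightarrow> smooth_closure (\<lambda>x. a x + b x)"
| mult: "smooth_closure a \<Longrightarrow> smooth_closure b \<Longrightarrow> smooth_closure (\<lambda>x. a x * b x)"
| inverse: "smooth_closure a \<Longrightarrow> (\<And>x. a x \<noteq> 0) \<Longrightarrow> smooth_closure (\<lambda>x. inverse (a x))"
| exp_flat: "smooth_closure a \<Longrightarrow> smooth_closure (\<lambda>x. exp_flat m (a x))"
| affine: "smooth_closure a \<Longrightarrow> smooth_closure (\<lambda>x. a (c *\<^sub>R x + y))"

lemma smooth_closure_derivative:
  fixes a :: "real ^ 'n \<Rightarrow> real"
  assumes "smooth_closure a"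
  shows "\<exists>D. (\<forall>x. (a has_derivative (\<lambda>v. D v x)) (at x)) \<and> (\<forall>v. smooth_closure (D v))"
  using assms
proof induction
  case (base a)
  then show ?case
    by (intro exI[of _ "\<lambda>v x. frechet_derivative a (at x) v"])
      (simp add: smooth_has_derivative smooth_closure.base smooth_frechet_derivative)
next
  case (const c)
  then show ?case by (intro exI[of _ "\<lambda>v x. 0"]) (auto intro: smooth_closure.const)
next
  case (coord i)
  have "((\<lambda>x. x $ i) has_derivative (\<lambda>v. v $ i)) (at x)" for x :: "real ^ 'n"
    by (intro bounded_linear_imp_has_derivative bounded_linear_vec_nth)
  then show ?case by (intro exI[of _ "\<lambda>v x. v $ i"]) (auto intro: smooth_closure.const)
next
  case (add a b)
  then obtain D E where
    "\<And>x. (a has_derivative (\<lambda>v. D v x)) (at x)" "\<And>v. smooth_closure (D v)"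
    "\<And>x. (b has_derivative (\<lambda>v. E v x)) (at x)" "\<And>v. smooth_closure (E v)" by blast
  then show ?case
    by (intro exI[of _ "\<lambda>v x. D v x + E v x"]) (auto intro: smooth_closure.add has_derivative_add)
next
  case (mult a b)
  then obtain D E where
    "\<And>x. (a has_derivative (\<lambda>v. D v x)) (at x)" "\<And>v. smooth_closure (D v)"
    "\<And>x. (b has_derivative (\<lambda>v. E v x)) (at x)" "\<And>v. smooth_closure (E v)" by blast
  note DE = this
  have "smooth_closure (\<lambda>x. a x * E v x + D v x * b x)" for v
    by (rule smooth_closure.add[OF smooth_closure.mult[OF mult(1) DE(4)] smooth_closure.mult[OF DE(2) mult(2)]])
  with DE show ?case
    by (intro exI[of _ "\<lambda>v x. a x * E v x + D v x * b x"]) (auto intro: has_derivative_mult)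
next
  case (inverse a)
  then obtain D where
    "\<And>x. (a has_derivative (\<lambda>v. D v x)) (at x)" "\<And>v. smooth_closure (D v)" by blast
  note D = this
  have inv: "smooth_closure (\<lambda>x. inverse (a x))"
    by (rule smooth_closure.inverse[OF inverse(1,2)])
  have "smooth_closure (\<lambda>x. (- 1) * (inverse (a x) * D v x * inverse (a x)))" for v
    by (rule smooth_closure.mult[OF smooth_closure.const smooth_closure.mult[OF smooth_closure.mult[OF inv D(2)] inv]])
  with D inverse(2) show ?case
    by (intro exI[of _ "\<lambda>v x. (- 1) * (inverse (a x) * D v x * inverse (a x))"])
      (auto intro!: Deriv.has_derivative_inverse)
next
  case (exp_flat a m)
  then obtain D where D:
    "\<And>x. (a has_derivative (\<lambda>v. D v x)) (at x)" "\<And>v. smooth_closure (D v)" by blast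
  have "((\<lambda>x. exp_flat m (a x)) has_derivative
      (\<lambda>v. (exp_flat (m + 2) (a x) + (- real m) * exp_flat (m + 1) (a x)) * D v x)) (at x)" for x
    using has_derivative_compose[OF D(1)
        DERIV_exp_flat[of m "a x", unfolded has_field_derivative_def]]
    by simp
  moreover have "smooth_closure (\<lambda>x. (exp_flat (m + 2) (a x) + (- real m) * exp_flat (m + 1) (a x)) * D v x)" for v
    by (rule smooth_closure.mult[OF smooth_closure.add[OF smooth_closure.exp_flat[OF exp_flat(1)]
            smooth_closure.mult[OF smooth_closure.const smooth_closure.exp_flat[OF exp_flat(1)]]] D(2)])
  ultimately show ?case
    by (intro exI[of _ "\<lambda>v x. (exp_flat (m + 2) (a x) + (- real m) * exp_flat (m + 1) (a x)) * D v x"]) blast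
next
  case (affine a c y)
  then obtain D where D:
    "\<And>x. (a has_derivative (\<lambda>v. D v x)) (at x)" "\<And>v. smooth_closure (D v)" by blast
  have lin: "linear (\<lambda>v. D v x)" for x
    using D(1) has_derivative_linear by blast
  have "((\<lambda>x. a (c *\<^sub>R x + y)) has_derivative (\<lambda>v. D (c *\<^sub>R v) (c *\<^sub>R x + y))) (at x)" for x
  proof -
    have "((\<lambda>x. c *\<^sub>R x + y) has_derivative (\<lambda>v. c *\<^sub>R v)) (at x)"
      by (auto intro!: derivative_eq_intros)
    from has_derivative_compose[OF this D(1)] show ?thesis .
  qed
  with smooth_closure.affine[OF D(2), where c = c and y = y] show ?case
    by (intro exI[of _ "\<lambda>v x. D (c *\<^sub>R v) (c *\<^sub>R x + y)"]) blast
qed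

lemma smooth_closure_imp_smooth: "smooth_closure a \<Longrightarrow> smooth a"
  by (erule smooth_coinduct[where P = smooth_closure]) (rule smooth_closure_derivative)

lemma smooth_const: "smooth (\<lambda>_. c)"
  and smooth_coord: "smooth (\<lambda>x. x $ i)"
  by (rule smooth_closure_imp_smooth[OF smooth_closure.const],
      rule smooth_closure_imp_smooth[OF smooth_closure.coord])

lemma smooth_add: "smooth a \<Longrightarrow> smooth b \<Longrightarrow> smooth (\<lambda>x. a x + b x)"
  by (rule smooth_closure_imp_smooth[OF smooth_closure.add[OF smooth_closure.base smooth_closure.base]])

lemma smooth_mult: "smooth a \<Longrightarrow> smooth b \<Longrightarrow> smooth (\<lambda>x. a x * b x)"
  by (rule smooth_closure_imp_smooth[OF smooth_closure.mult[OF smooth_closure.base smooth_closure.base]])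

lemma smooth_inverse: "smooth a \<Longrightarrow> (\<And>x. a x \<noteq> 0) \<Longrightarrow> smooth (\<lambda>x. inverse (a x))"
  by (rule smooth_closure_imp_smooth[OF smooth_closure.inverse[OF smooth_closure.base]])

lemma smooth_exp_flat: "smooth a \<Longrightarrow> smooth (\<lambda>x. exp_flat m (a x))"
  by (rule smooth_closure_imp_smooth[OF smooth_closure.exp_flat[OF smooth_closure.base]])

lemma smooth_affine: "smooth a \<Longrightarrow> smooth (\<lambda>x. a (c *\<^sub>R x + y))"
  by (rule smooth_closure_imp_smooth[OF smooth_closure.affine[OF smooth_closure.base]])

lemma smooth_diff: "smooth a \<Longrightarrow> smooth b \<Longrightarrow> smooth (\<lambda>x. a x - b x)"
  using smooth_add[of a "\<lambda>x. (- 1) * b x"] smooth_mult[OF smooth_const, of b "- 1"] by simp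

lemma smooth_sum: "finite I \<Longrightarrow> (\<And>i. i \<in> I \<Longrightarrow> smooth (a i)) \<Longrightarrow> smooth (\<lambda>x. \<Sum>i\<in>I. a i x)"
  by (induction rule: finite_induct) (auto intro: smooth_const smooth_add)

lemma smooth_prod: "finite I \<Longrightarrow> (\<And>i. i \<in> I \<Longrightarrow> smooth (a i)) \<Longrightarrow> smooth (\<lambda>x. \<Prod>i\<in>I. a i x)"
  by (induction rule: finite_induct) (auto intro: smooth_const smooth_mult)

subsection \<open>Test functions\<close>

lemma test_function_iff: "test_function \<phi> \<longleftrightarrow> smooth \<phi> \<and> compact (closure {x. \<phi> x \<noteq> 0})"
  by (simp add: test_function_def smooth_def)

lemma test_functionI:
  assumes "smooth \<phi>" "compact K" "\<And>x. x \<notin> K \<Longrightarrow> \<phi> x = 0"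
  shows "test_function \<phi>"
proof -
  have "closure {x. \<phi> x \<noteq> 0} \<subseteq> K"
    using assms by (intro closure_minimal) (auto simp: compact_imp_closed)
  then show ?thesis
    using assms bounded_subset[of K] by (simp add: compact_eq_bounded_closed test_function_iff)
qed

lemma test_function_support:
  assumes "test_function \<phi>"
  shows "\<exists>K. compact K \<and> (\<forall>x. x \<notin> K \<longrightarrow> \<phi> x = 0 \<and> (\<forall>v. frechet_derivative \<phi> (at x) v = 0))"
proof (intro exI conjI allI impI)
  let ?K = "closure {x. \<phi> x \<noteq> 0}"
  show "compact ?K" using assms by (simp add: test_function_iff)
  have *: "\<phi> x = 0" if "x \<notin> ?K" for x
    using that closure_subset[of "{x. \<phi> x \<noteq> 0}"] by auto
  fix x v assume x: "x \<notin> ?K"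
  show "\<phi> x = 0" using * x .
  have "(\<phi> has_derivative (\<lambda>v. 0)) (at x)"
  proof (rule has_derivative_transform_within_open[OF has_derivative_const[of 0]])
    show "open (- ?K)" by (rule open_Compl) simp
    show "x \<in> - ?K" using x by simp
    show "0 = \<phi> y" if "y \<in> - ?K" for y
      by (rule sym, rule *) (use that in \<open>unfold Compl_iff\<close>)
  qed
  then have zero: "(\<lambda>v. 0) = frechet_derivative \<phi> (at x)" by (rule frechet_derivative_at)
  show "frechet_derivative \<phi> (at x) v = 0" using fun_cong[OF zero, of v] by simp
qed

lemma test_function_derivative:
  assumes "test_function \<phi>"
  shows "test_function (\<lambda>x. frechet_derivative \<phi> (at x) v)"
proof -
  obtain K where "compact K" "\<And>x. x \<notin> K \<Longrightarrow> \<phi> x = 0"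
    "\<And>x v. x \<notin> K \<Longrightarrow> frechet_derivative \<phi> (at x) v = 0"
    using test_function_support[OF assms] by blast
  then show ?thesis
    using assms by (intro test_functionI) (auto simp: test_function_iff smooth_frechet_derivative)
qed

lemma test_function_mult_smooth:
  assumes "test_function \<phi>" "smooth \<eta>"
  shows "test_function (\<lambda>x. \<phi> x * \<eta> x)"
proof -
  obtain K where "compact K" "\<And>x. x \<notin> K \<Longrightarrow> \<phi> x = 0"
    "\<And>x v. x \<notin> K \<Longrightarrow> frechet_derivative \<phi> (at x) v = 0"
    using test_function_support[OF assms(1)] by blast
  then show ?thesis
    using assms by (intro test_functionI) (auto simp: test_function_iff smooth_mult)
qed

lemma test_function_affine:
  assumes "test_function \<phi>" "c \<noteq> 0"
  shows "test_function (\<lambda>x. \<phi> (c *\<^sub>R x + y))"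
proof -
  obtain K where K: "compact K" "\<And>x. x \<notin> K \<Longrightarrow> \<phi> x = 0"
    "\<And>x v. x \<notin> K \<Longrightarrow> frechet_derivative \<phi> (at x) v = 0"
    using test_function_support[OF assms(1)] by blast
  have "compact ((\<lambda>x. (1 / c) *\<^sub>R x + (- (1 / c) *\<^sub>R y)) ` K)"
    by (intro compact_continuous_image K continuous_intros)
  moreover have "\<phi> (c *\<^sub>R x + y) = 0" if "x \<notin> (\<lambda>x. (1 / c) *\<^sub>R x + (- (1 / c) *\<^sub>R y)) ` K" for x
  proof (rule K(2), rule notI)
    assume "c *\<^sub>R x + y \<in> K"
    moreover have "x = (1 / c) *\<^sub>R (c *\<^sub>R x + y) + (- (1 / c) *\<^sub>R y)"
      using assms(2) by (simp add: algebra_simps)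
    ultimately show False using that by blast
  qed
  ultimately show ?thesis
    using assms by (intro test_functionI) (auto simp: test_function_iff smooth_affine)
qed

lemma frechet_derivative_affine:
  assumes "smooth \<phi>"
  shows "frechet_derivative (\<lambda>x. \<phi> (c *\<^sub>R x + y)) (at x) v = c * frechet_derivative \<phi> (at (c *\<^sub>R x + y)) v"
proof -
  have "((\<lambda>x. c *\<^sub>R x + y) has_derivative (\<lambda>v. c *\<^sub>R v)) (at x)"
    by (auto intro!: derivative_eq_intros)
  from has_derivative_compose[OF this smooth_has_derivative[OF assms]]
  have "frechet_derivative (\<lambda>x. \<phi> (c *\<^sub>R x + y)) (at x) v = frechet_derivative \<phi> (at (c *\<^sub>R x + y)) (c *\<^sub>R v)"
    using frechet_derivative_at by metis
  also have "\<dots> = c * frechet_derivative \<phi> (at (c *\<^sub>R x + y)) v"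
    using linear_frechet_derivative[OF smooth_differentiable[OF assms]]
    by (simp add: linear_cmul)
  finally show ?thesis .
qed

lemma frechet_derivative_mult_smooth:
  assumes "smooth \<phi>" "smooth \<eta>"
  shows "frechet_derivative (\<lambda>x. \<phi> x * \<eta> x) (at x) v
    = \<phi> x * frechet_derivative \<eta> (at x) v + frechet_derivative \<phi> (at x) v * \<eta> x"
  using frechet_derivative_at[OF has_derivative_mult[OF smooth_has_derivative[OF assms(1)]
        smooth_has_derivative[OF assms(2)], of x]] by metis

lemma frechet_derivative_axis:
  assumes "smooth \<phi>"
  shows "frechet_derivative \<phi> (at x) v = (\<Sum>i\<in>UNIV. v $ i * frechet_derivative \<phi> (at x) (axis i 1))"
proof -
  have lin: "linear (frechet_derivative \<phi> (at x))"
    using smooth_differentiable[OF assms] linear_frechet_derivative by blast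
  have "v = (\<Sum>i\<in>UNIV. v $ i *\<^sub>R axis i 1)"
    using basis_expansion[of v] by (simp add: scalar_mult_eq_scaleR)
  then have "frechet_derivative \<phi> (at x) v = frechet_derivative \<phi> (at x) (\<Sum>i\<in>UNIV. v $ i *\<^sub>R axis i 1)"
    by (rule arg_cong)
  also have "\<dots> = (\<Sum>i\<in>UNIV. v $ i * frechet_derivative \<phi> (at x) (axis i 1))"
    by (simp add: linear_sum[OF lin] linear_cmul[OF lin])
  finally show ?thesis .
qed

lemma test_function_bounded:
  assumes "test_function \<phi>"
  obtains B where "B > 0" "\<And>x. \<bar>\<phi> x\<bar> \<le> B"
proof -
  obtain K where K: "compact K" "\<And>x. x \<notin> K \<Longrightarrow> \<phi> x = 0"
    "\<And>x v. x \<notin> K \<Longrightarrow> frechet_derivative \<phi> (at x) v = 0"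
    using test_function_support[OF assms] by blast
  have "compact (\<phi> ` K)"
    using K(1) assms
    by (intro compact_continuous_image continuous_on_subset[OF smooth_continuous])
      (auto simp: test_function_iff)
  then obtain B where "B > 0" "\<And>x. x \<in> K \<Longrightarrow> \<bar>\<phi> x\<bar> \<le> B"
    by (metis bounded_pos compact_imp_bounded image_eqI real_norm_def)
  then have "\<bar>\<phi> x\<bar> \<le> B" for x using K(2)[of x] by (cases "x \<in> K") auto
  with \<open>B > 0\<close> show ?thesis using that by blast
qed

section \<open>Square-integrable functions\<close>

lemma nn_integral_lborel_affine:
  fixes f :: "'a::euclidean_space \<Rightarrow> ennreal"
  assumes [measurable]: "f \<in> borel_measurable borel" and c: "c \<noteq> 0"
  shows "(\<integral>\<^sup>+x. f x \<partial>lborel) = ennreal (\<bar>c\<bar> ^ DIM('a)) * (\<integral>\<^sup>+x. f (t + c *\<^sub>R x) \<partial>lborel)"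
  by (subst lborel_affine[OF c, of t])
     (simp add: nn_integral_density nn_integral_distr nn_integral_cmult)

lemma nn_integral_lborel_translation:
  fixes f :: "'a::euclidean_space \<Rightarrow> ennreal"
  assumes "f \<in> borel_measurable borel"
  shows "(\<integral>\<^sup>+x. f (x + t) \<partial>lborel) = (\<integral>\<^sup>+x. f x \<partial>lborel)"
  using nn_integral_lborel_affine[OF assms, of 1 t] by (simp add: add.commute)

lemma integral_lborel_affine:
  fixes f :: "'a::euclidean_space \<Rightarrow> 'b::{banach, second_countable_topology}"
  assumes [measurable]: "f \<in> borel_measurable borel" and c: "c \<noteq> 0"
  shows "(\<integral>x. f x \<partial>lborel) = (\<bar>c\<bar> ^ DIM('a)) *\<^sub>R (\<integral>x. f (t + c *\<^sub>R x) \<partial>lborel)"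
  by (subst lborel_affine[OF c, of t]) (simp add: integral_density integral_distr)

lemma integral_lborel_translation:
  fixes f :: "'a::euclidean_space \<Rightarrow> 'b::{banach, second_countable_topology}"
  assumes "f \<in> borel_measurable borel"
  shows "(\<integral>x. f (x + t) \<partial>lborel) = (\<integral>x. f x \<partial>lborel)"
  using integral_lborel_affine[OF assms, of 1 t] by (simp add: add.commute)

lemma integrable_lborel_affine:
  fixes f :: "'a::euclidean_space \<Rightarrow> 'b::{banach, second_countable_topology}"
  assumes "integrable lborel f" and c: "c \<noteq> 0"
  shows "integrable lborel (\<lambda>x. f (c *\<^sub>R x + t))"
proof -
  have f[measurable]: "f \<in> borel_measurable borel" using assms by auto
  have "ennreal (\<bar>c\<bar> ^ DIM('a)) * (\<integral>\<^sup>+x. norm (f (c *\<^sub>R x + t)) \<partial>lborel) < \<infinity>"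
    using assms nn_integral_lborel_affine[of "\<lambda>x. ennreal (norm (f x))" c t]
    by (simp add: integrable_iff_bounded add.commute)
  then have "(\<integral>\<^sup>+x. norm (f (c *\<^sub>R x + t)) \<partial>lborel) < \<infinity>"
    using c by (auto simp: ennreal_mult_less_top)
  then show ?thesis by (simp add: integrable_iff_bounded)
qed

definition sq_int :: "(real ^ 'n \<Rightarrow> 'b::euclidean_space) \<Rightarrow> real" where
  "sq_int u = (LINT x|lborel. (norm (u x))\<^sup>2)"

lemma sq_int_nonneg [simp]: "0 \<le> sq_int u"
  by (simp add: sq_int_def)

lemma L2_measurable [measurable_dest]: "u \<in> L2 \<Longrightarrow> u \<in> borel_measurable borel"
  by (simp add: L2_def)

lemma L2_integrable: "u \<in> L2 \<Longrightarrow> integrable lborel (\<lambda>x. (norm (u x))\<^sup>2)"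
  by (simp add: L2_def)

lemma nn_integral_L2:
  "u \<in> L2 \<Longrightarrow> (\<integral>\<^sup>+x. ennreal ((norm (u x))\<^sup>2) \<partial>lborel) = ennreal (sq_int u)"
  unfolding sq_int_def by (intro nn_integral_eq_integral L2_integrable) auto

lemma L2_nn_integralI:
  assumes [measurable]: "u \<in> borel_measurable borel"
    and le: "(\<integral>\<^sup>+x. ennreal ((norm (u x))\<^sup>2) \<partial>lborel) \<le> ennreal c" and c: "0 \<le> c"
  shows "u \<in> L2" and "sq_int u \<le> c"
proof -
  have "integrable lborel (\<lambda>x. (norm (u x))\<^sup>2)"
    using le_less_trans[OF le, of \<infinity>] by (intro integrableI_nonneg) auto
  then show u: "u \<in> L2" by (simp add: L2_def)
  show "sq_int u \<le> c" using le c by (simp add: nn_integral_L2[OF u])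
qed

lemma L2_bound:
  assumes "integrable lborel w" "u \<in> borel_measurable borel" "\<And>x. (norm (u x))\<^sup>2 \<le> w x"
  shows "u \<in> L2" "sq_int u \<le> (LINT x|lborel. w x)"
proof -
  have "integrable lborel (\<lambda>x. (norm (u x))\<^sup>2)"
    using assms by (intro Bochner_Integration.integrable_bound[OF assms(1)])
      (auto intro: order_trans[OF _ abs_ge_self])
  then show "u \<in> L2" "sq_int u \<le> (LINT x|lborel. w x)"
    using assms by (auto simp: L2_def sq_int_def intro: integral_mono)
qed

lemma power2_norm_add_le: "(norm (a + b))\<^sup>2 \<le> 2 * (norm a)\<^sup>2 + 2 * (norm b)\<^sup>2"
proof -
  have "(norm (a + b))\<^sup>2 \<le> (norm a + norm b)\<^sup>2"
    by (intro power_mono norm_triangle_ineq) auto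
  also have "\<dots> \<le> 2 * (norm a)\<^sup>2 + 2 * (norm b)\<^sup>2"
    using sum_squares_bound[of "norm a" "norm b"] by (simp add: power2_sum)
  finally show ?thesis .
qed

lemma L2_scaleR:
  assumes "u \<in> L2" shows "(\<lambda>x. c *\<^sub>R u x) \<in> L2" "sq_int (\<lambda>x. c *\<^sub>R u x) = c\<^sup>2 * sq_int u"
  using assms by (auto simp: L2_def sq_int_def power_mult_distrib)

lemma L2_add:
  fixes u v :: "real ^ 'n \<Rightarrow> 'b::euclidean_space"
  assumes [measurable]: "u \<in> L2" "v \<in> L2"
  shows "(\<lambda>x. u x + v x) \<in> L2" "sq_int (\<lambda>x. u x + v x) \<le> 2 * sq_int u + 2 * sq_int v"
proof -
  have "integrable lborel (\<lambda>x. 2 * (norm (u x))\<^sup>2 + 2 * (norm (v x))\<^sup>2)"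
    using L2_integrable[OF assms(1)] L2_integrable[OF assms(2)] by simp
  from L2_bound[OF this _ power2_norm_add_le] show "(\<lambda>x. u x + v x) \<in> L2" "sq_int (\<lambda>x. u x + v x) \<le> 2 * sq_int u + 2 * sq_int v"
    using L2_integrable[OF assms(1)] L2_integrable[OF assms(2)] by (auto simp: sq_int_def)
qed

lemma L2_diff:
  fixes u v :: "real ^ 'n \<Rightarrow> 'b::euclidean_space"
  assumes "u \<in> L2" "v \<in> L2"
  shows "(\<lambda>x. u x - v x) \<in> L2" "sq_int (\<lambda>x. u x - v x) \<le> 2 * sq_int u + 2 * sq_int v"
  using L2_add[OF assms(1) L2_scaleR(1)[OF assms(2), of "- 1"]] L2_scaleR(2)[OF assms(2), of "- 1"]
  by auto

lemma sq_int_parallelogram: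
  fixes u v :: "real ^ 'n \<Rightarrow> 'b::euclidean_space"
  assumes "u \<in> L2" "v \<in> L2"
  shows "sq_int (\<lambda>x. u x + v x) + sq_int (\<lambda>x. u x - v x) = 2 * sq_int u + 2 * sq_int v"
proof -
  have "(norm (u x + v x))\<^sup>2 + (norm (u x - v x))\<^sup>2 = 2 * (norm (u x))\<^sup>2 + 2 * (norm (v x))\<^sup>2" for x
    by (simp add: power2_norm_eq_inner inner_simps inner_commute)
  then have "(LINT x|lborel. (norm (u x + v x))\<^sup>2 + (norm (u x - v x))\<^sup>2)
      = (LINT x|lborel. 2 * (norm (u x))\<^sup>2 + 2 * (norm (v x))\<^sup>2)" by simp
  then show ?thesis
    using assms L2_add(1)[OF assms] L2_diff(1)[OF assms]
    by (simp add: sq_int_def L2_integrable)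
qed

lemma L2_affine:
  fixes u :: "real ^ 'n \<Rightarrow> 'b::euclidean_space"
  assumes "u \<in> L2" "c > 0"
  shows "(\<lambda>x. u (c *\<^sub>R x + y)) \<in> L2" "sq_int u = c ^ CARD('n) * sq_int (\<lambda>x. u (c *\<^sub>R x + y))"
proof -
  show "(\<lambda>x. u (c *\<^sub>R x + y)) \<in> L2"
    using assms integrable_lborel_affine[OF L2_integrable[OF assms(1)], of c y]
    by (auto simp: L2_def)
  show "sq_int u = c ^ CARD('n) * sq_int (\<lambda>x. u (c *\<^sub>R x + y))"
    using integral_lborel_affine[of "\<lambda>x. (norm (u x))\<^sup>2" c y] assms
    by (simp add: sq_int_def L2_measurable add.commute)
qed

lemma L2_integrable_scaleR:
  fixes a :: "real ^ 'n \<Rightarrow> real" and b :: "real ^ 'n \<Rightarrow> 'b::euclidean_space"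
  assumes [measurable]: "a \<in> L2" "b \<in> L2"
  shows "integrable lborel (\<lambda>x. a x *\<^sub>R b x)"
proof (rule Bochner_Integration.integrable_bound)
  show "integrable lborel (\<lambda>x. (norm (a x))\<^sup>2 + (norm (b x))\<^sup>2)"
    by (rule Bochner_Integration.integrable_add[OF L2_integrable[OF assms(1)] L2_integrable[OF assms(2)]])
  show "AE x in lborel. norm (a x *\<^sub>R b x) \<le> norm ((norm (a x))\<^sup>2 + (norm (b x))\<^sup>2)"
  proof (intro AE_I2)
    fix x
    have "0 \<le> \<bar>a x\<bar> * norm (b x)" by simp
    moreover have "2 * (\<bar>a x\<bar> * norm (b x)) \<le> (a x)\<^sup>2 + (norm (b x))\<^sup>2"
      using sum_squares_bound[of "\<bar>a x\<bar>" "norm (b x)"] by simp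
    ultimately show "norm (a x *\<^sub>R b x) \<le> norm ((norm (a x))\<^sup>2 + (norm (b x))\<^sup>2)"
      unfolding norm_scaleR real_norm_def power2_abs by linarith
  qed
qed simp

lemma L2_Cauchy_Schwarz:
  fixes a :: "real ^ 'n \<Rightarrow> real" and b :: "real ^ 'n \<Rightarrow> 'b::euclidean_space"
  assumes [measurable]: "a \<in> L2" "b \<in> L2"
  shows "(norm (LINT x|lborel. a x *\<^sub>R b x))\<^sup>2 \<le> sq_int a * sq_int b"
proof -
  have "ennreal ((norm (LINT x|lborel. a x *\<^sub>R b x))\<^sup>2) \<le> (\<integral>\<^sup>+x. ennreal (norm (a x)) * ennreal (norm (b x)) \<partial>lborel)\<^sup>2"
    using integral_norm_bound_ennreal[OF L2_integrable_scaleR[OF assms]]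
    by (auto simp: ennreal_power[symmetric] ennreal_mult[symmetric] intro!: power_mono)
  also have "\<dots> \<le> (\<integral>\<^sup>+x. (ennreal (norm (a x)))\<^sup>2 \<partial>lborel) * (\<integral>\<^sup>+x. (ennreal (norm (b x)))\<^sup>2 \<partial>lborel)"
    by (intro Cauchy_Schwarz_nn_integral) auto
  also have "\<dots> = ennreal (sq_int a * sq_int b)"
    by (simp only: ennreal_power norm_ge_zero nn_integral_L2[OF assms(1)] nn_integral_L2[OF assms(2)])
      (simp add: ennreal_mult)
  finally show ?thesis by simp
qed

section \<open>Weak gradients\<close>

lemma locally_integrable_measurable:
  fixes u :: "real ^ 'n \<Rightarrow> 'b::euclidean_space"
  assumes "locally_integrable u"
  shows "u \<in> borel_measurable borel"
proof (rule borel_measurable_LIMSEQ_metric)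
  show "(\<lambda>x. indicat_real (cball 0 (real k)) x *\<^sub>R u x) \<in> borel_measurable borel" for k
  proof -
    have "integrable lborel (\<lambda>x. indicat_real (cball 0 (real k)) x *\<^sub>R u x)"
      using assms compact_cball by (auto simp: locally_integrable_def set_integrable_def)
    then show ?thesis by (auto dest: borel_measurable_integrable)
  qed
  show "(\<lambda>k. indicat_real (cball 0 (real k)) x *\<^sub>R u x) \<longlonglongrightarrow> u x" for x
  proof (rule tendsto_eventually)
    obtain k where "norm x \<le> real k" using real_arch_simple by blast
    then show "\<forall>\<^sub>F k in sequentially. indicat_real (cball 0 (real k)) x *\<^sub>R u x = u x"
      by (auto simp: eventually_sequentially indicator_def intro!: exI[of _ k])
  qed
qed

lemma L2_locally_integrable:
  assumes "u \<in> L2" shows "locally_integrable u"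
  unfolding locally_integrable_def set_integrable_def
proof (intro allI impI)
  fix K :: "(real ^ 'a) set" assume K: "compact K"
  then have [measurable]: "K \<in> sets borel" by (simp add: borel_compact)
  have [measurable]: "u \<in> borel_measurable borel" using assms by (rule L2_measurable)
  show "integrable lborel (\<lambda>x. indicat_real K x *\<^sub>R u x)"
  proof (rule Bochner_Integration.integrable_bound)
    show "integrable lborel (\<lambda>x. indicat_real K x + (norm (u x))\<^sup>2)"
      using assms emeasure_compact_finite[OF K]
      by (intro Bochner_Integration.integrable_add L2_integrable integrable_real_indicator)
        auto
    have "t \<le> 1 + t\<^sup>2" for t :: real
      using zero_le_power2[of "t - 1/2"] by (simp add: power2_eq_square algebra_simps)
    then show "AE x in lborel. norm (indicat_real K x *\<^sub>R u x) \<le> norm (indicat_real K x + (norm (u x))\<^sup>2)"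
      by (intro AE_I2) (auto simp: indicator_def)
  qed simp
qed

lemma locally_integrable_bounded_linear:
  assumes "bounded_linear T" "locally_integrable u"
  shows "locally_integrable (\<lambda>x. T (u x))"
proof -
  interpret bounded_linear T by fact
  show ?thesis
    using assms integrable_bounded_linear[OF assms(1)]
    unfolding locally_integrable_def set_integrable_def by (fastforce simp: scaleR)
qed

lemma locally_integrable_nth:
  fixes g :: "real ^ 'n \<Rightarrow> complex ^ 'n"
  shows "locally_integrable g \<Longrightarrow> locally_integrable (\<lambda>x. g x $ i)"
  by (rule locally_integrable_bounded_linear) (rule bounded_linear_vec_nth)

lemma locally_integrable_diff:
  fixes u :: "real ^ 'n \<Rightarrow> 'b::euclidean_space"
  shows "locally_integrable u \<Longrightarrow> locally_integrable v \<Longrightarrow> locally_integrable (\<lambda>x. u x - v x)"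
  by (simp add: locally_integrable_def set_integrable_def scaleR_diff_right)

lemma test_function_measurable:
  "test_function \<phi> \<Longrightarrow> \<phi> \<in> borel_measurable borel"
  by (simp add: borel_measurable_continuous_onI smooth_continuous test_function_iff)

lemma integrable_test_function_scaleR:
  assumes "test_function \<phi>" "locally_integrable w"
  shows "integrable lborel (\<lambda>x. \<phi> x *\<^sub>R w x)"
proof -
  obtain K where K: "compact K" "\<And>x. x \<notin> K \<Longrightarrow> \<phi> x = 0"
    "\<And>x v. x \<notin> K \<Longrightarrow> frechet_derivative \<phi> (at x) v = 0"
    using test_function_support[OF assms(1)] by blast
  obtain B where B: "B > 0" "\<And>x. \<bar>\<phi> x\<bar> \<le> B"
    using test_function_bounded[OF assms(1)] by blast
  have [measurable]: "\<phi> \<in> borel_measurable borel" "w \<in> borel_measurable borel"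
    using assms by (auto intro: test_function_measurable locally_integrable_measurable)
  show ?thesis
  proof (rule Bochner_Integration.integrable_bound)
    show "integrable lborel (\<lambda>x. B *\<^sub>R (indicat_real K x *\<^sub>R w x))"
      using assms(2) K(1) by (intro integrable_scaleR_right) (simp add: locally_integrable_def set_integrable_def)
    show "AE x in lborel. norm (\<phi> x *\<^sub>R w x) \<le> norm (B *\<^sub>R (indicat_real K x *\<^sub>R w x))"
      using B K(2) by (intro AE_I2) (auto simp: indicator_def intro: mult_right_mono)
  qed simp
qed

lemma test_function_L2: "test_function \<phi> \<Longrightarrow> \<phi> \<in> L2"
proof -
  assume t: "test_function \<phi>"
  then have "continuous_on UNIV \<phi>" by (simp add: smooth_continuous test_function_iff)
  then have "locally_integrable \<phi>"
    unfolding locally_integrable_def set_integrable_def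
    by (blast intro: borel_integrable_compact continuous_on_subset)
  from integrable_test_function_scaleR[OF t this] show ?thesis
    using test_function_measurable[OF t] by (simp add: L2_def power2_eq_square)
qed

subsection \<open>The fundamental lemma of the calculus of variations\<close>

text \<open>
  Test functions that increase to the indicator of an open box as \<open>k\<close> grows: each factor is \<open>exp (- 1 / (k q))\<close>
  where the quadratic \<open>q\<close> is positive, that is, where the coordinate lies between its bounds.
\<close>

definition box_bump :: "real ^ 'n \<Rightarrow> real ^ 'n \<Rightarrow> nat \<Rightarrow> real ^ 'n \<Rightarrow> real" where
  "box_bump a b k x = (\<Prod>i\<in>UNIV. exp_flat 0 (real k * ((x $ i - a $ i) * (b $ i - x $ i))))"

lemma box_bump_zero:
  assumes "\<And>i. a $ i < b $ i" "x \<notin> box a b"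
  shows "box_bump a b k x = 0"
proof -
  obtain i where "x $ i \<le> a $ i \<or> b $ i \<le> x $ i"
    using assms(2) by (auto simp: mem_box_cart not_less)
  then have "(x $ i - a $ i) * (b $ i - x $ i) \<le> 0"
    using assms(1)[of i] by (auto simp: mult_le_0_iff)
  then have "exp_flat 0 (real k * ((x $ i - a $ i) * (b $ i - x $ i))) = 0"
    by (intro exp_flat_nonpos) (simp add: mult_nonneg_nonpos)
  then show ?thesis unfolding box_bump_def by (intro prod_zero) auto
qed

lemma test_function_box_bump:
  assumes "\<And>i. a $ i < b $ i"
  shows "test_function (box_bump a b k)"
proof (rule test_functionI)
  show "smooth (box_bump a b k)"
    unfolding box_bump_def
    by (intro smooth_prod smooth_exp_flat smooth_mult smooth_diff smooth_const smooth_coord) simp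
  show "compact (cbox a b)" by simp
  show "box_bump a b k x = 0" if "x \<notin> cbox a b" for x
    using that box_subset_cbox[of a b] by (intro box_bump_zero assms) auto
qed

lemma box_bump_bounds: "0 \<le> box_bump a b k x" "box_bump a b k x \<le> 1"
  unfolding box_bump_def by (auto intro!: prod_nonneg prod_le_1 simp: exp_flat_nonneg exp_flat_le_1)

lemma box_bump_tendsto:
  assumes "\<And>i. a $ i < b $ i"
  shows "(\<lambda>k. box_bump a b k x) \<longlonglongrightarrow> indicator (box a b) x"
proof (cases "x \<in> box a b")
  case True
  have "(\<lambda>k. exp_flat 0 (real k * ((x $ i - a $ i) * (b $ i - x $ i)))) \<longlonglongrightarrow> 1" for i
  proof -
    define c where "c = (x $ i - a $ i) * (b $ i - x $ i)"
    have "c > 0" using True by (auto simp: c_def mem_box_cart)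
    have "(\<lambda>k. exp (- (1 / c) * inverse (real k))) \<longlonglongrightarrow> exp (- (1 / c) * 0)"
      by (intro tendsto_intros lim_inverse_n)
    then have "(\<lambda>k. exp_flat 0 (real k * c)) \<longlonglongrightarrow> exp (- (1 / c) * 0)"
      by (rule Lim_transform_eventually)
        (use \<open>c > 0\<close> in \<open>auto simp: exp_flat_def eventually_sequentially field_simps intro!: exI[of _ 1]\<close>)
    then show ?thesis by (simp add: c_def)
  qed
  then have "(\<lambda>k. box_bump a b k x) \<longlonglongrightarrow> (\<Prod>i\<in>(UNIV::'a set). 1)"
    unfolding box_bump_def by (intro tendsto_prod)
  then show ?thesis using True by simp
next
  case False
  then show ?thesis using box_bump_zero[OF assms False] by simp
qed

text \<open>
  Boxes are stable under intersection and generate the Borel sets, so the integral over every Borel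
  subset of a fixed box vanishes.
\<close>

lemma integral_box_zero_imp_AE_zero:
  fixes w :: "real ^ 'n \<Rightarrow> complex"
  assumes w: "locally_integrable w"
    and zero: "\<And>a b. (LINT x|lborel. indicat_real (box a b) x *\<^sub>R w x) = 0"
  shows "AE x in lborel. w x = 0"
proof -
  have box_int: "integrable lborel (\<lambda>x. indicat_real (box a b) x *\<^sub>R w x)" for a b
  proof -
    have "set_integrable lborel (cbox a b) w" using w by (simp add: locally_integrable_def)
    then have "set_integrable lborel (box a b) w"
      by (rule set_integrable_subset) (auto simp: box_subset_cbox)
    then show ?thesis by (simp add: set_integrable_def)
  qed
  have "AE x in lborel. indicat_real (box a b) x *\<^sub>R w x = 0" for a b
  proof (rule sigma_finite_measure.density_zero[OF sigma_finite_lborel box_int])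
    fix A :: "(real ^ 'n) set" assume "A \<in> sets lborel"
    then have A: "A \<in> sigma_sets UNIV (range (\<lambda>(a, b). box a b))"
      by (simp add: borel_eq_box)
    let ?w = "\<lambda>x. indicat_real (box a b) x *\<^sub>R w x"
    have meas: "S \<in> sets lborel" if "S \<in> sigma_sets UNIV (range (\<lambda>(a, b). box a b :: (real ^ 'n) set))" for S
      using that by (simp add: borel_eq_box)
    have Int: "Int_stable (range (\<lambda>(a, b). box a b :: (real ^ 'n) set))"
      by (auto simp: Int_stable_def box_Int_box)
    have full: "(LINT x|lborel. ?w x) = 0" using zero .
    have sub: "range (\<lambda>(a, b). box a b :: (real ^ 'n) set) \<subseteq> Pow UNIV" by simp
    from Int sub A show "set_lebesgue_integral lborel A ?w = 0"
    proof (induction rule: sigma_sets_induct_disjoint)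
      case (basic S)
      then obtain c d where S: "S = box c d" by auto
      obtain e h where box: "box c d \<inter> box a b = box e h" by (simp add: box_Int_box)
      have "indicat_real S x *\<^sub>R ?w x = indicat_real (box e h) x *\<^sub>R w x" for x
        unfolding box[symmetric] S by (simp add: indicator_inter_arith)
      then show ?case
        unfolding set_lebesgue_integral_def using zero[of e h] by presburger
    next
      case empty then show ?case by (simp add: set_lebesgue_integral_def)
    next
      case (compl S)
      have "indicat_real (UNIV - S) x *\<^sub>R ?w x = ?w x - indicat_real S x *\<^sub>R ?w x" for x
        by (simp add: indicator_def)
      then have "set_lebesgue_integral lborel (UNIV - S) ?w
          = (LINT x|lborel. ?w x) - (LINT x|lborel. indicat_real S x *\<^sub>R ?w x)"
        unfolding set_lebesgue_integral_def
        using integrable_mult_indicator[OF meas[OF compl(1)] box_int] box_int by simp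
      then show ?case using compl full by (simp add: set_lebesgue_integral_def)
    next
      case (union S)
      have Si: "S i \<in> sets lborel" for i
        using union(2) by (intro meas) blast
      have "set_lebesgue_integral lborel (\<Union>i. S i) ?w = (\<Sum>i. set_lebesgue_integral lborel (S i) ?w)"
      proof (rule lebesgue_integral_countable_add)
        show "set_integrable lborel (\<Union>i. S i) ?w"
          unfolding set_integrable_def
          using Si by (intro integrable_mult_indicator box_int sets.countable_UN) auto
      qed (use union(1) Si in \<open>auto simp: disjoint_family_on_def\<close>)
      then show ?case using union by simp
    qed
  qed
  then have "AE x in lborel. \<forall>i::nat. indicat_real (box (- (real i *\<^sub>R One)) (real i *\<^sub>R One)) x *\<^sub>R w x = 0"
    unfolding AE_all_countable by blast
  then show ?thesis
  proof eventually_elim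
    case (elim x)
    obtain i :: nat where "x \<in> box (- (real i *\<^sub>R One)) (real i *\<^sub>R One)"
      using UN_box_eq_UNIV by blast
    with elim[rule_format, of i] show ?case by simp
  qed
qed

theorem fundamental_lemma:
  fixes w :: "real ^ 'n \<Rightarrow> complex"
  assumes w: "locally_integrable w"
    and zero: "\<And>\<phi>. test_function \<phi> \<Longrightarrow> (LINT x|lborel. \<phi> x *\<^sub>R w x) = 0"
  shows "AE x in lborel. w x = 0"
proof (rule integral_box_zero_imp_AE_zero[OF w])
  fix a b :: "real ^ 'n"
  have [measurable]: "w \<in> borel_measurable borel" using w by (rule locally_integrable_measurable)
  show "(LINT x|lborel. indicat_real (box a b) x *\<^sub>R w x) = 0"
  proof (cases "\<forall>i. a $ i < b $ i")
    case False
    then have "box a b = {}" by (auto simp: interval_eq_empty_cart not_less)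
    then show ?thesis by simp
  next
    case True
    note test = test_function_box_bump[OF True[rule_format]]
    have "(\<lambda>k. LINT x|lborel. box_bump a b k x *\<^sub>R w x) \<longlonglongrightarrow> (LINT x|lborel. indicat_real (box a b) x *\<^sub>R w x)"
    proof (rule integral_dominated_convergence)
      show "integrable lborel (\<lambda>x. norm (indicat_real (cbox a b) x *\<^sub>R w x))"
        using w by (intro integrable_norm) (simp add: locally_integrable_def set_integrable_def)
      show "AE x in lborel. (\<lambda>k. box_bump a b k x *\<^sub>R w x) \<longlonglongrightarrow> indicat_real (box a b) x *\<^sub>R w x"
        using box_bump_tendsto[OF True[rule_format]] by (intro AE_I2 tendsto_intros)
      show "AE x in lborel. norm (box_bump a b k x *\<^sub>R w x) \<le> norm (indicat_real (cbox a b) x *\<^sub>R w x)" for k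
      proof (intro AE_I2)
        fix x
        have "\<bar>box_bump a b k x\<bar> \<le> indicat_real (cbox a b) x"
        proof (cases "x \<in> cbox a b")
          case True then show ?thesis using box_bump_bounds[of a b k x] by simp
        next
          case False
          then have "x \<notin> box a b" using box_subset_cbox[of a b] by blast
          then show ?thesis using box_bump_zero[OF True[rule_format], of x k] by simp
        qed
        then show "norm (box_bump a b k x *\<^sub>R w x) \<le> norm (indicat_real (cbox a b) x *\<^sub>R w x)"
          by (simp add: mult_right_mono)
      qed
    qed (use test_function_measurable[OF test] in auto)
    then show ?thesis
      using zero[OF test] by (simp add: LIMSEQ_const_iff)
  qed
qed

subsection \<open>Calculus of weak gradients\<close>

lemma weak_gradient_unique:
  assumes "is_weak_gradient u g" "is_weak_gradient u g'"
  shows "AE x in lborel. g x = g' x"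
proof -
  have "AE x in lborel. g x $ i - g' x $ i = 0" for i
  proof (rule fundamental_lemma)
    have li: "locally_integrable (\<lambda>x. g x $ i)" "locally_integrable (\<lambda>x. g' x $ i)"
      using assms by (auto simp: is_weak_gradient_def intro: locally_integrable_nth)
    then show "locally_integrable (\<lambda>x. g x $ i - g' x $ i)" by (rule locally_integrable_diff)
    fix \<phi> :: "real ^ 'a \<Rightarrow> real" assume \<phi>: "test_function \<phi>"
    have "- (LINT x|lborel. \<phi> x *\<^sub>R (g x $ i)) = - (LINT x|lborel. \<phi> x *\<^sub>R (g' x $ i))"
    proof (rule trans[OF sym])
      show "(LINT x|lborel. frechet_derivative \<phi> (at x) (axis i 1) *\<^sub>R u x)
          = - (LINT x|lborel. \<phi> x *\<^sub>R (g x $ i))"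
        using assms(1) \<phi> by (simp add: is_weak_gradient_def)
      show "(LINT x|lborel. frechet_derivative \<phi> (at x) (axis i 1) *\<^sub>R u x)
          = - (LINT x|lborel. \<phi> x *\<^sub>R (g' x $ i))"
        using assms(2) \<phi> by (simp add: is_weak_gradient_def)
    qed
    then show "(LINT x|lborel. \<phi> x *\<^sub>R (g x $ i - g' x $ i)) = 0"
      using integrable_test_function_scaleR[OF \<phi> li(1)] integrable_test_function_scaleR[OF \<phi> li(2)]
      by (simp add: scaleR_diff_right)
  qed
  then have "AE x in lborel. \<forall>i\<in>UNIV. g x $ i - g' x $ i = 0"
    by (intro AE_finite_allI) auto
  then show ?thesis by eventually_elim (simp add: vec_eq_iff)
qed

text \<open>
  All computations below are done with a square-integrable weak gradient at hand; uniqueness makes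
  the choice made by \<^const>\<open>weak_gradient\<close> irrelevant.
\<close>

definition sobolev :: "(real ^ 'n \<Rightarrow> complex) \<Rightarrow> (real ^ 'n \<Rightarrow> complex ^ 'n) \<Rightarrow> bool" where
  "sobolev u g \<longleftrightarrow> u \<in> L2 \<and> g \<in> L2 \<and> is_weak_gradient u g"

lemma sobolev_L2: "sobolev u g \<Longrightarrow> u \<in> L2" "sobolev u g \<Longrightarrow> g \<in> L2"
  by (auto simp: sobolev_def)

lemma sobolev_H1: "sobolev u g \<Longrightarrow> u \<in> H1"
  by (auto simp: sobolev_def H1_def)

lemma H1_sobolev:
  assumes "u \<in> H1" shows "sobolev u (weak_gradient u)"
proof -
  obtain g where g: "u \<in> L2" "g \<in> L2" "is_weak_gradient u g"
    using assms by (auto simp: H1_def)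
  then have w: "is_weak_gradient u (weak_gradient u)"
    unfolding weak_gradient_def by (metis someI)
  then have m[measurable]: "weak_gradient u \<in> borel_measurable borel"
    by (auto simp: is_weak_gradient_def intro: locally_integrable_measurable)
  have [measurable]: "g \<in> borel_measurable borel" using g by (auto intro: L2_measurable)
  have "integrable lborel (\<lambda>x. (norm (weak_gradient u x))\<^sup>2) \<longleftrightarrow> integrable lborel (\<lambda>x. (norm (g x))\<^sup>2)"
    by (rule integrable_cong_AE) (use weak_gradient_unique[OF w g(3)] in auto)
  then have "weak_gradient u \<in> L2" using g m by (auto simp: L2_def)
  then show ?thesis using g w by (simp add: sobolev_def)
qed

lemma sobolev_weak_gradient:
  assumes "sobolev u g"
  shows "sq_int (weak_gradient u) = sq_int g"
proof -
  have h: "sobolev u (weak_gradient u)" using assms by (intro H1_sobolev sobolev_H1)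
  have [measurable]: "g \<in> borel_measurable borel" "weak_gradient u \<in> borel_measurable borel"
    using assms h by (auto simp: sobolev_def intro: L2_measurable)
  have "AE x in lborel. weak_gradient u x = g x"
    using assms h by (intro weak_gradient_unique) (auto simp: sobolev_def)
  then show ?thesis unfolding sq_int_def by (intro integral_cong_AE) auto
qed

lemma sobolevI:
  assumes "u \<in> L2" "g \<in> L2"
    and "\<And>\<phi> i. test_function \<phi> \<Longrightarrow>
        (LINT x|lborel. frechet_derivative \<phi> (at x) (axis i 1) *\<^sub>R u x)
          = - (LINT x|lborel. \<phi> x *\<^sub>R (g x $ i))"
  shows "sobolev u g"
  using assms by (simp add: sobolev_def is_weak_gradient_def L2_locally_integrable)

lemma sobolevD:
  assumes "sobolev u g" "test_function \<phi>"
  shows "(LINT x|lborel. frechet_derivative \<phi> (at x) (axis i 1) *\<^sub>R u x)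
          = - (LINT x|lborel. \<phi> x *\<^sub>R (g x $ i))"
  using assms by (simp add: sobolev_def is_weak_gradient_def)

lemma sobolev_integrable:
  assumes "sobolev u g" "test_function \<phi>"
  shows "integrable lborel (\<lambda>x. frechet_derivative \<phi> (at x) v *\<^sub>R u x)"
    and "integrable lborel (\<lambda>x. \<phi> x *\<^sub>R u x)"
    and "integrable lborel (\<lambda>x. \<phi> x *\<^sub>R (g x $ i))"
  using assms
  by (auto intro!: integrable_test_function_scaleR test_function_derivative L2_locally_integrable
      locally_integrable_nth simp: sobolev_def)

lemma sobolev_scaleR:
  assumes "sobolev u g" shows "sobolev (\<lambda>x. c *\<^sub>R u x) (\<lambda>x. c *\<^sub>R g x)"
proof (rule sobolevI)
  fix \<phi> :: "real ^ 'a \<Rightarrow> real" and i assume \<phi>: "test_function \<phi>"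
  have "(LINT x|lborel. frechet_derivative \<phi> (at x) (axis i 1) *\<^sub>R (c *\<^sub>R u x))
      = c *\<^sub>R (LINT x|lborel. frechet_derivative \<phi> (at x) (axis i 1) *\<^sub>R u x)"
    by (subst integral_scaleR_right[symmetric]) (simp_all add: mult.commute)
  also have "\<dots> = - (c *\<^sub>R (LINT x|lborel. \<phi> x *\<^sub>R (g x $ i)))"
    by (simp add: sobolevD[OF assms \<phi>])
  also have "c *\<^sub>R (LINT x|lborel. \<phi> x *\<^sub>R (g x $ i)) = (LINT x|lborel. \<phi> x *\<^sub>R ((c *\<^sub>R g x) $ i))"
    by (subst integral_scaleR_right[symmetric]) (simp_all add: mult.commute)
  finally show "(LINT x|lborel. frechet_derivative \<phi> (at x) (axis i 1) *\<^sub>R (c *\<^sub>R u x))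
      = - (LINT x|lborel. \<phi> x *\<^sub>R ((c *\<^sub>R g x) $ i))" .
qed (use assms in \<open>auto intro: L2_scaleR sobolev_L2\<close>)

lemma sobolev_add:
  assumes "sobolev u g" "sobolev v h" shows "sobolev (\<lambda>x. u x + v x) (\<lambda>x. g x + h x)"
proof (rule sobolevI)
  fix \<phi> :: "real ^ 'a \<Rightarrow> real" and i assume \<phi>: "test_function \<phi>"
  show "(LINT x|lborel. frechet_derivative \<phi> (at x) (axis i 1) *\<^sub>R (u x + v x))
      = - (LINT x|lborel. \<phi> x *\<^sub>R ((g x + h x) $ i))"
    using sobolev_integrable[OF assms(1) \<phi>] sobolev_integrable[OF assms(2) \<phi>]
    by (simp add: scaleR_add_right sobolevD[OF assms(1) \<phi>] sobolevD[OF assms(2) \<phi>])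
qed (use assms in \<open>auto intro: L2_add sobolev_L2\<close>)

lemma sobolev_diff:
  assumes "sobolev u g" "sobolev v h" shows "sobolev (\<lambda>x. u x - v x) (\<lambda>x. g x - h x)"
  using sobolev_add[OF assms(1) sobolev_scaleR[OF assms(2), of "- 1"]] by simp

text \<open>
  Testing the rescaled function against \<open>\<phi>\<close> amounts to testing \<open>u\<close> against \<open>\<phi>\<close> composed with the inverse map.
\<close>

lemma sobolev_affine:
  assumes s: "sobolev u g" and c: "c > 0"
  shows "sobolev (\<lambda>x. u (c *\<^sub>R x + y)) (\<lambda>x. c *\<^sub>R g (c *\<^sub>R x + y))"
proof (rule sobolevI)
  fix \<phi> :: "real ^ 'a \<Rightarrow> real" and i assume \<phi>: "test_function \<phi>"
  have [measurable]: "u \<in> borel_measurable borel" "g \<in> borel_measurable borel"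
    using s by (auto intro: L2_measurable simp: sobolev_def)
  have [measurable]: "\<phi> \<in> borel_measurable borel"
    "(\<lambda>x. frechet_derivative \<phi> (at x) (axis i 1)) \<in> borel_measurable borel"
    using \<phi> by (auto intro: test_function_measurable test_function_derivative)
  have gi: "(\<lambda>x. g x $ i) \<in> borel_measurable borel"
    using s by (intro locally_integrable_measurable locally_integrable_nth L2_locally_integrable sobolev_L2)
  note [measurable] = gi
  define \<psi> where "\<psi> = (\<lambda>x. \<phi> ((1 / c) *\<^sub>R x + (- (1 / c) *\<^sub>R y)))"
  have test: "test_function \<psi>" unfolding \<psi>_def using c by (intro test_function_affine \<phi>) auto
  have inv: "(1 / c) *\<^sub>R (y + c *\<^sub>R x) + (- (1 / c) *\<^sub>R y) = x" for x :: "real ^ 'a"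
    using c by (simp add: algebra_simps)
  have d\<psi>: "frechet_derivative \<psi> (at x) v = (1 / c) * frechet_derivative \<phi> (at ((1 / c) *\<^sub>R x + (- (1 / c) *\<^sub>R y))) v" for x v
    unfolding \<psi>_def using \<phi> by (intro frechet_derivative_affine) (simp add: test_function_iff)
  have m: "(\<lambda>x. \<psi> x *\<^sub>R (g x $ i)) \<in> borel_measurable borel"
    "(\<lambda>x. frechet_derivative \<psi> (at x) (axis i 1) *\<^sub>R u x) \<in> borel_measurable borel"
    using test_function_measurable[OF test] test_function_measurable[OF test_function_derivative[OF test]] by auto
  have "(LINT x|lborel. frechet_derivative \<psi> (at x) (axis i 1) *\<^sub>R u x)
      = c ^ CARD('a) *\<^sub>R (LINT x|lborel. frechet_derivative \<psi> (at (y + c *\<^sub>R x)) (axis i 1) *\<^sub>R u (y + c *\<^sub>R x))"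
    using c by (subst integral_lborel_affine[OF m(2), of c y]) simp_all
  also have "\<dots> = c ^ CARD('a) *\<^sub>R (LINT x|lborel. (1 / c) *\<^sub>R (frechet_derivative \<phi> (at x) (axis i 1) *\<^sub>R u (c *\<^sub>R x + y)))"
    unfolding d\<psi> inv by (simp add: add.commute)
  finally have 1: "(LINT x|lborel. frechet_derivative \<psi> (at x) (axis i 1) *\<^sub>R u x)
      = c ^ CARD('a) *\<^sub>R ((1 / c) *\<^sub>R (LINT x|lborel. frechet_derivative \<phi> (at x) (axis i 1) *\<^sub>R u (c *\<^sub>R x + y)))"
    unfolding integral_scaleR_right .
  have "(LINT x|lborel. \<psi> x *\<^sub>R (g x $ i))
      = c ^ CARD('a) *\<^sub>R (LINT x|lborel. \<psi> (y + c *\<^sub>R x) *\<^sub>R (g (y + c *\<^sub>R x) $ i))"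
    using c by (subst integral_lborel_affine[OF m(1), of c y]) simp_all
  then have 2: "(LINT x|lborel. \<psi> x *\<^sub>R (g x $ i))
      = c ^ CARD('a) *\<^sub>R (LINT x|lborel. \<phi> x *\<^sub>R (g (c *\<^sub>R x + y) $ i))"
    unfolding \<psi>_def inv by (simp add: add.commute)
  have "(1 / c) *\<^sub>R (LINT x|lborel. frechet_derivative \<phi> (at x) (axis i 1) *\<^sub>R u (c *\<^sub>R x + y))
      = - (LINT x|lborel. \<phi> x *\<^sub>R (g (c *\<^sub>R x + y) $ i))"
    using sobolevD[OF s test, of i] c
    unfolding 1 2 scaleR_minus_right[symmetric] by (simp only: scaleR_cancel_left) simp
  from arg_cong[OF this, of "\<lambda>t. c *\<^sub>R t"]
  have "(LINT x|lborel. frechet_derivative \<phi> (at x) (axis i 1) *\<^sub>R u (c *\<^sub>R x + y))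
      = - (c *\<^sub>R (LINT x|lborel. \<phi> x *\<^sub>R (g (c *\<^sub>R x + y) $ i)))"
    using c by simp
  also have "c *\<^sub>R (LINT x|lborel. \<phi> x *\<^sub>R (g (c *\<^sub>R x + y) $ i))
      = (LINT x|lborel. \<phi> x *\<^sub>R ((c *\<^sub>R g (c *\<^sub>R x + y)) $ i))"
    by (subst integral_scaleR_right[symmetric]) (simp_all add: mult.commute)
  finally show "(LINT x|lborel. frechet_derivative \<phi> (at x) (axis i 1) *\<^sub>R u (c *\<^sub>R x + y))
      = - (LINT x|lborel. \<phi> x *\<^sub>R ((c *\<^sub>R g (c *\<^sub>R x + y)) $ i))" .
qed (rule L2_affine(1)[OF sobolev_L2(1)[OF s] c]
    L2_scaleR(1)[OF L2_affine(1)[OF sobolev_L2(2)[OF s] c]])+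

lemma sobolev_translation:
  assumes "sobolev u g" shows "sobolev (\<lambda>x. u (x + y)) (\<lambda>x. g (x + y))"
  using sobolev_affine[OF assms, of 1 y] by simp

text \<open>
  The product rule is the product rule for \<open>\<phi> \<eta>\<close>, which is again a test function. The bounds on \<open>\<eta>\<close> and its
  gradient keep the result square-integrable.
\<close>

lemma sobolev_mult_smooth:
  fixes u :: "real ^ 'n \<Rightarrow> complex"
  assumes s: "sobolev u g" and \<eta>: "smooth \<eta>" "\<And>x. \<bar>\<eta> x\<bar> \<le> 1"
    and bound: "\<And>x i. \<bar>frechet_derivative \<eta> (at x) (axis i 1)\<bar> \<le> B"
  shows "sobolev (\<lambda>x. \<eta> x *\<^sub>R u x)
    (\<lambda>x. \<eta> x *\<^sub>R g x + (\<chi> i. frechet_derivative \<eta> (at x) (axis i 1) *\<^sub>R u x))"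
proof (rule sobolevI)
  have [measurable]: "u \<in> borel_measurable borel" "g \<in> borel_measurable borel"
    using s by (auto intro: L2_measurable simp: sobolev_def)
  have d\<eta>[measurable]: "(\<lambda>x. frechet_derivative \<eta> (at x) (axis i 1)) \<in> borel_measurable borel" for i
    using \<eta>(1) by (intro borel_measurable_continuous_onI smooth_continuous smooth_frechet_derivative)
  have \<eta>m[measurable]: "\<eta> \<in> borel_measurable borel"
    using \<eta>(1) by (intro borel_measurable_continuous_onI smooth_continuous)
  have bd: "\<bar>\<eta> x\<bar> * t \<le> t" if "0 \<le> t" for x t
    using mult_right_mono[OF \<eta>(2)[of x] that] by simp
  show "(\<lambda>x. \<eta> x *\<^sub>R u x) \<in> L2"
    using L2_integrable[OF sobolev_L2(1)[OF s]]
    by (rule L2_bound(1)) (auto intro!: power_mono bd)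
  have 1: "(\<lambda>x. \<eta> x *\<^sub>R g x) \<in> L2"
    using L2_integrable[OF sobolev_L2(2)[OF s]]
    by (rule L2_bound(1)) (auto intro!: power_mono bd)
  have 2: "(\<lambda>x. \<chi> i. frechet_derivative \<eta> (at x) (axis i 1) *\<^sub>R u x) \<in> L2"
  proof (rule L2_bound(1))
    show "integrable lborel (\<lambda>x. (real CARD('n) * B\<^sup>2) * (norm (u x))\<^sup>2)"
      using L2_integrable[OF sobolev_L2(1)[OF s]] by simp
    show "(\<lambda>x. \<chi> i. frechet_derivative \<eta> (at x) (axis i 1) *\<^sub>R u x) \<in> borel_measurable borel"
      by (subst borel_measurable_euclidean_space) (auto simp: Basis_vec_def inner_axis)
    fix x
    have "(norm (\<chi> i. frechet_derivative \<eta> (at x) (axis i 1) *\<^sub>R u x))\<^sup>2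
        = (\<Sum>i\<in>UNIV. \<bar>frechet_derivative \<eta> (at x) (axis i 1)\<bar>\<^sup>2 * (norm (u x))\<^sup>2)"
      by (simp add: norm_vec_def L2_set_def sum_nonneg power_mult_distrib)
    also have "\<dots> \<le> (\<Sum>i\<in>(UNIV :: 'n set). B\<^sup>2 * (norm (u x))\<^sup>2)"
      by (intro sum_mono mult_right_mono power_mono bound) auto
    finally show "(norm (\<chi> i. frechet_derivative \<eta> (at x) (axis i 1) *\<^sub>R u x))\<^sup>2
        \<le> (real CARD('n) * B\<^sup>2) * (norm (u x))\<^sup>2" by simp
  qed
  show "(\<lambda>x. \<eta> x *\<^sub>R g x + (\<chi> i. frechet_derivative \<eta> (at x) (axis i 1) *\<^sub>R u x)) \<in> L2"
    using L2_add(1)[OF 1 2] .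
  fix \<phi> :: "real ^ 'n \<Rightarrow> real" and i assume \<phi>: "test_function \<phi>"
  have test: "test_function (\<lambda>x. \<phi> x * \<eta> x)" using \<phi> \<eta> by (intro test_function_mult_smooth)
  have test': "test_function (\<lambda>x. \<phi> x * frechet_derivative \<eta> (at x) (axis i 1))"
    using \<phi> \<eta> by (intro test_function_mult_smooth smooth_frechet_derivative)
  have prod: "frechet_derivative (\<lambda>x. \<phi> x * \<eta> x) (at x) v
    = \<phi> x * frechet_derivative \<eta> (at x) v + frechet_derivative \<phi> (at x) v * \<eta> x" for x v
    using \<phi> \<eta> by (intro frechet_derivative_mult_smooth) (auto simp: test_function_iff)
  have "(LINT x|lborel. frechet_derivative \<phi> (at x) (axis i 1) *\<^sub>R (\<eta> x *\<^sub>R u x))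
      = (LINT x|lborel. frechet_derivative (\<lambda>x. \<phi> x * \<eta> x) (at x) (axis i 1) *\<^sub>R u x
          - (\<phi> x * frechet_derivative \<eta> (at x) (axis i 1)) *\<^sub>R u x)"
    by (simp add: prod scaleR_add_left)
  also have "\<dots> = - (LINT x|lborel. (\<phi> x * \<eta> x) *\<^sub>R (g x $ i))
      - (LINT x|lborel. (\<phi> x * frechet_derivative \<eta> (at x) (axis i 1)) *\<^sub>R u x)"
    using sobolev_integrable(1)[OF s test] sobolev_integrable(2)[OF s test'] sobolevD[OF s test]
    by simp
  also have "\<dots> = - (LINT x|lborel. (\<phi> x * \<eta> x) *\<^sub>R (g x $ i)
      + (\<phi> x * frechet_derivative \<eta> (at x) (axis i 1)) *\<^sub>R u x)"
    using sobolev_integrable(3)[OF s test] sobolev_integrable(2)[OF s test'] by simp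
  finally show "(LINT x|lborel. frechet_derivative \<phi> (at x) (axis i 1) *\<^sub>R (\<eta> x *\<^sub>R u x))
      = - (LINT x|lborel. \<phi> x *\<^sub>R ((\<eta> x *\<^sub>R g x
          + (\<chi> i. frechet_derivative \<eta> (at x) (axis i 1) *\<^sub>R u x)) $ i))"
    by (simp add: scaleR_add_right)
qed

lemma sq_int_nth_le:
  fixes g :: "real ^ 'n \<Rightarrow> complex ^ 'n"
  assumes g: "g \<in> L2"
  shows "(\<lambda>x. g x $ i) \<in> L2" "sq_int (\<lambda>x. g x $ i) \<le> sq_int g"
proof -
  have m: "(\<lambda>x. g x $ i) \<in> borel_measurable borel"
    using g by (intro locally_integrable_measurable locally_integrable_nth L2_locally_integrable)
  have le: "(norm (g x $ i))\<^sup>2 \<le> (norm (g x))\<^sup>2" for x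
    by (intro power_mono Finite_Cartesian_Product.norm_nth_le) auto
  show "(\<lambda>x. g x $ i) \<in> L2" "sq_int (\<lambda>x. g x $ i) \<le> sq_int g"
    using L2_bound[OF L2_integrable[OF g] m le] by (auto simp: sq_int_def)
qed

lemma L2_tendsto_integral:
  fixes w :: "nat \<Rightarrow> real ^ 'n \<Rightarrow> complex"
  assumes a: "a \<in> L2" and w: "\<And>k. w k \<in> L2" and v: "v \<in> L2"
    and lim: "(\<lambda>k. sq_int (\<lambda>x. w k x - v x)) \<longlonglongrightarrow> 0"
  shows "(\<lambda>k. LINT x|lborel. a x *\<^sub>R w k x) \<longlonglongrightarrow> (LINT x|lborel. a x *\<^sub>R v x)"
proof -
  have "(\<lambda>k. (norm ((LINT x|lborel. a x *\<^sub>R w k x) - (LINT x|lborel. a x *\<^sub>R v x)))\<^sup>2) \<longlonglongrightarrow> 0"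
  proof (rule tendsto_sandwich[OF _ _ tendsto_const])
    show "(\<lambda>k. sq_int a * sq_int (\<lambda>x. w k x - v x)) \<longlonglongrightarrow> 0"
      using tendsto_mult_right_zero[OF lim] .
    have "(norm ((LINT x|lborel. a x *\<^sub>R w k x) - (LINT x|lborel. a x *\<^sub>R v x)))\<^sup>2
        \<le> sq_int a * sq_int (\<lambda>x. w k x - v x)" for k
      using L2_Cauchy_Schwarz[OF a L2_diff(1)[OF w v], of k] L2_integrable_scaleR[OF a w]
        L2_integrable_scaleR[OF a v]
      by (simp add: scaleR_diff_right)
    then show "\<forall>\<^sub>F k in sequentially. (norm ((LINT x|lborel. a x *\<^sub>R w k x) - (LINT x|lborel. a x *\<^sub>R v x)))\<^sup>2
        \<le> sq_int a * sq_int (\<lambda>x. w k x - v x)" by simp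
  qed simp
  from tendsto_real_sqrt[OF this]
  have "(\<lambda>k. norm ((LINT x|lborel. a x *\<^sub>R w k x) - (LINT x|lborel. a x *\<^sub>R v x))) \<longlonglongrightarrow> 0"
    by simp
  then show ?thesis by (rule LIM_zero_cancel[OF tendsto_norm_zero_cancel])
qed

text \<open>
  Both sides of the defining identity are continuous in the mean-square sense.
\<close>

lemma sobolev_closed:
  fixes u :: "real ^ 'n \<Rightarrow> complex"
  assumes s: "\<And>k. sobolev (w k) (h k)" and u: "u \<in> L2" and g: "g \<in> L2"
    and lim: "(\<lambda>k. sq_int (\<lambda>x. w k x - u x)) \<longlonglongrightarrow> 0" "(\<lambda>k. sq_int (\<lambda>x. h k x - g x)) \<longlonglongrightarrow> 0"
  shows "sobolev u g"
proof (rule sobolevI[OF u g])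
  fix \<phi> :: "real ^ 'n \<Rightarrow> real" and i assume \<phi>: "test_function \<phi>"
  have 1: "(\<lambda>k. LINT x|lborel. frechet_derivative \<phi> (at x) (axis i 1) *\<^sub>R w k x)
      \<longlonglongrightarrow> (LINT x|lborel. frechet_derivative \<phi> (at x) (axis i 1) *\<^sub>R u x)"
    by (rule L2_tendsto_integral[OF test_function_L2[OF test_function_derivative[OF \<phi>]] sobolev_L2(1)[OF s] u lim(1)])
  have "(\<lambda>k. LINT x|lborel. \<phi> x *\<^sub>R (h k x $ i)) \<longlonglongrightarrow> (LINT x|lborel. \<phi> x *\<^sub>R (g x $ i))"
  proof (rule L2_tendsto_integral[OF test_function_L2[OF \<phi>]])
    show "(\<lambda>k. sq_int (\<lambda>x. h k x $ i - g x $ i)) \<longlonglongrightarrow> 0"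
    proof (rule tendsto_sandwich[OF _ _ tendsto_const lim(2)])
      show "\<forall>\<^sub>F k in sequentially. sq_int (\<lambda>x. h k x $ i - g x $ i) \<le> sq_int (\<lambda>x. h k x - g x)"
        using sq_int_nth_le(2)[OF L2_diff(1)[OF sobolev_L2(2)[OF s] g], of _ i] by simp
    qed simp
    show "(\<lambda>x. h k x $ i) \<in> L2" for k by (rule sq_int_nth_le[OF sobolev_L2(2)[OF s]])
    show "(\<lambda>x. g x $ i) \<in> L2" by (rule sq_int_nth_le[OF g])
  qed
  then have "(\<lambda>k. - (LINT x|lborel. \<phi> x *\<^sub>R (h k x $ i))) \<longlonglongrightarrow> - (LINT x|lborel. \<phi> x *\<^sub>R (g x $ i))"
    by (rule tendsto_minus)
  with 1 show "(LINT x|lborel. frechet_derivative \<phi> (at x) (axis i 1) *\<^sub>R u x) = - (LINT x|lborel. \<phi> x *\<^sub>R (g x $ i))"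
    unfolding sobolevD[OF s \<phi>] by (rule LIMSEQ_unique)
qed

subsection \<open>The translation estimate\<close>

text \<open>
  The integrability needed to interchange the integration along a segment with the one over space,
  for both halves of the proof of the fundamental theorem below.
\<close>

lemma integrable_pair_shifts:
  fixes a :: "real ^ 'n \<Rightarrow> real" and b :: "real ^ 'n \<Rightarrow> complex"
  assumes a: "a \<in> L2" and b: "b \<in> L2"
  shows "integrable (lborel \<Otimes>\<^sub>M lborel)
    (\<lambda>(t::real, x). indicat_real {0..1} t *\<^sub>R (a (x + t *\<^sub>R p) *\<^sub>R b (x + t *\<^sub>R q)))"
proof (rule integrableI_bounded)
  note [measurable] = L2_measurable[OF a] L2_measurable[OF b]
  show "(\<lambda>(t, x). indicat_real {0..1} t *\<^sub>R (a (x + t *\<^sub>R p) *\<^sub>R b (x + t *\<^sub>R q)))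
      \<in> borel_measurable (lborel \<Otimes>\<^sub>M lborel)" by measurable
  have "(\<integral>\<^sup>+ z. ennreal (norm (case z of (t, x) \<Rightarrow> indicat_real {0..1} t *\<^sub>R (a (x + t *\<^sub>R p) *\<^sub>R b (x + t *\<^sub>R q))))
      \<partial>(lborel \<Otimes>\<^sub>M lborel))
      \<le> (\<integral>\<^sup>+ z. (case z of (t, x) \<Rightarrow> indicator {0..1::real} t *
          (ennreal ((norm (a (x + t *\<^sub>R p)))\<^sup>2) + ennreal ((norm (b (x + t *\<^sub>R q)))\<^sup>2))) \<partial>(lborel \<Otimes>\<^sub>M lborel))"
  proof (rule nn_integral_mono, clarify)
    fix t :: real and x
    have "0 \<le> \<bar>a (x + t *\<^sub>R p)\<bar> * norm (b (x + t *\<^sub>R q))" by simp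
    moreover have "2 * (\<bar>a (x + t *\<^sub>R p)\<bar> * norm (b (x + t *\<^sub>R q)))
        \<le> (norm (a (x + t *\<^sub>R p)))\<^sup>2 + (norm (b (x + t *\<^sub>R q)))\<^sup>2"
      using sum_squares_bound[of "\<bar>a (x + t *\<^sub>R p)\<bar>" "norm (b (x + t *\<^sub>R q))"] by simp
    ultimately have "\<bar>a (x + t *\<^sub>R p)\<bar> * norm (b (x + t *\<^sub>R q))
        \<le> (norm (a (x + t *\<^sub>R p)))\<^sup>2 + (norm (b (x + t *\<^sub>R q)))\<^sup>2" by linarith
    then show "ennreal (norm (indicat_real {0..1} t *\<^sub>R (a (x + t *\<^sub>R p) *\<^sub>R b (x + t *\<^sub>R q))))
      \<le> indicator {0..1} t * (ennreal ((norm (a (x + t *\<^sub>R p)))\<^sup>2) + ennreal ((norm (b (x + t *\<^sub>R q)))\<^sup>2))"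
      by (cases "t \<in> {0..1}") (auto simp flip: ennreal_plus)
  qed
  also have "\<dots> = (\<integral>\<^sup>+ t. \<integral>\<^sup>+ x. indicator {0..1::real} t *
          (ennreal ((norm (a (x + t *\<^sub>R p)))\<^sup>2) + ennreal ((norm (b (x + t *\<^sub>R q)))\<^sup>2)) \<partial>lborel \<partial>lborel)"
    by (subst lborel.nn_integral_fst[symmetric]) auto
  also have "\<dots> = (\<integral>\<^sup>+ t. indicator {0..1::real} t * (ennreal (sq_int a) + ennreal (sq_int b)) \<partial>lborel)"
  proof (rule nn_integral_cong)
    fix t :: real
    have A: "(\<integral>\<^sup>+ x. ennreal ((norm (a (x + t *\<^sub>R p)))\<^sup>2) \<partial>lborel) = ennreal (sq_int a)"
      by (rule trans[OF nn_integral_lborel_translation nn_integral_L2[OF a]]) measurable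
    have B: "(\<integral>\<^sup>+ x. ennreal ((norm (b (x + t *\<^sub>R q)))\<^sup>2) \<partial>lborel) = ennreal (sq_int b)"
      by (rule trans[OF nn_integral_lborel_translation nn_integral_L2[OF b]]) measurable
    show "(\<integral>\<^sup>+ x. indicator {0..1::real} t *
          (ennreal ((norm (a (x + t *\<^sub>R p)))\<^sup>2) + ennreal ((norm (b (x + t *\<^sub>R q)))\<^sup>2)) \<partial>lborel)
        = indicator {0..1::real} t * (ennreal (sq_int a) + ennreal (sq_int b))"
      unfolding A[symmetric] B[symmetric]
      by (subst nn_integral_add[symmetric]; (subst nn_integral_cmult)?) auto
  qed
  also have "\<dots> < \<infinity>"
    by (simp add: nn_integral_multc flip: ennreal_plus)
  finally show "(\<integral>\<^sup>+ z. ennreal (norm (case z of (t, x) \<Rightarrow> indicat_real {0..1} t *\<^sub>R (a (x + t *\<^sub>R p) *\<^sub>R b (x + t *\<^sub>R q))))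
      \<partial>(lborel \<Otimes>\<^sub>M lborel)) < \<infinity>" .
qed

lemma Fubini_shifts:
  fixes a :: "real ^ 'n \<Rightarrow> real" and b :: "real ^ 'n \<Rightarrow> complex"
  assumes a: "a \<in> L2" and b: "b \<in> L2"
  shows "(LINT x|lborel. LINT t|lborel. indicat_real {0..1::real} t *\<^sub>R (a (x + t *\<^sub>R p) *\<^sub>R b (x + t *\<^sub>R q)))
    = (LINT t|lborel. indicat_real {0..1::real} t *\<^sub>R (LINT x|lborel. a (x + t *\<^sub>R p) *\<^sub>R b (x + t *\<^sub>R q)))"
  using lborel_pair.Fubini_integral[OF integrable_pair_shifts[OF a b, of p q]]
  unfolding integral_scaleR_right .

definition directional :: "(real ^ 'n \<Rightarrow> complex ^ 'n) \<Rightarrow> real ^ 'n \<Rightarrow> real ^ 'n \<Rightarrow> complex" where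
  "directional g h x = (\<Sum>i\<in>UNIV. h $ i *\<^sub>R (g x $ i))"

lemma norm_directional_le: "(norm (directional g h x))\<^sup>2 \<le> (norm h)\<^sup>2 * (norm (g x))\<^sup>2"
proof -
  have "norm (directional g h x) \<le> (\<Sum>i\<in>UNIV. \<bar>h $ i\<bar> * norm (g x $ i))"
    unfolding directional_def by (rule order_trans[OF norm_sum]) simp
  also have "\<dots> \<le> norm h * norm (g x)"
    unfolding norm_vec_def using L2_set_mult_ineq[of "\<lambda>i. norm (h $ i)" "\<lambda>i. norm (g x $ i)" UNIV] by simp
  finally show ?thesis by (metis norm_ge_zero power_mono power_mult_distrib)
qed

lemma directional_L2:
  fixes g :: "real ^ 'n \<Rightarrow> complex ^ 'n"
  assumes g: "g \<in> L2"
  shows "directional g h \<in> L2" "sq_int (directional g h) \<le> (norm h)\<^sup>2 * sq_int g"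
proof -
  have int: "integrable lborel (\<lambda>x. (norm h)\<^sup>2 * (norm (g x))\<^sup>2)" using L2_integrable[OF g] by simp
  have m: "directional g h \<in> borel_measurable borel"
    unfolding directional_def using L2_measurable[OF sq_int_nth_le(1)[OF g]] by simp
  show "directional g h \<in> L2" "sq_int (directional g h) \<le> (norm h)\<^sup>2 * sq_int g"
    using L2_bound[OF int m norm_directional_le] by (auto simp: sq_int_def)
qed

lemma sobolev_directional:
  fixes u :: "real ^ 'n \<Rightarrow> complex"
  assumes s: "sobolev u g" and \<phi>: "test_function \<phi>"
  shows "(LINT x|lborel. frechet_derivative \<phi> (at x) h *\<^sub>R u x) = - (LINT x|lborel. \<phi> x *\<^sub>R directional g h x)"
proof -
  have "(LINT x|lborel. frechet_derivative \<phi> (at x) h *\<^sub>R u x)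
      = (LINT x|lborel. (\<Sum>i\<in>UNIV. h $ i *\<^sub>R (frechet_derivative \<phi> (at x) (axis i 1) *\<^sub>R u x)))"
    using \<phi> frechet_derivative_axis[of \<phi> _ h] by (simp add: scaleR_sum_left test_function_iff)
  also have "\<dots> = (\<Sum>i\<in>UNIV. h $ i *\<^sub>R (LINT x|lborel. frechet_derivative \<phi> (at x) (axis i 1) *\<^sub>R u x))"
    using sobolev_integrable(1)[OF s \<phi>]
    by (subst Bochner_Integration.integral_sum) (auto simp del: scaleR_scaleR)
  also have "\<dots> = - (\<Sum>i\<in>UNIV. h $ i *\<^sub>R (LINT x|lborel. \<phi> x *\<^sub>R (g x $ i)))"
    by (simp add: sobolevD[OF s \<phi>] sum_negf)
  also have "(\<Sum>i\<in>UNIV. h $ i *\<^sub>R (LINT x|lborel. \<phi> x *\<^sub>R (g x $ i)))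
      = (LINT x|lborel. (\<Sum>i\<in>UNIV. h $ i *\<^sub>R (\<phi> x *\<^sub>R (g x $ i))))"
    using sobolev_integrable(3)[OF s \<phi>]
    by (subst Bochner_Integration.integral_sum) (auto simp del: scaleR_scaleR)
  also have "\<dots> = (LINT x|lborel. \<phi> x *\<^sub>R directional g h x)"
    by (simp add: directional_def scaleR_sum_right mult.commute)
  finally show ?thesis .
qed

definition segment_mean :: "(real ^ 'n \<Rightarrow> complex) \<Rightarrow> real ^ 'n \<Rightarrow> real ^ 'n \<Rightarrow> complex" where
  "segment_mean b h x = (LINT t|lborel. indicat_real {0..1::real} t *\<^sub>R b (x + t *\<^sub>R h))"

lemma segment_mean_measurable:
  assumes "b \<in> L2" shows "segment_mean b h \<in> borel_measurable borel"
proof -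
  note [measurable] = L2_measurable[OF assms]
  have "(\<lambda>x. LINT t|lborel. indicat_real {0..1::real} t *\<^sub>R b (x + t *\<^sub>R h)) \<in> borel_measurable lborel"
    by measurable
  then show ?thesis unfolding segment_mean_def by simp
qed

text \<open>
  Averaging is a contraction: apply the Cauchy--Schwarz inequality on each segment and integrate over
  \<open>x\<close> first.
\<close>

lemma segment_mean_L2:
  fixes b :: "real ^ 'n \<Rightarrow> complex"
  assumes b: "b \<in> L2"
  shows "segment_mean b h \<in> L2" "sq_int (segment_mean b h) \<le> sq_int b"
proof -
  note [measurable] = L2_measurable[OF b] segment_mean_measurable[OF b, of h]
  have point: "ennreal ((norm (segment_mean b h x))\<^sup>2)
      \<le> (\<integral>\<^sup>+t. indicator {0..1::real} t * ennreal ((norm (b (x + t *\<^sub>R h)))\<^sup>2) \<partial>lborel)" for x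
  proof (cases "integrable lborel (\<lambda>t. indicat_real {0..1::real} t *\<^sub>R b (x + t *\<^sub>R h))")
    case True
    have "ennreal (norm (segment_mean b h x))
        \<le> (\<integral>\<^sup>+t. norm (indicat_real {0..1::real} t *\<^sub>R b (x + t *\<^sub>R h)) \<partial>lborel)"
      unfolding segment_mean_def by (rule integral_norm_bound_ennreal[OF True])
    also have "\<dots> = (\<integral>\<^sup>+t. indicator {0..1::real} t * (indicator {0..1::real} t * ennreal (norm (b (x + t *\<^sub>R h)))) \<partial>lborel)"
      by (intro nn_integral_cong) (auto simp: indicator_def)
    finally have "(ennreal (norm (segment_mean b h x)))\<^sup>2
      \<le> (\<integral>\<^sup>+t. indicator {0..1::real} t * (indicator {0..1::real} t * ennreal (norm (b (x + t *\<^sub>R h)))) \<partial>lborel)\<^sup>2"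
      by (intro power_mono) auto
    also have "\<dots> \<le> (\<integral>\<^sup>+t. (indicator {0..1::real} t)\<^sup>2 \<partial>lborel) *
        (\<integral>\<^sup>+t. (indicator {0..1::real} t * ennreal (norm (b (x + t *\<^sub>R h))))\<^sup>2 \<partial>lborel)"
      by (rule Cauchy_Schwarz_nn_integral) auto
    also have "(\<integral>\<^sup>+t. (indicator {0..1::real} t)\<^sup>2 \<partial>lborel) = (\<integral>\<^sup>+t. indicator {0..1::real} t \<partial>lborel)"
      by (intro nn_integral_cong) (auto simp: indicator_def)
    also have "\<dots> = 1" by simp
    also have "(\<integral>\<^sup>+t. (indicator {0..1::real} t * ennreal (norm (b (x + t *\<^sub>R h))))\<^sup>2 \<partial>lborel)
      = (\<integral>\<^sup>+t. indicator {0..1::real} t * ennreal ((norm (b (x + t *\<^sub>R h)))\<^sup>2) \<partial>lborel)"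
      by (intro nn_integral_cong) (auto simp: indicator_def ennreal_power)
    finally show ?thesis by (simp add: ennreal_power)
  qed (simp add: segment_mean_def not_integrable_integral_eq)
  have "(\<integral>\<^sup>+x. ennreal ((norm (segment_mean b h x))\<^sup>2) \<partial>lborel)
      \<le> (\<integral>\<^sup>+x. \<integral>\<^sup>+t. indicator {0..1::real} t * ennreal ((norm (b (x + t *\<^sub>R h)))\<^sup>2) \<partial>lborel \<partial>lborel)"
    by (intro nn_integral_mono point)
  also have "\<dots> = (\<integral>\<^sup>+t. \<integral>\<^sup>+x. indicator {0..1::real} t * ennreal ((norm (b (x + t *\<^sub>R h)))\<^sup>2) \<partial>lborel \<partial>lborel)"
    by (rule lborel_pair.Fubini') measurable
  also have "\<dots> = (\<integral>\<^sup>+t. indicator {0..1::real} t * ennreal (sq_int b) \<partial>lborel)"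
    using nn_integral_lborel_translation[of "\<lambda>x. ennreal ((norm (b x))\<^sup>2)"]
    by (simp add: nn_integral_cmult nn_integral_L2[OF b])
  also have "\<dots> = ennreal (sq_int b)" by (simp add: nn_integral_multc)
  finally show "segment_mean b h \<in> L2" "sq_int (segment_mean b h) \<le> sq_int b"
    by (auto intro: L2_nn_integralI)
qed

text \<open>
  The fundamental theorem of calculus for weak gradients. Tested against \<open>\<phi>\<close>, the left-hand side moves the
  translation onto \<open>\<phi>\<close>, to which the classical theorem applies; the derivative of \<open>\<phi>\<close> along \<open>h\<close> is then
  exchanged for the weak gradient of \<open>u\<close>. The fundamental lemma removes \<open>\<phi>\<close>.
\<close>

lemma sobolev_fundamental_theorem:
  fixes u :: "real ^ 'n \<Rightarrow> complex"
  assumes s: "sobolev u g"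
  shows "AE x in lborel. u (x + h) - u x = segment_mean (directional g h) h x"
proof -
  let ?b = "directional g h"
  have u: "u \<in> L2" and b: "?b \<in> L2" using s by (auto intro: sobolev_L2 directional_L2)
  have uh: "(\<lambda>x. u (x + h)) \<in> L2" using L2_affine(1)[OF u, of 1 h] by simp
  note [measurable] = L2_measurable[OF u] L2_measurable[OF b] segment_mean_measurable[OF b]
  have "AE x in lborel. u (x + h) - u x - segment_mean ?b h x = 0"
  proof (rule fundamental_lemma)
    show "locally_integrable (\<lambda>x. u (x + h) - u x - segment_mean ?b h x)"
      by (intro L2_locally_integrable L2_diff(1) uh u segment_mean_L2 b)
    fix \<phi> :: "real ^ 'n \<Rightarrow> real" assume \<phi>: "test_function \<phi>"
    note [measurable] = test_function_measurable[OF \<phi>] test_function_measurable[OF test_function_derivative[OF \<phi>]]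
    have sm: "smooth \<phi>" using \<phi> by (simp add: test_function_iff)
    have int: "integrable lborel (\<lambda>x. \<phi> x *\<^sub>R u (x + h))" "integrable lborel (\<lambda>x. \<phi> x *\<^sub>R u x)"
      "integrable lborel (\<lambda>x. \<phi> x *\<^sub>R segment_mean ?b h x)"
      by (intro L2_integrable_scaleR test_function_L2 \<phi> uh u segment_mean_L2 b)+
    have shift: "test_function (\<lambda>x. \<phi> (x + y))" for y using test_function_affine[OF \<phi>, of 1 y] by simp
    have int2: "integrable lborel (\<lambda>x. \<phi> (x - h) *\<^sub>R u x)"
      using L2_integrable_scaleR[OF test_function_L2[OF shift[of "- h"]] u] by simp
    have ftc: "\<phi> (x - h) - \<phi> x = (LINT t|lborel. indicat_real {0..1} t *\<^sub>R (- frechet_derivative \<phi> (at (x + t *\<^sub>R (- h))) h))" for x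
    proof -
      have "(LINT t|lborel. indicat_real {0..1} t *\<^sub>R (- frechet_derivative \<phi> (at (x + t *\<^sub>R (- h))) h))
          = \<phi> (x + 1 *\<^sub>R (- h)) - \<phi> (x + 0 *\<^sub>R (- h))"
      proof (rule integral_FTC_Icc[of 0 1 "\<lambda>t. \<phi> (x + t *\<^sub>R (- h))"])
        fix t :: real
        have "((\<lambda>t. x + t *\<^sub>R (- h)) has_derivative (\<lambda>v. v *\<^sub>R (- h))) (at t within {0..1})"
          by (auto intro!: derivative_eq_intros)
        from has_derivative_compose[OF this smooth_has_derivative[OF sm]]
        have "((\<lambda>t. \<phi> (x + t *\<^sub>R (- h))) has_derivative
            (\<lambda>v. frechet_derivative \<phi> (at (x + t *\<^sub>R (- h))) (v *\<^sub>R (- h)))) (at t within {0..1})" .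
        moreover have "frechet_derivative \<phi> (at (x + t *\<^sub>R (- h))) (v *\<^sub>R (- h))
            = v *\<^sub>R (- frechet_derivative \<phi> (at (x + t *\<^sub>R (- h))) h)" for v
          using linear_frechet_derivative[OF smooth_differentiable[OF sm]]
          by (metis linear_cmul linear_neg)
        ultimately show "((\<lambda>t. \<phi> (x + t *\<^sub>R (- h))) has_vector_derivative
            - frechet_derivative \<phi> (at (x + t *\<^sub>R (- h))) h) (at t within {0..1})"
          by (simp add: has_vector_derivative_def)
      next
        show "continuous_on {0..1} (\<lambda>t. - frechet_derivative \<phi> (at (x + t *\<^sub>R (- h))) h)"
          by (intro continuous_intros
              continuous_on_compose2[OF smooth_continuous[OF smooth_frechet_derivative[OF sm]]]) auto
      qed simp
      then show ?thesis by simp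
    qed
    have D: "(\<lambda>x. frechet_derivative \<phi> (at x) h) \<in> L2"
      by (intro test_function_L2 test_function_derivative \<phi>)
    have "(LINT x|lborel. \<phi> x *\<^sub>R u (x + h)) = (LINT x|lborel. \<phi> (x - h) *\<^sub>R u x)"
      using integral_lborel_translation[of "\<lambda>x. \<phi> (x - h) *\<^sub>R u x" h] by simp
    then have "(LINT x|lborel. \<phi> x *\<^sub>R u (x + h)) - (LINT x|lborel. \<phi> x *\<^sub>R u x)
        = (LINT x|lborel. (\<phi> (x - h) - \<phi> x) *\<^sub>R u x)"
      using int int2 by (simp add: scaleR_diff_left)
    also have "\<dots> = (LINT x|lborel. - (LINT t|lborel. indicat_real {0..1} t *\<^sub>R
        (frechet_derivative \<phi> (at (x + t *\<^sub>R (- h))) h *\<^sub>R u (x + t *\<^sub>R 0))))"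
    proof (rule Bochner_Integration.integral_cong[OF refl])
      fix x
      have "integrable lborel (\<lambda>t. indicat_real {0..1} t *\<^sub>R (- frechet_derivative \<phi> (at (x + t *\<^sub>R (- h))) h))"
        by (intro borel_integrable_compact continuous_intros
            continuous_on_compose2[OF smooth_continuous[OF smooth_frechet_derivative[OF sm]]]) auto
      then have "(\<phi> (x - h) - \<phi> x) *\<^sub>R u x
          = (LINT t|lborel. (indicat_real {0..1} t *\<^sub>R (- frechet_derivative \<phi> (at (x + t *\<^sub>R (- h))) h)) *\<^sub>R u x)"
        unfolding ftc by (subst integral_scaleR_left) auto
      then show "(\<phi> (x - h) - \<phi> x) *\<^sub>R u x = - (LINT t|lborel. indicat_real {0..1} t *\<^sub>R
        (frechet_derivative \<phi> (at (x + t *\<^sub>R (- h))) h *\<^sub>R u (x + t *\<^sub>R 0)))"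
        by simp
    qed
    also have "\<dots> = - (LINT t|lborel. indicat_real {0..1} t *\<^sub>R
        (LINT x|lborel. frechet_derivative \<phi> (at (x + t *\<^sub>R (- h))) h *\<^sub>R u (x + t *\<^sub>R 0)))"
      unfolding integral_minus Fubini_shifts[OF D u] ..
    also have "\<dots> = (LINT t|lborel. indicat_real {0..1} t *\<^sub>R (LINT x|lborel. \<phi> (x + t *\<^sub>R 0) *\<^sub>R ?b (x + t *\<^sub>R h)))"
    proof -
      have "(LINT x|lborel. frechet_derivative \<phi> (at (x + t *\<^sub>R (- h))) h *\<^sub>R u (x + t *\<^sub>R 0))
          = - (LINT x|lborel. \<phi> (x + t *\<^sub>R 0) *\<^sub>R ?b (x + t *\<^sub>R h))" for t
      proof -
        have "(LINT x|lborel. frechet_derivative \<phi> (at (x + t *\<^sub>R (- h))) h *\<^sub>R u (x + t *\<^sub>R 0))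
            = (LINT x|lborel. frechet_derivative (\<lambda>x. \<phi> (x + t *\<^sub>R (- h))) (at x) h *\<^sub>R u x)"
          using frechet_derivative_affine[OF sm, of 1 "t *\<^sub>R (- h)"] by simp
        also have "\<dots> = - (LINT x|lborel. \<phi> (x + t *\<^sub>R (- h)) *\<^sub>R ?b x)"
          by (rule sobolev_directional[OF s shift])
        also have "(LINT x|lborel. \<phi> (x + t *\<^sub>R (- h)) *\<^sub>R ?b x) = (LINT x|lborel. \<phi> (x + t *\<^sub>R 0) *\<^sub>R ?b (x + t *\<^sub>R h))"
          using integral_lborel_translation[of "\<lambda>x. \<phi> (x + t *\<^sub>R (- h)) *\<^sub>R ?b x" "t *\<^sub>R h"] by simp
        finally show ?thesis .
      qed
      then show ?thesis by simp
    qed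
    also have "\<dots> = (LINT x|lborel. \<phi> x *\<^sub>R segment_mean ?b h x)"
      unfolding Fubini_shifts[OF test_function_L2[OF \<phi>] b, symmetric] segment_mean_def
      by (simp add: mult.commute flip: integral_scaleR_right)
    finally show "(LINT x|lborel. \<phi> x *\<^sub>R (u (x + h) - u x - segment_mean ?b h x)) = 0"
      using int by (simp add: scaleR_diff_right)
  qed
  then show ?thesis by eventually_elim simp
qed

definition increment :: "real ^ 'n \<Rightarrow> (real ^ 'n \<Rightarrow> 'b::euclidean_space) \<Rightarrow> ennreal" where
  "increment h u = (\<integral>\<^sup>+x. ennreal ((norm (u (x + h) - u x))\<^sup>2) \<partial>lborel)"

theorem translation_estimate:
  fixes u :: "real ^ 'n \<Rightarrow> complex"
  assumes s: "sobolev u g"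
  shows "increment h u \<le> ennreal ((norm h)\<^sup>2 * sq_int g)"
proof -
  let ?b = "directional g h"
  have b: "?b \<in> L2" using s by (auto intro: sobolev_L2 directional_L2)
  have "increment h u = (\<integral>\<^sup>+x. ennreal ((norm (segment_mean ?b h x))\<^sup>2) \<partial>lborel)"
    unfolding increment_def using sobolev_fundamental_theorem[OF s, of h]
    by (intro nn_integral_cong_AE) auto
  also have "\<dots> = ennreal (sq_int (segment_mean ?b h))" by (intro nn_integral_L2 segment_mean_L2 b)
  also have "\<dots> \<le> ennreal ((norm h)\<^sup>2 * sq_int g)"
    using segment_mean_L2(2)[OF b, of h] directional_L2(2)[OF sobolev_L2(2)[OF s], of h]
    by (intro ennreal_leI) linarith
  finally show ?thesis .
qed

section \<open>A local Gagliardo--Nirenberg inequality\<close>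

lemma increment_double:
  fixes u :: "real ^ 'n \<Rightarrow> 'b::euclidean_space"
  assumes [measurable]: "u \<in> borel_measurable borel"
  shows "increment (2 *\<^sub>R h) u \<le> 4 * increment h u"
proof -
  have "increment (2 *\<^sub>R h) u
      \<le> (\<integral>\<^sup>+x. 2 * ennreal ((norm (u ((x + h) + h) - u (x + h)))\<^sup>2) + 2 * ennreal ((norm (u (x + h) - u x))\<^sup>2) \<partial>lborel)"
    unfolding increment_def
  proof (rule nn_integral_mono)
    fix x
    have "(norm (u (x + 2 *\<^sub>R h) - u x))\<^sup>2
        \<le> 2 * (norm (u ((x + h) + h) - u (x + h)))\<^sup>2 + 2 * (norm (u (x + h) - u x))\<^sup>2"
      using power2_norm_add_le[of "u ((x + h) + h) - u (x + h)" "u (x + h) - u x"]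
      by (simp add: add.assoc scaleR_2)
    then show "ennreal ((norm (u (x + 2 *\<^sub>R h) - u x))\<^sup>2)
      \<le> 2 * ennreal ((norm (u ((x + h) + h) - u (x + h)))\<^sup>2) + 2 * ennreal ((norm (u (x + h) - u x))\<^sup>2)"
      by (drule_tac ennreal_leI) (simp add: ennreal_plus ennreal_mult)
  qed
  also have "\<dots> = 2 * (\<integral>\<^sup>+x. ennreal ((norm (u ((x + h) + h) - u (x + h)))\<^sup>2) \<partial>lborel) + 2 * increment h u"
    unfolding increment_def by (subst nn_integral_add) (auto simp: nn_integral_cmult)
  also have "(\<integral>\<^sup>+x. ennreal ((norm (u ((x + h) + h) - u (x + h)))\<^sup>2) \<partial>lborel) = increment h u"
    unfolding increment_def
    by (rule nn_integral_lborel_translation[of "\<lambda>x. ennreal ((norm (u (x + h) - u x))\<^sup>2)"]) measurable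
  also have "2 * increment h u + 2 * increment h u = 4 * increment h u"
    by (simp flip: distrib_right)
  finally show ?thesis .
qed

lemma increment_power2:
  fixes u :: "real ^ 'n \<Rightarrow> 'b::euclidean_space"
  assumes "u \<in> borel_measurable borel"
  shows "increment (2 ^ k *\<^sub>R h) u \<le> ennreal (4 ^ k) * increment h u"
proof (induction k)
  case (Suc k)
  have "increment (2 ^ Suc k *\<^sub>R h) u \<le> 4 * increment (2 ^ k *\<^sub>R h) u"
    using increment_double[OF assms, of "2 ^ k *\<^sub>R h"] by simp
  also have "\<dots> \<le> 4 * (ennreal (4 ^ k) * increment h u)"
    by (intro mult_left_mono Suc) auto
  finally show ?case by (simp add: ennreal_mult mult.assoc)
qed simp

text \<open>
  The part of a value between the levels \<open>s\<close> and \<open>2 s\<close>. With dyadic \<open>s\<close> these parts add up to a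
  truncation of the function, and each of them can be treated on its own length scale.
\<close>

definition layer :: "real \<Rightarrow> real \<Rightarrow> real" where
  "layer s v = min (max (v - s) 0) s"

lemma layer_measurable [measurable]: "layer s \<in> borel_measurable borel"
  unfolding layer_def by measurable

lemma sum_layers:
  assumes "s > 0"
  shows "(\<Sum>j<J. layer (s * 2 ^ j) a) = min (max (a - s) 0) (s * (2 ^ J - 1))"
proof (induction J)
  case 0
  then show ?case by simp
next
  case (Suc J)
  have step: "min (max (a - s) 0) (m - s) + min (max (a - m) 0) m = min (max (a - s) 0) (2 * m - s)"
    if "m \<ge> s" for m
    using that assms by (auto simp: min_def max_def)
  have "s * 2 ^ J \<ge> s * 1" using assms by (intro mult_left_mono) auto
  then show ?case
    using step[of "s * 2 ^ J"] Suc by (simp add: layer_def algebra_simps)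
qed

text \<open>
  The layers are monotone and add up to a truncation, so their differences have equal signs and sum to at
  most \<open>|a - b|\<close>. This is why the gradients of all layers together cost no more than the gradient
  of the function, which yields the critical exponent rather than only smaller ones.
\<close>

lemma sum_layer_diff_squares:
  assumes s: "s > 0"
  shows "(\<Sum>j<J. (layer (s * 2 ^ j) a - layer (s * 2 ^ j) b)\<^sup>2) \<le> (a - b)\<^sup>2"
proof -
  have *: "(\<Sum>j<J. (layer (s * 2 ^ j) a - layer (s * 2 ^ j) b)\<^sup>2) \<le> (a - b)\<^sup>2" if "b \<le> a" for a b
  proof -
    define d where "d j = layer (s * 2 ^ j) a - layer (s * 2 ^ j) b" for j :: nat
    have nonneg: "0 \<le> d j" for j
      using that by (auto simp: d_def layer_def min_def max_def)
    have sum: "(\<Sum>j<J. d j) \<le> a - b" "0 \<le> (\<Sum>j<J. d j)"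
      using that nonneg unfolding d_def sum_subtractf sum_layers[OF s]
      by (auto simp: min_def max_def intro: sum_nonneg)
    have "(\<Sum>j<J. (d j)\<^sup>2) \<le> (\<Sum>j<J. d j * (\<Sum>j<J. d j))"
      unfolding power2_eq_square by (intro sum_mono mult_left_mono member_le_sum nonneg) auto
    also have "\<dots> = (\<Sum>j<J. d j)\<^sup>2" by (simp add: sum_distrib_right power2_eq_square)
    also have "\<dots> \<le> (a - b)\<^sup>2" using sum by (intro power_mono)
    finally show ?thesis by (simp add: d_def)
  qed
  show ?thesis
  proof (cases "b \<le> a")
    case False
    then show ?thesis using *[of a b] by (simp add: power2_commute)
  qed (rule *)
qed

lemma sum_increment_layers:
  fixes v :: "real ^ 'n \<Rightarrow> real"
  assumes [measurable]: "v \<in> borel_measurable borel" and s: "s > 0"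
  shows "(\<Sum>j<J. increment h (\<lambda>x. layer (s * 2 ^ j) (v x))) \<le> increment h v"
proof -
  have "(\<Sum>j<J. increment h (\<lambda>x. layer (s * 2 ^ j) (v x)))
    = (\<integral>\<^sup>+x. ennreal (\<Sum>j<J. (layer (s * 2 ^ j) (v (x + h)) - layer (s * 2 ^ j) (v x))\<^sup>2) \<partial>lborel)"
    unfolding increment_def by (subst nn_integral_sum[symmetric]) (auto simp: sum_ennreal)
  also have "\<dots> \<le> increment h v"
    unfolding increment_def using sum_layer_diff_squares[OF s]
    by (intro nn_integral_mono ennreal_leI) auto
  finally show ?thesis .
qed

abbreviation unit_ball_volume :: "'n::finite itself \<Rightarrow> real" where
  "unit_ball_volume N \<equiv> measure lborel (cball 0 1 :: (real ^ 'n) set)"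

lemma emeasure_cball_finite: "emeasure lborel (cball x r :: 'a::euclidean_space set) < \<infinity>"
  by (intro emeasure_compact_finite compact_cball)

lemma emeasure_unit_ball: "emeasure lborel (cball 0 1 :: (real ^ 'n) set) = ennreal (unit_ball_volume TYPE('n))"
  using emeasure_cball_finite by (intro emeasure_eq_ennreal_measure) (simp add: less_top)

lemma unit_ball_volume_pos: "unit_ball_volume TYPE('n::finite) > 0"
  by (rule content_cball_pos) simp

text \<open>
  A weak-type estimate for one layer. By the local bound on the mass, the set where \<open>v\<close> exceeds \<open>s\<close> fills at
  most half of any ball of radius \<open>\<rho>\<close>. So from any point with \<open>v \<ge> 2 s\<close>, at least half of the
  translations by \<open>\<rho> h\<close> lead to a point with \<open>v \<le> s\<close>, across which the layer jumps by \<open>s\<close>.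
\<close>

lemma layer_measure_bound:
  fixes v :: "real ^ 'n \<Rightarrow> real"
  assumes [measurable]: "v \<in> borel_measurable borel" and s: "s > 0" and \<rho>: "\<rho> > 0" and \<eta>: "\<eta> \<ge> 0"
    and local: "\<And>x. (\<integral>\<^sup>+y. indicator (cball x \<rho>) y * ennreal ((v y)\<^sup>2) \<partial>lborel) \<le> ennreal \<eta>"
    and large: "2 * \<eta> \<le> unit_ball_volume TYPE('n) * s\<^sup>2 * \<rho> ^ CARD('n)"
  shows "ennreal (s\<^sup>2 * unit_ball_volume TYPE('n)) * emeasure lborel {x. 2 * s \<le> v x}
    \<le> 2 * (\<integral>\<^sup>+h. indicator (cball 0 1) h * increment (\<rho> *\<^sub>R h) (\<lambda>x. layer s (v x)) \<partial>lborel)"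
proof -
  define \<omega> where "\<omega> = unit_ball_volume TYPE('n)"
  let ?B = "cball 0 1 :: (real ^ 'n) set"
  have [measurable]: "?B \<in> sets borel" by simp
  have \<omega>: "\<omega> > 0" unfolding \<omega>_def by (rule unit_ball_volume_pos)
  have emB: "emeasure lborel ?B = ennreal \<omega>" unfolding \<omega>_def by (rule emeasure_unit_ball)
  define low where "low x = (\<integral>\<^sup>+h. indicator ?B h * indicator {..s} (v (x + \<rho> *\<^sub>R h)) \<partial>lborel)" for x
  \<comment> \<open>around every point, at least half of the ball of radius \<open>\<rho>\<close> lies below the level \<open>s\<close>\<close>
  have half: "ennreal (\<omega> / 2) \<le> low x" for x
  proof -
    have "ennreal \<eta> \<ge> (\<integral>\<^sup>+y. indicator (cball x \<rho>) y * ennreal ((v y)\<^sup>2) \<partial>lborel)" by (rule local)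
    also have "(\<integral>\<^sup>+y. indicator (cball x \<rho>) y * ennreal ((v y)\<^sup>2) \<partial>lborel)
      = ennreal (\<rho> ^ CARD('n)) * (\<integral>\<^sup>+h. indicator (cball x \<rho>) (x + \<rho> *\<^sub>R h) * ennreal ((v (x + \<rho> *\<^sub>R h))\<^sup>2) \<partial>lborel)"
    proof (rule nn_integral_lborel_affine[where c = \<rho> and t = x, THEN trans])
      have "(\<lambda>y. indicator (cball x \<rho>) y :: ennreal) \<in> borel_measurable borel"
        by (intro borel_measurable_indicator) simp
      then show "(\<lambda>y. indicator (cball x \<rho>) y * ennreal ((v y)\<^sup>2)) \<in> borel_measurable borel"
        by measurable
    qed (use \<rho> in auto)
    also have "(\<integral>\<^sup>+h. indicator (cball x \<rho>) (x + \<rho> *\<^sub>R h) * ennreal ((v (x + \<rho> *\<^sub>R h))\<^sup>2) \<partial>lborel)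
      = (\<integral>\<^sup>+h. indicator ?B h * ennreal ((v (x + \<rho> *\<^sub>R h))\<^sup>2) \<partial>lborel)"
      using \<rho> by (intro nn_integral_cong) (auto simp: indicator_def dist_norm)
    finally have 1: "ennreal (\<rho> ^ CARD('n)) * (\<integral>\<^sup>+h. indicator ?B h * ennreal ((v (x + \<rho> *\<^sub>R h))\<^sup>2) \<partial>lborel) \<le> ennreal \<eta>" .
    have "ennreal (s\<^sup>2) * (\<integral>\<^sup>+h. indicator ?B h * indicator {s<..} (v (x + \<rho> *\<^sub>R h)) \<partial>lborel)
      \<le> (\<integral>\<^sup>+h. indicator ?B h * ennreal ((v (x + \<rho> *\<^sub>R h))\<^sup>2) \<partial>lborel)"
      using s by (subst nn_integral_cmult[symmetric])
        (auto intro!: nn_integral_mono ennreal_leI power_mono simp: indicator_def)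
    then have "ennreal (\<rho> ^ CARD('n)) * (ennreal (s\<^sup>2) * (\<integral>\<^sup>+h. indicator ?B h * indicator {s<..} (v (x + \<rho> *\<^sub>R h)) \<partial>lborel))
        \<le> ennreal \<eta>"
      using 1 by (meson mult_left_mono order_trans zero_le)
    also have "ennreal \<eta> \<le> ennreal (\<rho> ^ CARD('n)) * (ennreal (s\<^sup>2) * ennreal (\<omega> / 2))"
      using large \<rho> \<omega> by (subst ennreal_mult[symmetric], simp, simp, subst ennreal_mult[symmetric])
        (auto intro!: ennreal_leI simp: \<omega>_def mult_ac)
    finally have "ennreal (\<rho> ^ CARD('n) * s\<^sup>2) * (\<integral>\<^sup>+h. indicator ?B h * indicator {s<..} (v (x + \<rho> *\<^sub>R h)) \<partial>lborel)
        \<le> ennreal (\<rho> ^ CARD('n) * s\<^sup>2) * ennreal (\<omega> / 2)"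
      using \<rho> by (simp add: ennreal_mult mult.assoc)
    then have high: "(\<integral>\<^sup>+h. indicator ?B h * indicator {s<..} (v (x + \<rho> *\<^sub>R h)) \<partial>lborel) \<le> ennreal (\<omega> / 2)"
      using \<rho> s by (subst (asm) ennreal_mult_le_mult_iff) auto
    have "ennreal (\<omega> / 2) + ennreal (\<omega> / 2) = (\<integral>\<^sup>+h. indicator ?B h \<partial>lborel)"
      using \<omega> emB by (simp flip: ennreal_plus)
    also have "\<dots> = (\<integral>\<^sup>+h. indicator ?B h * indicator {..s} (v (x + \<rho> *\<^sub>R h))
        + indicator ?B h * indicator {s<..} (v (x + \<rho> *\<^sub>R h)) \<partial>lborel)"
      by (intro nn_integral_cong) (auto simp: indicator_def)
    also have "\<dots> = low x + (\<integral>\<^sup>+h. indicator ?B h * indicator {s<..} (v (x + \<rho> *\<^sub>R h)) \<partial>lborel)"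
      unfolding low_def by (rule nn_integral_add) measurable
    also have "\<dots> \<le> low x + ennreal (\<omega> / 2)" using high by (rule add_left_mono)
    finally show ?thesis unfolding add.commute[of "low x"] ennreal_add_left_cancel_le by simp
  qed
  have "ennreal (s\<^sup>2 * \<omega>) * emeasure lborel {x. 2 * s \<le> v x}
      = (\<integral>\<^sup>+x. ennreal (s\<^sup>2 * \<omega>) * indicator {x. 2 * s \<le> v x} x \<partial>lborel)"
    by (subst nn_integral_cmult_indicator) auto
  also have "\<dots> = (\<integral>\<^sup>+x. ennreal (s\<^sup>2 * \<omega>) * indicator {2 * s..} (v x) \<partial>lborel)"
    by (intro nn_integral_cong) (auto simp: indicator_def)
  also have "\<dots> \<le> (\<integral>\<^sup>+x. 2 * (ennreal (s\<^sup>2) * (indicator {2 * s..} (v x) * low x)) \<partial>lborel)"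
  proof (rule nn_integral_mono)
    fix x
    have "ennreal (s\<^sup>2 * \<omega>) = 2 * (ennreal (s\<^sup>2) * ennreal (\<omega> / 2))"
      using \<omega> s by (simp add: ennreal_mult'[symmetric] ennreal_mult''[symmetric] flip: ennreal_numeral)
    also have "\<dots> \<le> 2 * (ennreal (s\<^sup>2) * low x)" by (intro mult_left_mono half) auto
    finally show "ennreal (s\<^sup>2 * \<omega>) * indicator {2 * s..} (v x)
        \<le> 2 * (ennreal (s\<^sup>2) * (indicator {2 * s..} (v x) * low x))"
      by (simp add: indicator_def)
  qed
  also have "\<dots> = 2 * (\<integral>\<^sup>+x. \<integral>\<^sup>+h. indicator ?B h * (ennreal (s\<^sup>2) * (indicator {2 * s..} (v x) *
      indicator {..s} (v (x + \<rho> *\<^sub>R h)))) \<partial>lborel \<partial>lborel)"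
    unfolding low_def
    by (simp add: nn_integral_cmult[symmetric] mult_ac)
  also have "\<dots> = 2 * (\<integral>\<^sup>+h. \<integral>\<^sup>+x. indicator ?B h * (ennreal (s\<^sup>2) * (indicator {2 * s..} (v x) *
      indicator {..s} (v (x + \<rho> *\<^sub>R h)))) \<partial>lborel \<partial>lborel)"
    by (subst lborel_pair.Fubini') (auto simp: indicator_def)
  also have "\<dots> \<le> 2 * (\<integral>\<^sup>+h. indicator ?B h * increment (\<rho> *\<^sub>R h) (\<lambda>x. layer s (v x)) \<partial>lborel)"
  proof (intro mult_left_mono nn_integral_mono)
    fix h
    show "(\<integral>\<^sup>+x. indicator ?B h * (ennreal (s\<^sup>2) * (indicator {2 * s..} (v x) *
        indicator {..s} (v (x + \<rho> *\<^sub>R h)))) \<partial>lborel)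
      \<le> indicator ?B h * increment (\<rho> *\<^sub>R h) (\<lambda>x. layer s (v x))"
      unfolding increment_def
    proof (subst nn_integral_cmult[symmetric])
      have "layer s a = s" if "2 * s \<le> a" for a using that s by (auto simp: layer_def)
      moreover have "layer s a = 0" if "a \<le> s" for a using that s by (auto simp: layer_def)
      ultimately show "(\<integral>\<^sup>+x. indicator ?B h * (ennreal (s\<^sup>2) * (indicator {2 * s..} (v x) *
          indicator {..s} (v (x + \<rho> *\<^sub>R h)))) \<partial>lborel)
        \<le> (\<integral>\<^sup>+x. indicator ?B h * ennreal ((norm (layer s (v (x + \<rho> *\<^sub>R h)) - layer s (v x)))\<^sup>2) \<partial>lborel)"
        by (intro nn_integral_mono) (auto simp: indicator_def)
    qed measurable
  qed simp
  finally show ?thesis by (simp add: \<omega>_def)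
qed

definition lions_const :: "'n::finite itself \<Rightarrow> real" where
  "lions_const N = 8 * 4 powr (2 + 4 / real CARD('n)) * (2 / unit_ball_volume N) powr (2 / real CARD('n))"

lemma lions_const_pos: "lions_const TYPE('n::finite) > 0"
  unfolding lions_const_def using unit_ball_volume_pos[where 'n = 'n] by simp

lemma power_powr_two_div:
  fixes R :: real
  assumes "R > 0" "N > 0"
  shows "(R ^ N) powr (2 / real N) = R\<^sup>2"
proof -
  have "(R ^ N) powr (2 / real N) = R powr (real N * (2 / real N))"
    using assms by (simp only: powr_realpow[symmetric] powr_powr)
  also have "real N * (2 / real N) = 2" using assms by simp
  finally show ?thesis using assms by simp
qed

text \<open>
  The weak-type estimates for the levels \<open>s 2\<^sup>j\<close>, summed. The radius \<open>\<rho> j\<close> allowed at level \<open>j\<close> is proportional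
  to \<open>(s 2\<^sup>j)\<^bsup>-2/N\<^esup>\<close>, up to rounding to \<open>R / 2\<^sup>k\<close>; so \<open>(s 2\<^sup>j)\<^sup>2 / (\<rho> j)\<^sup>2\<close> is comparable to
  the power \<open>2 + 4 / N\<close> of the level. The rounding makes all translations multiples of a single small one by
  powers of two, so that \<open>increment_power2\<close> compares them and the layers can be added up.
\<close>

lemma sum_level_sets_bound:
  fixes v :: "real ^ 'n \<Rightarrow> real" and R \<eta> :: real
  defines "\<omega> \<equiv> unit_ball_volume TYPE('n)" and "p \<equiv> 2 / real CARD('n)"
  defines "s \<equiv> sqrt (2 * \<eta> / (\<omega> * R ^ CARD('n)))"
  assumes v[measurable]: "v \<in> borel_measurable borel"
    and incr: "\<And>h. increment h v \<le> ennreal ((norm h)\<^sup>2 * G)" and G: "0 \<le> G"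
    and R: "R > 0" and \<eta>: "\<eta> > 0"
    and local: "\<And>x. (\<integral>\<^sup>+y. indicator (cball x R) y * ennreal ((v y)\<^sup>2) \<partial>lborel) \<le> ennreal \<eta>"
  shows "(\<Sum>j<J. ennreal ((s * 2 ^ j) powr (2 + 2 * p)) * emeasure lborel {x. 2 * (s * 2 ^ j) \<le> v x})
    \<le> ennreal (8 * (2 * \<eta> / \<omega>) powr p * G)"
proof -
  have [measurable]: "cball (0 :: real ^ 'n) 1 \<in> sets borel" by simp
  define N where "N = CARD('n)"
  have N: "N > 0" "p = 2 / real N" by (simp_all add: N_def p_def)
  have \<omega>: "\<omega> > 0" unfolding \<omega>_def by (rule unit_ball_volume_pos)
  have s: "s > 0" "s\<^sup>2 = 2 * \<eta> / (\<omega> * R ^ N)"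
    using \<omega> R \<eta> by (simp_all add: s_def N_def)
  \<comment> \<open>the largest exponent for which the radius \<open>R / 2 ^ k\<close> is admissible at level \<open>j\<close>\<close>
  define k where "k j = 2 * j div N" for j
  define K where "K = k J"
  define \<rho> where "\<rho> j = R / 2 ^ k j" for j
  have \<rho>: "0 < \<rho> j" "\<rho> j \<le> R" for j
    using R by (auto simp: \<rho>_def divide_le_eq intro: mult_left_mono[of 1 "2 ^ k j" R, simplified])
  have kK: "k j \<le> K" if "j < J" for j
    unfolding k_def K_def using that by (intro div_le_mono) auto
  have D: "ennreal ((s * 2 ^ j) powr (2 + 2 * p) * \<omega>) * emeasure lborel {x. 2 * (s * 2 ^ j) \<le> v x}
      \<le> ennreal (8 * s powr (2 * p) * 4 ^ K) *
        (\<integral>\<^sup>+h. indicator (cball 0 1) h * increment ((R / 2 ^ K) *\<^sub>R h) (\<lambda>x. layer (s * 2 ^ j) (v x)) \<partial>lborel)"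
    if j: "j < J" for j
  proof -
    have sj: "s * 2 ^ j > 0" using s by simp
    have loc: "(\<integral>\<^sup>+y. indicator (cball x (\<rho> j)) y * ennreal ((v y)\<^sup>2) \<partial>lborel) \<le> ennreal \<eta>" for x
      by (rule order_trans[OF nn_integral_mono local[of x]])
        (use \<rho>(2)[of j] in \<open>auto simp: indicator_def\<close>)
    have kj: "k j * N \<le> 2 * j" by (simp add: k_def)
    have "(2::real) ^ (k j * N) \<le> 2 ^ (2 * j)" by (rule power_increasing[OF kj]) simp
    then have "1 \<le> (4::real) ^ j / (2 ^ k j) ^ N" by (simp add: power_mult)
    then have "2 * \<eta> * 1 \<le> 2 * \<eta> * (4 ^ j / (2 ^ k j) ^ N)" using \<eta> by (intro mult_left_mono) auto
    also have "\<dots> = \<omega> * (s * 2 ^ j)\<^sup>2 * \<rho> j ^ N"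
    proof -
      have pj: "(2 ^ j)\<^sup>2 = (4::real) ^ j" by (simp add: power2_eq_square flip: power_mult_distrib)
      show ?thesis
        unfolding \<rho>_def power_mult_distrib power_divide pj s(2) using \<omega> R by simp
    qed
    finally have large: "2 * \<eta> \<le> unit_ball_volume TYPE('n) * (s * 2 ^ j)\<^sup>2 * \<rho> j ^ CARD('n)"
      by (simp add: \<omega>_def N_def)
    let ?I = "\<lambda>h. increment h (\<lambda>x. layer (s * 2 ^ j) (v x))"
    have step1: "ennreal ((s * 2 ^ j)\<^sup>2 * \<omega>) * emeasure lborel {x. 2 * (s * 2 ^ j) \<le> v x}
        \<le> 2 * (\<integral>\<^sup>+h. indicator (cball 0 1) h * ?I (\<rho> j *\<^sub>R h) \<partial>lborel)"
      unfolding \<omega>_def by (rule layer_measure_bound[OF v sj \<rho>(1) less_imp_le[OF \<eta>] loc large])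
    have step2: "?I (\<rho> j *\<^sub>R h) \<le> ennreal (4 ^ (K - k j)) * ?I ((R / 2 ^ K) *\<^sub>R h)" for h
    proof -
      have "2 ^ (K - k j) *\<^sub>R ((R / 2 ^ K) *\<^sub>R h) = \<rho> j *\<^sub>R h"
        using kK[OF j] by (simp add: \<rho>_def power_diff)
      moreover have "(\<lambda>x. layer (s * 2 ^ j) (v x)) \<in> borel_measurable borel" by measurable
      ultimately show ?thesis
        using increment_power2[of "\<lambda>x. layer (s * 2 ^ j) (v x)" "K - k j" "(R / 2 ^ K) *\<^sub>R h"] by metis
    qed
    have "(4::real) powr (real j * p) \<le> 4 powr (real (k j) + 1)"
    proof (rule powr_mono)
      have "2 * j < (k j + 1) * N" unfolding k_def using N(1) by (metis add.commute dividend_less_div_times mult.commute mult_Suc plus_1_eq_Suc)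
      then have "real (2 * j) \<le> real ((k j + 1) * N)" by (intro of_nat_mono less_imp_le)
      then have "real (2 * j) / real N \<le> real (k j) + 1"
        using N(1) by (simp add: pos_divide_le_eq algebra_simps)
      then show "real j * p \<le> real (k j) + 1" by (simp add: N(2) mult.commute)
    qed simp
    also have "\<dots> = 4 * 4 ^ k j" by (simp add: powr_add powr_realpow)
    finally have pow4: "(4::real) powr (real j * p) \<le> 4 * 4 ^ k j" .
    have "(2 ^ j) powr (2 * p) = ((2::real) powr real j) powr (2 * p)" by (simp add: powr_realpow)
    also have "\<dots> = (2 powr 2) powr (real j * p)" unfolding powr_powr by (simp add: mult_ac)
    also have "(2::real) powr 2 = 4" by simp
    finally have pow: "(2 ^ j) powr (2 * p) \<le> (4::real) * 4 ^ k j" using pow4 by simp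
    have "(s * 2 ^ j) powr (2 + 2 * p) = (s * 2 ^ j)\<^sup>2 * (s powr (2 * p) * (2 ^ j) powr (2 * p))"
    proof -
      have "(s * 2 ^ j) powr (2 + 2 * p) = (s * 2 ^ j)\<^sup>2 * (s * 2 ^ j) powr (2 * p)"
        using sj by (simp only: powr_add powr_numeral[OF less_imp_le])
      also have "(s * 2 ^ j) powr (2 * p) = s powr (2 * p) * (2 ^ j) powr (2 * p)"
        using s(1) by (simp add: powr_mult)
      finally show ?thesis .
    qed
    also have "\<dots> \<le> (s * 2 ^ j)\<^sup>2 * (s powr (2 * p) * (4 * 4 ^ k j))"
      using pow by (intro mult_left_mono) auto
    finally have "(s * 2 ^ j) powr (2 + 2 * p) * \<omega> \<le> (s powr (2 * p) * (4 * 4 ^ k j)) * ((s * 2 ^ j)\<^sup>2 * \<omega>)"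
      using \<omega> by (simp add: mult_ac)
    then have "ennreal ((s * 2 ^ j) powr (2 + 2 * p) * \<omega>) * emeasure lborel {x. 2 * (s * 2 ^ j) \<le> v x}
      \<le> ennreal ((s powr (2 * p) * (4 * 4 ^ k j)) * ((s * 2 ^ j)\<^sup>2 * \<omega>)) * emeasure lborel {x. 2 * (s * 2 ^ j) \<le> v x}"
      by (intro mult_right_mono ennreal_leI) auto
    also have "\<dots> = ennreal (s powr (2 * p) * (4 * 4 ^ k j)) *
        (ennreal ((s * 2 ^ j)\<^sup>2 * \<omega>) * emeasure lborel {x. 2 * (s * 2 ^ j) \<le> v x})"
      using \<omega> by (subst ennreal_mult) (auto simp: mult.assoc)
    also have "\<dots> \<le> ennreal (s powr (2 * p) * (4 * 4 ^ k j)) *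
        (2 * (\<integral>\<^sup>+h. indicator (cball 0 1) h * ?I (\<rho> j *\<^sub>R h) \<partial>lborel))"
      by (intro mult_left_mono step1) auto
    also have "\<dots> \<le> ennreal (s powr (2 * p) * (4 * 4 ^ k j)) *
        (2 * (\<integral>\<^sup>+h. ennreal (4 ^ (K - k j)) * (indicator (cball 0 1) h * ?I ((R / 2 ^ K) *\<^sub>R h)) \<partial>lborel))"
      using step2 by (intro mult_left_mono nn_integral_mono) (auto simp: indicator_def)
    also have "\<dots> = ennreal (s powr (2 * p) * (4 * 4 ^ k j)) * (2 * (ennreal (4 ^ (K - k j)) *
        (\<integral>\<^sup>+h. indicator (cball 0 1) h * ?I ((R / 2 ^ K) *\<^sub>R h) \<partial>lborel)))"
      unfolding increment_def by (subst nn_integral_cmult) measurable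
    also have "\<dots> = ennreal ((s powr (2 * p) * (4 * 4 ^ k j)) * (2 * 4 ^ (K - k j))) *
        (\<integral>\<^sup>+h. indicator (cball 0 1) h * ?I ((R / 2 ^ K) *\<^sub>R h) \<partial>lborel)"
    proof -
      have "ennreal a * (2 * (ennreal b * X)) = ennreal (a * (2 * b)) * X" if "0 \<le> a" "0 \<le> b" for a b X
        using that by (simp add: ennreal_mult mult_ac)
      then show ?thesis by simp
    qed
    also have "(s powr (2 * p) * (4 * 4 ^ k j)) * (2 * 4 ^ (K - k j)) = 8 * s powr (2 * p) * 4 ^ K"
      using kK[OF j] by (simp add: power_diff field_simps)
    finally show ?thesis .
  qed
  have "(\<Sum>j<J. ennreal ((s * 2 ^ j) powr (2 + 2 * p)) * emeasure lborel {x. 2 * (s * 2 ^ j) \<le> v x}) * ennreal \<omega>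
      = (\<Sum>j<J. ennreal ((s * 2 ^ j) powr (2 + 2 * p) * \<omega>) * emeasure lborel {x. 2 * (s * 2 ^ j) \<le> v x})"
    unfolding sum_distrib_right
  proof (rule sum.cong[OF refl])
    fix j
    have "ennreal a * X * ennreal \<omega> = ennreal (a * \<omega>) * X" if "0 \<le> a" for a X
      using that \<omega> by (simp add: ennreal_mult mult_ac)
    then show "ennreal ((s * 2 ^ j) powr (2 + 2 * p)) * emeasure lborel {x. 2 * (s * 2 ^ j) \<le> v x} * ennreal \<omega>
      = ennreal ((s * 2 ^ j) powr (2 + 2 * p) * \<omega>) * emeasure lborel {x. 2 * (s * 2 ^ j) \<le> v x}" by simp
  qed
  also have "\<dots> \<le> (\<Sum>j<J. ennreal (8 * s powr (2 * p) * 4 ^ K) *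
        (\<integral>\<^sup>+h. indicator (cball 0 1) h * increment ((R / 2 ^ K) *\<^sub>R h) (\<lambda>x. layer (s * 2 ^ j) (v x)) \<partial>lborel))"
    using D by (intro sum_mono) auto
  also have "\<dots> = ennreal (8 * s powr (2 * p) * 4 ^ K) * (\<integral>\<^sup>+h. indicator (cball 0 1) h *
      (\<Sum>j<J. increment ((R / 2 ^ K) *\<^sub>R h) (\<lambda>x. layer (s * 2 ^ j) (v x))) \<partial>lborel)"
    unfolding sum_distrib_left[symmetric]
    unfolding increment_def by (subst nn_integral_sum[symmetric]) (measurable, simp only: sum_distrib_left)
  also have "\<dots> \<le> ennreal (8 * s powr (2 * p) * 4 ^ K) * (\<integral>\<^sup>+h. indicator (cball 0 1 :: (real ^ 'n) set) h * ennreal ((R / 2 ^ K)\<^sup>2 * G) \<partial>lborel)"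
  proof (rule mult_left_mono[OF nn_integral_mono])
    fix h :: "real ^ 'n"
    show "indicator (cball 0 1) h * (\<Sum>j<J. increment ((R / 2 ^ K) *\<^sub>R h) (\<lambda>x. layer (s * 2 ^ j) (v x)))
        \<le> indicator (cball 0 1) h * ennreal ((R / 2 ^ K)\<^sup>2 * G)"
    proof (cases "h \<in> cball 0 1")
      case True
      have "(\<Sum>j<J. increment ((R / 2 ^ K) *\<^sub>R h) (\<lambda>x. layer (s * 2 ^ j) (v x))) \<le> increment ((R / 2 ^ K) *\<^sub>R h) v"
        by (rule sum_increment_layers[OF v s(1)])
      also have "\<dots> \<le> ennreal ((norm ((R / 2 ^ K) *\<^sub>R h))\<^sup>2 * G)" by (rule incr)
      also have "\<dots> \<le> ennreal ((R / 2 ^ K)\<^sup>2 * G)"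
      proof (intro ennreal_leI mult_right_mono G power_mono)
        have "norm ((R / 2 ^ K) *\<^sub>R h) = (R / 2 ^ K) * norm h" using R by simp
        also have "\<dots> \<le> (R / 2 ^ K) * 1" using True R by (intro mult_left_mono) auto
        finally show "norm ((R / 2 ^ K) *\<^sub>R h) \<le> R / 2 ^ K" by simp
      qed simp
      finally show ?thesis using True by simp
    qed simp
  qed simp
  also have "\<dots> = ennreal (8 * s powr (2 * p) * 4 ^ K) * (ennreal \<omega> * ennreal ((R / 2 ^ K)\<^sup>2 * G))"
    by (subst nn_integral_multc) (simp_all add: emeasure_unit_ball \<omega>_def)
  also have "\<dots> = ennreal (8 * s powr (2 * p) * 4 ^ K * ((R / 2 ^ K)\<^sup>2 * G)) * ennreal \<omega>"
    using \<omega> G by (subst ennreal_mult) (auto simp: mult_ac)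
  also have "8 * s powr (2 * p) * 4 ^ K * ((R / 2 ^ K)\<^sup>2 * G) = 8 * (s powr (2 * p) * R\<^sup>2) * G"
  proof -
    have "(2 ^ K)\<^sup>2 = (4::real) ^ K" by (simp add: power2_eq_square flip: power_mult_distrib)
    then show ?thesis by (simp only: power_divide) simp
  qed
  also have "s powr (2 * p) * R\<^sup>2 = (2 * \<eta> / \<omega>) powr p"
  proof -
    have "s powr (2 * p) = (s powr 2) powr p" by (simp add: powr_powr)
    then have "s powr (2 * p) = (s\<^sup>2) powr p" using s(1) by simp
    moreover have "R\<^sup>2 = (R ^ N) powr p"
      unfolding N(2) by (rule power_powr_two_div[OF R N(1), symmetric])
    ultimately have "s powr (2 * p) * R\<^sup>2 = (s\<^sup>2 * R ^ N) powr p"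
      using powr_mult[of "s\<^sup>2" "R ^ N" p] R by simp
    also have "s\<^sup>2 * R ^ N = 2 * \<eta> / \<omega>" using R s(2) by simp
    finally show ?thesis .
  qed
  finally show ?thesis
    using \<omega> unfolding mult.commute[of _ "ennreal \<omega>"] by (subst (asm) ennreal_mult_le_mult_iff) auto
qed

text \<open>
  The level sets above \<open>2 s\<close> are controlled by the sum over all dyadic levels; below \<open>2 s\<close> the extra power
  \<open>4 / N\<close> is bounded by that of \<open>2 s\<close>, which produces the term with \<open>R\<^bsup>-2\<^esup>\<close>.
\<close>

theorem lions_inequality_nn:
  fixes v :: "real ^ 'n \<Rightarrow> real" and R \<eta> :: real
  assumes v[measurable]: "v \<in> borel_measurable borel" and nonneg: "\<And>x. 0 \<le> v x"
    and incr: "\<And>h. increment h v \<le> ennreal ((norm h)\<^sup>2 * G)" and G: "0 \<le> G"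
    and R: "R > 0" and \<eta>: "\<eta> > 0"
    and local: "\<And>x. (\<integral>\<^sup>+y. indicator (cball x R) y * ennreal ((v y)\<^sup>2) \<partial>lborel) \<le> ennreal \<eta>"
    and mass: "(\<integral>\<^sup>+x. ennreal ((v x)\<^sup>2) \<partial>lborel) = ennreal m" and m: "0 \<le> m"
  shows "(\<integral>\<^sup>+x. ennreal (v x powr (2 + 4 / real CARD('n))) \<partial>lborel)
    \<le> ennreal (lions_const TYPE('n) * \<eta> powr (2 / real CARD('n)) * (G + m / R\<^sup>2))"
proof -
  define \<omega> where "\<omega> = unit_ball_volume TYPE('n)"
  define N where "N = CARD('n)"
  define p where "p = 2 / real N"
  define s where "s = sqrt (2 * \<eta> / (\<omega> * R ^ N))"
  have l: "2 + 4 / real CARD('n) = 2 + 2 * p" by (simp add: p_def N_def)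
  have N: "N > 0" "p > 0" by (simp_all add: N_def p_def)
  have \<omega>: "\<omega> > 0" unfolding \<omega>_def by (rule unit_ball_volume_pos)
  have s: "s > 0" "s\<^sup>2 = 2 * \<eta> / (\<omega> * R ^ N)" using \<omega> R \<eta> by (simp_all add: s_def)
  let ?V = "\<lambda>j. {x. 2 * (s * 2 ^ j) \<le> v x}"
  have point: "ennreal (v x powr (2 + 2 * p)) \<le> ennreal ((2 * s) powr (2 * p)) * ennreal ((v x)\<^sup>2)
      + (\<Sum>j. ennreal (4 powr (2 + 2 * p)) * (ennreal ((s * 2 ^ j) powr (2 + 2 * p)) * indicator (?V j) x))" for x
  proof (cases "v x < 2 * s")
    case True
    have "v x powr (2 + 2 * p) = v x powr (2 * p) * (v x)\<^sup>2"
      using nonneg[of x] by (cases "v x = 0") (auto simp: powr_add)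
    also have "\<dots> \<le> (2 * s) powr (2 * p) * (v x)\<^sup>2"
      using True nonneg[of x] N by (intro mult_right_mono powr_mono2) auto
    finally have "ennreal (v x powr (2 + 2 * p)) \<le> ennreal ((2 * s) powr (2 * p)) * ennreal ((v x)\<^sup>2)"
      by (simp add: ennreal_leI flip: ennreal_mult)
    then show ?thesis by (rule order_trans) simp
  next
    case False
    obtain n where "v x / (2 * s) < 2 ^ n" using real_arch_pow[of 2 "v x / (2 * s)"] by auto
    then have ex: "v x < 2 * (s * 2 ^ n)" using s by (simp add: field_simps)
    define i where "i = (LEAST n. v x < 2 * (s * 2 ^ n))"
    have i: "v x < 2 * (s * 2 ^ i)" unfolding i_def by (rule LeastI[of _ n]) (rule ex)
    have "i \<noteq> 0" using i False by (cases i) auto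
    then obtain j where j: "i = Suc j" by (cases i) auto
    have vj: "2 * (s * 2 ^ j) \<le> v x" using not_less_Least[of j "\<lambda>n. v x < 2 * (s * 2 ^ n)"] j
      by (simp add: i_def)
    have "v x powr (2 + 2 * p) \<le> (4 * (s * 2 ^ j)) powr (2 + 2 * p)"
      using i j nonneg N by (intro powr_mono2) auto
    also have "\<dots> = 4 powr (2 + 2 * p) * (s * 2 ^ j) powr (2 + 2 * p)" using s by (simp add: powr_mult)
    finally have "ennreal (v x powr (2 + 2 * p))
        \<le> ennreal (4 powr (2 + 2 * p)) * (ennreal ((s * 2 ^ j) powr (2 + 2 * p)) * indicator (?V j) x)"
      using vj by (simp add: ennreal_leI flip: ennreal_mult)
    also have "\<dots> \<le> (\<Sum>j. ennreal (4 powr (2 + 2 * p)) * (ennreal ((s * 2 ^ j) powr (2 + 2 * p)) * indicator (?V j) x))"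
      by (rule order_trans[OF _ sum_le_suminf[of _ "{j}"]]) auto
    finally show ?thesis by (rule order_trans) simp
  qed
  have "(\<integral>\<^sup>+x. ennreal (v x powr (2 + 2 * p)) \<partial>lborel)
      \<le> (\<integral>\<^sup>+x. ennreal ((2 * s) powr (2 * p)) * ennreal ((v x)\<^sup>2)
      + (\<Sum>j. ennreal (4 powr (2 + 2 * p)) * (ennreal ((s * 2 ^ j) powr (2 + 2 * p)) * indicator (?V j) x)) \<partial>lborel)"
    by (intro nn_integral_mono point)
  also have "\<dots> = ennreal ((2 * s) powr (2 * p)) * ennreal m
      + (\<Sum>j. ennreal (4 powr (2 + 2 * p)) * (ennreal ((s * 2 ^ j) powr (2 + 2 * p)) * emeasure lborel (?V j)))"
    by (subst nn_integral_add) (auto simp: nn_integral_cmult mass nn_integral_suminf)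
  also have "(\<Sum>j. ennreal (4 powr (2 + 2 * p)) * (ennreal ((s * 2 ^ j) powr (2 + 2 * p)) * emeasure lborel (?V j)))
      \<le> ennreal (4 powr (2 + 2 * p)) * ennreal (8 * (2 * \<eta> / \<omega>) powr p * G)"
  proof (subst suminf_eq_SUP, rule SUP_least)
    fix J
    have "(\<Sum>j<J. ennreal ((s * 2 ^ j) powr (2 + 2 * p)) * emeasure lborel (?V j)) \<le> ennreal (8 * (2 * \<eta> / \<omega>) powr p * G)"
      using sum_level_sets_bound[OF v incr G R \<eta> local, of J]
      unfolding s_def \<omega>_def p_def N_def .
    then show "(\<Sum>j<J. ennreal (4 powr (2 + 2 * p)) * (ennreal ((s * 2 ^ j) powr (2 + 2 * p)) * emeasure lborel (?V j)))
      \<le> ennreal (4 powr (2 + 2 * p)) * ennreal (8 * (2 * \<eta> / \<omega>) powr p * G)"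
      unfolding sum_distrib_left[symmetric] by (intro mult_left_mono) auto
  qed
  also have "ennreal ((2 * s) powr (2 * p)) * ennreal m + ennreal (4 powr (2 + 2 * p)) * ennreal (8 * (2 * \<eta> / \<omega>) powr p * G)
    = ennreal ((2 * s) powr (2 * p) * m + 4 powr (2 + 2 * p) * (8 * (2 * \<eta> / \<omega>) powr p * G))"
    using m G by (subst ennreal_plus) (auto simp: ennreal_mult)
  also have "\<dots> \<le> ennreal (lions_const TYPE('n) * \<eta> powr p * (G + m / R\<^sup>2))"
  proof (rule ennreal_leI)
    have C: "lions_const TYPE('n) * \<eta> powr p = 8 * 4 powr (2 + 2 * p) * (2 * \<eta> / \<omega>) powr p"
      unfolding lions_const_def \<omega>_def[symmetric] l using \<omega> \<eta> by (simp add: powr_mult powr_divide p_def N_def)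
    have "(2 * s) powr (2 * p) = 4 powr p * ((2 * \<eta> / \<omega>) powr p / R\<^sup>2)"
    proof -
      have "(2 * s) powr (2 * p) = ((2 * s) powr 2) powr p" by (simp add: powr_powr)
      also have "(2 * s) powr 2 = (2 * s)\<^sup>2" using s(1) by simp
      also have "(2 * s)\<^sup>2 = 4 * ((2 * \<eta> / \<omega>) / R ^ N)" by (simp add: power_mult_distrib s(2))
      also have "\<dots> powr p = 4 powr p * ((2 * \<eta> / \<omega>) powr p / (R ^ N) powr p)"
      proof -
        define a where "a = 2 * \<eta> / \<omega>"
        have "a \<ge> 0" using \<eta> \<omega> by (simp add: a_def)
        then show ?thesis unfolding a_def[symmetric] using R by (simp add: powr_mult powr_divide)
      qed
      also have "(R ^ N) powr p = R\<^sup>2"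
        unfolding p_def using R N(1) by (rule power_powr_two_div)
      finally show ?thesis .
    qed
    also have "\<dots> \<le> (8 * 4 powr (2 + 2 * p)) * ((2 * \<eta> / \<omega>) powr p / R\<^sup>2)"
    proof (rule mult_right_mono)
      have "(4::real) powr p \<le> 4 powr (2 + 2 * p)" using N by (intro powr_mono) auto
      moreover have "0 \<le> (4::real) powr (2 + 2 * p)" by simp
      ultimately show "(4::real) powr p \<le> 8 * 4 powr (2 + 2 * p)" by linarith
    qed simp
    finally have "(2 * s) powr (2 * p) * m \<le> (8 * 4 powr (2 + 2 * p)) * ((2 * \<eta> / \<omega>) powr p / R\<^sup>2) * m"
      using m by (rule mult_right_mono)
    then show "(2 * s) powr (2 * p) * m + 4 powr (2 + 2 * p) * (8 * (2 * \<eta> / \<omega>) powr p * G)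
        \<le> lions_const TYPE('n) * \<eta> powr p * (G + m / R\<^sup>2)"
      unfolding C by (simp add: algebra_simps)
  qed
  finally show ?thesis unfolding l by (simp add: p_def N_def)
qed

section \<open>The energy\<close>

subsection \<open>Critical integrals and the potential\<close>

abbreviation crit_exp :: "'n::finite itself \<Rightarrow> real" where
  "crit_exp N \<equiv> 2 + 4 / real CARD('n)"

definition crit_int :: "(real ^ 'n \<Rightarrow> complex) \<Rightarrow> real" where
  "crit_int u = (LINT x|lborel. norm (u x) powr crit_exp TYPE('n))"

lemma crit_int_nonneg [simp]: "0 \<le> crit_int u"
  by (simp add: crit_int_def)

text \<open>
  The previous inequality, applied to the modulus of \<open>u\<close>; its increments are dominated by those of \<open>u\<close>,
  to which the translation estimate applies.
\<close>

theorem lions_inequality: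
  fixes u :: "real ^ 'n \<Rightarrow> complex"
  assumes s: "sobolev u g" and R: "R > 0" and \<eta>: "\<eta> > 0"
    and local: "\<And>x. (\<integral>\<^sup>+y. indicator (cball x R) y * ennreal ((norm (u y))\<^sup>2) \<partial>lborel) \<le> ennreal \<eta>"
  shows "integrable lborel (\<lambda>x. norm (u x) powr crit_exp TYPE('n))"
    and "crit_int u \<le> lions_const TYPE('n) * \<eta> powr (2 / real CARD('n)) * (sq_int g + sq_int u / R\<^sup>2)"
proof -
  note [measurable] = L2_measurable[OF sobolev_L2(1)[OF s]]
  have incr: "increment h (\<lambda>x. norm (u x)) \<le> ennreal ((norm h)\<^sup>2 * sq_int g)" for h
  proof -
    have "increment h (\<lambda>x. norm (u x)) \<le> increment h u"
      unfolding increment_def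
      by (intro nn_integral_mono ennreal_leI power_mono) (simp_all add: norm_triangle_ineq3)
    also have "\<dots> \<le> ennreal ((norm h)\<^sup>2 * sq_int g)" by (rule translation_estimate[OF s])
    finally show ?thesis .
  qed
  have nn: "(\<integral>\<^sup>+x. ennreal (norm (u x) powr crit_exp TYPE('n)) \<partial>lborel)
      \<le> ennreal (lions_const TYPE('n) * \<eta> powr (2 / real CARD('n)) * (sq_int g + sq_int u / R\<^sup>2))"
    by (rule lions_inequality_nn[OF _ _ incr _ R \<eta> local nn_integral_L2[OF sobolev_L2(1)[OF s]]]) auto
  show int: "integrable lborel (\<lambda>x. norm (u x) powr crit_exp TYPE('n))"
    using le_less_trans[OF nn, of \<infinity>] by (intro integrableI_nonneg) auto
  have "ennreal (crit_int u) = (\<integral>\<^sup>+x. ennreal (norm (u x) powr crit_exp TYPE('n)) \<partial>lborel)"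
    unfolding crit_int_def by (rule nn_integral_eq_integral[symmetric, OF int]) simp
  with nn show "crit_int u \<le> lions_const TYPE('n) * \<eta> powr (2 / real CARD('n)) * (sq_int g + sq_int u / R\<^sup>2)"
  proof -
    have "0 \<le> lions_const TYPE('n) * \<eta> powr (2 / real CARD('n)) * (sq_int g + sq_int u / R\<^sup>2)"
      using R less_imp_le[OF lions_const_pos[where 'n = 'n]]
      by (intro mult_nonneg_nonneg add_nonneg_nonneg) auto
    moreover have "ennreal (crit_int u)
        \<le> ennreal (lions_const TYPE('n) * \<eta> powr (2 / real CARD('n)) * (sq_int g + sq_int u / R\<^sup>2))"
      using nn \<open>ennreal (crit_int u) = _\<close> by simp
    ultimately show ?thesis by (subst (asm) ennreal_le_iff)
  qed
qed

lemma local_mass_le: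
  assumes "u \<in> L2" "sq_int u \<le> m"
  shows "(\<integral>\<^sup>+y. indicator A y * ennreal ((norm (u y))\<^sup>2) \<partial>lborel) \<le> ennreal m"
proof -
  have "(\<integral>\<^sup>+y. indicator A y * ennreal ((norm (u y))\<^sup>2) \<partial>lborel) \<le> (\<integral>\<^sup>+y. ennreal ((norm (u y))\<^sup>2) \<partial>lborel)"
    by (intro nn_integral_mono) (simp add: indicator_def)
  also have "\<dots> \<le> ennreal m" using assms by (simp add: nn_integral_L2 ennreal_leI)
  finally show ?thesis .
qed

lemma gagliardo_nirenberg:
  fixes u :: "real ^ 'n \<Rightarrow> complex"
  assumes s: "sobolev u g" and R: "R > 0" and m: "m > 0" "sq_int u \<le> m"
  shows "integrable lborel (\<lambda>x. norm (u x) powr crit_exp TYPE('n))"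
    and "crit_int u \<le> lions_const TYPE('n) * m powr (2 / real CARD('n)) * (sq_int g + sq_int u / R\<^sup>2)"
  using lions_inequality[OF s R m(1) local_mass_le[OF sobolev_L2(1)[OF s] m(2)]] by blast+

lemma sobolev_crit_integrable:
  fixes u :: "real ^ 'n \<Rightarrow> complex"
  assumes s: "sobolev u g"
  shows "integrable lborel (\<lambda>x. norm (u x) powr crit_exp TYPE('n))"
  using gagliardo_nirenberg(1)[OF s, of 1 "sq_int u + 1"] by (simp add: add_nonneg_pos)

text \<open>
  The conditions at the origin and at infinity as global bounds with two powers of \<open>\<tau>\<close>: the coefficient of
  the lower power (\<open>small\<close>) or of the critical power (\<open>large\<close>) can be chosen arbitrarily small, at the
  expense of the other one. The parameter \<open>dim\<close> stands for the dimension and fixes the critical exponent.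
\<close>

locale mass_subcritical =
  fixes f :: "complex \<Rightarrow> complex" and dim :: "'n::finite itself"
  assumes continuous: "continuous_on UNIV f"
    and small: "\<And>\<epsilon>. \<epsilon> > 0 \<Longrightarrow> \<exists>B\<ge>0. \<forall>\<tau>\<ge>0. \<bar>Re (f (of_real \<tau>))\<bar> \<le> \<epsilon> * \<tau> + B * \<tau> powr (crit_exp TYPE('n) - 1)"
    and large: "\<And>\<epsilon>. \<epsilon> > 0 \<Longrightarrow> \<exists>A\<ge>0. \<forall>\<tau>\<ge>0. \<bar>Re (f (of_real \<tau>))\<bar> \<le> A * \<tau> + \<epsilon> * \<tau> powr (crit_exp TYPE('n) - 1)"
begin

lemma continuous_Re: "continuous_on S (\<lambda>\<tau>. Re (f (of_real \<tau>)))"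
  by (intro continuous_intros continuous_on_compose2[OF continuous]) auto

lemma F_diff_le:
  assumes growth: "\<And>\<tau>. \<tau> \<ge> 0 \<Longrightarrow> \<bar>Re (f (of_real \<tau>))\<bar> \<le> A * \<tau> + B * \<tau> powr (crit_exp TYPE('n) - 1)"
    and AB: "A \<ge> 0" "B \<ge> 0"
  shows "\<bar>F f z - F f w\<bar> \<le> \<bar>norm z - norm w\<bar> *
    (A * max (norm z) (norm w) + B * max (norm z) (norm w) powr (crit_exp TYPE('n) - 1))"
proof -
  have *: "\<bar>F f z - F f w\<bar> \<le> (norm z - norm w) * (A * norm z + B * norm z powr (crit_exp TYPE('n) - 1))"
    if zw: "norm w \<le> norm z" for z w
  proof -
    have "integral {0..norm w} (\<lambda>\<tau>. Re (f (of_real \<tau>))) + integral {norm w..norm z} (\<lambda>\<tau>. Re (f (of_real \<tau>)))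
        = integral {0..norm z} (\<lambda>\<tau>. Re (f (of_real \<tau>)))"
      using zw by (intro Henstock_Kurzweil_Integration.integral_combine integrable_continuous_interval continuous_Re) auto
    then have "F f z - F f w = integral {norm w..norm z} (\<lambda>\<tau>. Re (f (of_real \<tau>)))"
      by (simp add: F_def)
    also have "\<bar>\<dots>\<bar> \<le> (A * norm z + B * norm z powr (crit_exp TYPE('n) - 1)) * (norm z - norm w)"
    proof (rule integral_bound[OF zw continuous_Re, unfolded real_norm_def])
      fix \<tau> assume \<tau>: "\<tau> \<in> {norm w..norm z}"
      then have \<tau>0: "\<tau> \<ge> 0" using order_trans[OF norm_ge_zero[of w], of \<tau>] by simp
      have "\<bar>Re (f (of_real \<tau>))\<bar> \<le> A * \<tau> + B * \<tau> powr (crit_exp TYPE('n) - 1)" by (rule growth[OF \<tau>0])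
      also have "\<dots> \<le> A * norm z + B * norm z powr (crit_exp TYPE('n) - 1)"
        using \<tau> \<tau>0 AB by (intro add_mono mult_left_mono powr_mono2) auto
      finally show "\<bar>Re (f (of_real \<tau>))\<bar> \<le> A * norm z + B * norm z powr (crit_exp TYPE('n) - 1)" .
    qed
    finally show ?thesis by (simp add: mult.commute)
  qed
  show ?thesis
  proof (cases "norm w \<le> norm z")
    case True then show ?thesis using *[OF True] by (simp add: max_def)
  next
    case False then show ?thesis using *[of z w] by (simp add: max_def abs_minus_commute)
  qed
qed

lemma F_0: "norm z = 0 \<Longrightarrow> F f z = 0" by (simp add: F_def)

lemma powr_times:
  assumes "0 \<le> t" shows "t * t powr (crit_exp TYPE('n) - 1) = t powr crit_exp TYPE('n)"
proof -
  have "1 + (crit_exp TYPE('n) - 1) = crit_exp TYPE('n)" by simp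
  then show ?thesis using powr_mult_base[OF assms, of "crit_exp TYPE('n) - 1"] by metis
qed

lemma F_le:
  assumes growth: "\<And>\<tau>. \<tau> \<ge> 0 \<Longrightarrow> \<bar>Re (f (of_real \<tau>))\<bar> \<le> A * \<tau> + B * \<tau> powr (crit_exp TYPE('n) - 1)"
    and AB: "A \<ge> 0" "B \<ge> 0"
  shows "\<bar>F f z\<bar> \<le> A * (norm z)\<^sup>2 + B * norm z powr crit_exp TYPE('n)"
proof -
  have "\<bar>F f z\<bar> \<le> norm z * (A * norm z + B * norm z powr (crit_exp TYPE('n) - 1))"
    using F_diff_le[OF growth AB, of z 0] by (simp add: F_0)
  also have "\<dots> = A * (norm z)\<^sup>2 + B * (norm z * norm z powr (crit_exp TYPE('n) - 1))"
    by (simp add: power2_eq_square algebra_simps)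
  finally show ?thesis unfolding powr_times[OF norm_ge_zero] .
qed

lemma F_bound_large:
  assumes "\<epsilon> > 0" shows "\<exists>A\<ge>0. \<forall>z. \<bar>F f z\<bar> \<le> A * (norm z)\<^sup>2 + \<epsilon> * norm z powr crit_exp TYPE('n)"
proof -
  obtain A where "A \<ge> 0" "\<And>\<tau>. \<tau> \<ge> 0 \<Longrightarrow> \<bar>Re (f (of_real \<tau>))\<bar> \<le> A * \<tau> + \<epsilon> * \<tau> powr (crit_exp TYPE('n) - 1)"
    using large[OF assms] by blast
  then show ?thesis using F_le[of A \<epsilon>] assms by auto
qed

lemma F_bound_small:
  assumes "\<epsilon> > 0" shows "\<exists>B\<ge>0. \<forall>z. \<bar>F f z\<bar> \<le> \<epsilon> * (norm z)\<^sup>2 + B * norm z powr crit_exp TYPE('n)"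
proof -
  obtain B where "B \<ge> 0" "\<And>\<tau>. \<tau> \<ge> 0 \<Longrightarrow> \<bar>Re (f (of_real \<tau>))\<bar> \<le> \<epsilon> * \<tau> + B * \<tau> powr (crit_exp TYPE('n) - 1)"
    using small[OF assms] by blast
  then show ?thesis using F_le[of \<epsilon> B] assms by auto
qed

text \<open>Young's inequality in its crudest form: compare \<open>t\<close> with \<open>\<delta> m\<close>.\<close>

lemma young:
  fixes t m :: real
  assumes "0 \<le> t" "0 \<le> m" "\<delta> > 0"
  shows "t * m \<le> \<delta> * m\<^sup>2 + (1 / \<delta>) * t\<^sup>2"
    and "t * m powr (crit_exp TYPE('n) - 1) \<le> \<delta> * m powr crit_exp TYPE('n) + (1 / \<delta>) powr (crit_exp TYPE('n) - 1) * t powr crit_exp TYPE('n)"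
proof -
  show "t * m \<le> \<delta> * m\<^sup>2 + (1 / \<delta>) * t\<^sup>2"
  proof (cases "t \<le> \<delta> * m")
    case True
    then have "t * m \<le> (\<delta> * m) * m" using assms by (intro mult_right_mono)
    then show ?thesis using assms by (simp add: power2_eq_square mult.assoc add_increasing2)
  next
    case False
    then have "t * m \<le> t * (t / \<delta>)" using assms by (intro mult_left_mono) (auto simp: field_simps)
    then show ?thesis using assms by (simp add: power2_eq_square add_increasing)
  qed
  show "t * m powr (crit_exp TYPE('n) - 1) \<le> \<delta> * m powr crit_exp TYPE('n) + (1 / \<delta>) powr (crit_exp TYPE('n) - 1) * t powr crit_exp TYPE('n)"
  proof (cases "t \<le> \<delta> * m")
    case True
    then have "t * m powr (crit_exp TYPE('n) - 1) \<le> (\<delta> * m) * m powr (crit_exp TYPE('n) - 1)" using assms by (intro mult_right_mono) auto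
    also have "\<dots> = \<delta> * m powr crit_exp TYPE('n)" using powr_times[OF assms(2)] by (simp add: mult.assoc)
    finally show ?thesis by (simp add: add_increasing2)
  next
    case False
    have "t * m powr (crit_exp TYPE('n) - 1) \<le> t * ((1 / \<delta>) * t) powr (crit_exp TYPE('n) - 1)"
      using False assms by (intro mult_left_mono powr_mono2) (auto simp: field_simps)
    also have "\<dots> = (1 / \<delta>) powr (crit_exp TYPE('n) - 1) * (t * t powr (crit_exp TYPE('n) - 1))"
      using assms powr_mult[of "1 / \<delta>" t "crit_exp TYPE('n) - 1"] by simp
    finally show ?thesis unfolding powr_times[OF assms(1)]
      using assms by (simp add: add_increasing)
  qed
qed

text \<open>
  The terms without \<open>z - w\<close> carry an arbitrarily small factor. After integration this is continuity of the
  potential on sets where mass and critical integral are bounded.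
\<close>

lemma F_diff_bound:
  assumes \<epsilon>: "\<epsilon> > 0"
  shows "\<exists>B\<ge>0. \<forall>(z::complex) (w::complex). \<bar>F f z - F f w\<bar>
    \<le> \<epsilon> * ((norm z)\<^sup>2 + norm z powr crit_exp TYPE('n) + (norm w)\<^sup>2 + norm w powr crit_exp TYPE('n)) + B * ((norm (z - w))\<^sup>2 + norm (z - w) powr crit_exp TYPE('n))"
proof -
  obtain A where A: "A \<ge> 0" "\<And>\<tau>. \<tau> \<ge> 0 \<Longrightarrow> \<bar>Re (f (of_real \<tau>))\<bar> \<le> A * \<tau> + 1 * \<tau> powr (crit_exp TYPE('n) - 1)"
    using large[of 1] by auto
  define \<delta> where "\<delta> = \<epsilon> / (A + 1)"
  have \<delta>: "\<delta> > 0" "A * \<delta> \<le> \<epsilon>" "\<delta> \<le> \<epsilon>"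
    using A \<epsilon> by (auto simp: \<delta>_def field_simps)
  define B where "B = A * (1 / \<delta>) + (1 / \<delta>) powr (crit_exp TYPE('n) - 1)"
  have B0: "0 \<le> A * (1 / \<delta>)" "0 \<le> (1 / \<delta>) powr (crit_exp TYPE('n) - 1)" using A \<delta> by auto
  show ?thesis
  proof (intro exI conjI allI)
    show "B \<ge> 0" using B0 by (simp add: B_def)
    fix z w :: complex
    define m where "m = max (norm z) (norm w)"
    define t where "t = norm (z - w)"
    have mt: "0 \<le> m" "0 \<le> t" by (auto simp: m_def t_def le_max_iff_disj)
    have "\<bar>F f z - F f w\<bar> \<le> \<bar>norm z - norm w\<bar> * (A * m + 1 * m powr (crit_exp TYPE('n) - 1))"
      unfolding m_def by (rule F_diff_le[OF A(2) A(1)]) auto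
    also have "\<dots> \<le> t * (A * m + 1 * m powr (crit_exp TYPE('n) - 1))"
      using A mt by (intro mult_right_mono) (auto simp: t_def norm_triangle_ineq3)
    also have "\<dots> = A * (t * m) + t * m powr (crit_exp TYPE('n) - 1)" by (simp add: algebra_simps)
    also have "\<dots> \<le> A * (\<delta> * m\<^sup>2 + (1 / \<delta>) * t\<^sup>2) + (\<delta> * m powr crit_exp TYPE('n) + (1 / \<delta>) powr (crit_exp TYPE('n) - 1) * t powr crit_exp TYPE('n))"
      using young[OF mt(2,1) \<delta>(1)] A by (intro add_mono mult_left_mono)
    also have "\<dots> = (A * \<delta>) * m\<^sup>2 + \<delta> * m powr crit_exp TYPE('n) + (A * (1 / \<delta>) * t\<^sup>2 + (1 / \<delta>) powr (crit_exp TYPE('n) - 1) * t powr crit_exp TYPE('n))"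
      by (simp add: algebra_simps)
    also have "\<dots> \<le> \<epsilon> * m\<^sup>2 + \<epsilon> * m powr crit_exp TYPE('n) + (B * t\<^sup>2 + B * t powr crit_exp TYPE('n))"
      using \<delta> B0 by (intro add_mono mult_right_mono) (auto simp: B_def)
    also have "\<dots> \<le> \<epsilon> * ((norm z)\<^sup>2 + norm z powr crit_exp TYPE('n) + (norm w)\<^sup>2 + norm w powr crit_exp TYPE('n)) + B * (t\<^sup>2 + t powr crit_exp TYPE('n))"
    proof -
      have "m\<^sup>2 + m powr crit_exp TYPE('n) \<le> (norm z)\<^sup>2 + norm z powr crit_exp TYPE('n) + (norm w)\<^sup>2 + norm w powr crit_exp TYPE('n)"
        by (auto simp: m_def max_def add_increasing2 add_increasing)
      from mult_left_mono[OF this less_imp_le[OF \<epsilon>]] show ?thesis by (simp add: algebra_simps)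
    qed
    finally show "\<bar>F f z - F f w\<bar> \<le> \<epsilon> * ((norm z)\<^sup>2 + norm z powr crit_exp TYPE('n) + (norm w)\<^sup>2 + norm w powr crit_exp TYPE('n))
        + B * ((norm (z - w))\<^sup>2 + norm (z - w) powr crit_exp TYPE('n))" by (simp add: t_def)
  qed
qed

lemma F_measurable [measurable]: "F f \<in> borel_measurable borel"
proof (rule borel_measurable_continuous_onI, rule continuous_at_imp_continuous_on, rule ballI)
  fix z :: complex
  have "continuous_on {0..norm z + 1} (\<lambda>s. integral {0..s} (\<lambda>\<tau>. Re (f (of_real \<tau>))))"
    by (intro indefinite_integral_continuous_1 integrable_continuous_interval continuous_Re)
  then have "continuous_on (ball 0 (norm z + 1)) (\<lambda>z. integral {0..norm z} (\<lambda>\<tau>. Re (f (of_real \<tau>))))"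
    by (rule continuous_on_compose2) (auto intro: continuous_intros)
  then have "continuous_on (ball 0 (norm z + 1)) (F f)" by (simp add: F_def[abs_def])
  then have "\<forall>y\<in>ball 0 (norm z + 1). isCont (F f) y" by (simp add: continuous_on_eq_continuous_at)
  then show "isCont (F f) z" by (rule bspec) simp
qed

definition potential :: "(real ^ 'n \<Rightarrow> complex) \<Rightarrow> real" where
  "potential u = (LINT x|lborel. F f (u x))"

lemma potential_integrable:
  fixes u :: "real ^ 'n \<Rightarrow> complex"
  assumes s: "sobolev u g"
  shows "integrable lborel (\<lambda>x. F f (u x))"
proof -
  note [measurable] = L2_measurable[OF sobolev_L2(1)[OF s]]
  obtain A where A: "A \<ge> 0" "\<And>z. \<bar>F f z\<bar> \<le> A * (norm z)\<^sup>2 + 1 * norm z powr crit_exp TYPE('n)"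
    using F_bound_large[of 1] by auto
  show ?thesis
  proof (rule Bochner_Integration.integrable_bound)
    show "integrable lborel (\<lambda>x. A * (norm (u x))\<^sup>2 + 1 * norm (u x) powr crit_exp TYPE('n))"
      using L2_integrable[OF sobolev_L2(1)[OF s]] sobolev_crit_integrable[OF s] by simp
    show "AE x in lborel. norm (F f (u x)) \<le> norm (A * (norm (u x))\<^sup>2 + 1 * norm (u x) powr crit_exp TYPE('n))"
      using A by (intro AE_I2) (simp add: add_nonneg_nonneg)
  qed simp
qed

lemma energy_eq:
  fixes u :: "real ^ 'n \<Rightarrow> complex"
  assumes s: "sobolev u g"
  shows "energy f u = 1/2 * sq_int g - potential u"
  using sobolev_weak_gradient[OF s] by (simp add: energy_def potential_def sq_int_def)

lemma potential_abs_le: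
  fixes u :: "real ^ 'n \<Rightarrow> complex"
  assumes s: "sobolev u g" and le: "\<And>z. \<bar>F f z\<bar> \<le> A * (norm z)\<^sup>2 + B * norm z powr crit_exp TYPE('n)"
  shows "\<bar>potential u\<bar> \<le> A * sq_int u + B * crit_int u"
proof -
  have "\<bar>potential u\<bar> \<le> (LINT x|lborel. \<bar>F f (u x)\<bar>)"
    unfolding potential_def by (rule integral_abs_bound)
  also have "\<dots> \<le> (LINT x|lborel. A * (norm (u x))\<^sup>2 + B * norm (u x) powr crit_exp TYPE('n))"
    using potential_integrable[OF s] L2_integrable[OF sobolev_L2(1)[OF s]] sobolev_crit_integrable[OF s] le
    by (intro integral_mono) auto
  also have "\<dots> = A * sq_int u + B * crit_int u"
    using L2_integrable[OF sobolev_L2(1)[OF s]] sobolev_crit_integrable[OF s]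
    by (simp add: sq_int_def crit_int_def)
  finally show ?thesis .
qed

subsection \<open>Lower bounds\<close>

text \<open>
  The critical term has a coefficient small enough for the Gagliardo--Nirenberg inequality to bound the
  potential by a quarter of \<open>\<integral>|g|\<^sup>2\<close> and a constant.
\<close>

lemma coercive:
  assumes \<alpha>: "\<alpha> > 0"
  shows "\<exists>C. \<forall>(u :: real ^ 'n \<Rightarrow> complex) g. sobolev u g \<longrightarrow> sq_int u \<le> \<alpha> \<longrightarrow> sq_int g \<le> 4 * energy f u + C"
proof -
  define K where "K = lions_const TYPE('n) * \<alpha> powr (2 / real CARD('n))"
  have K: "K > 0" using \<alpha> lions_const_pos[where 'n = 'n] by (simp add: K_def)
  obtain A where A: "A \<ge> 0" "\<And>z. \<bar>F f z\<bar> \<le> A * (norm z)\<^sup>2 + (1 / (4 * K)) * norm z powr crit_exp TYPE('n)"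
    using F_bound_large[of "1 / (4 * K)"] K by auto
  show ?thesis
  proof (intro exI allI impI)
    fix u :: "real ^ 'n \<Rightarrow> complex" and g assume s: "sobolev u g" and m: "sq_int u \<le> \<alpha>"
    have "crit_int u \<le> K * (sq_int g + sq_int u / 1\<^sup>2)"
      unfolding K_def by (rule gagliardo_nirenberg(2)[OF s _ \<alpha> m]) simp
    also have "\<dots> \<le> K * (sq_int g + \<alpha>)" using m K by simp
    finally have "(1 / (4 * K)) * crit_int u \<le> (1 / (4 * K)) * (K * (sq_int g + \<alpha>))"
      using K by (intro mult_left_mono) auto
    also have "\<dots> = (sq_int g + \<alpha>) / 4" using K by simp
    finally have "\<bar>potential u\<bar> \<le> A * \<alpha> + (sq_int g + \<alpha>) / 4"
      using potential_abs_le[OF s A(2)] mult_left_mono[OF m A(1)] by linarith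
    then show "sq_int g \<le> 4 * energy f u + (4 * (A * \<alpha>) + \<alpha>)"
      unfolding energy_eq[OF s] by (simp add: field_simps)
  qed
qed

text \<open>
  Negative energy needs a positive potential, of which the quadratic term supplies at most half.
\<close>

lemma crit_int_lower_bound:
  assumes \<alpha>: "\<alpha> > 0" and e: "e < 0"
  shows "\<exists>\<tau>>0. \<forall>(u :: real ^ 'n \<Rightarrow> complex) g. sobolev u g \<longrightarrow> sq_int u \<le> \<alpha> \<longrightarrow> energy f u \<le> e \<longrightarrow> \<tau> \<le> crit_int u"
proof -
  define \<epsilon> where "\<epsilon> = - e / (2 * \<alpha>)"
  have \<epsilon>: "\<epsilon> > 0" "\<epsilon> * \<alpha> = - e / 2" using \<alpha> e by (simp_all add: \<epsilon>_def divide_neg_pos)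
  obtain B where B: "B \<ge> 0" "\<And>z. \<bar>F f z\<bar> \<le> \<epsilon> * (norm z)\<^sup>2 + B * norm z powr crit_exp TYPE('n)"
    using F_bound_small[OF \<epsilon>(1)] by auto
  show ?thesis
  proof (intro exI[of _ "- e / (2 * (B + 1))"] conjI allI impI)
    show "- e / (2 * (B + 1)) > 0" using e B by (intro divide_pos_pos) auto
    fix u :: "real ^ 'n \<Rightarrow> complex" and g assume s: "sobolev u g" and m: "sq_int u \<le> \<alpha>" and en: "energy f u \<le> e"
    have "- e \<le> potential u" using en sq_int_nonneg[of g] unfolding energy_eq[OF s] by linarith
    also have "potential u \<le> \<epsilon> * sq_int u + B * crit_int u" using potential_abs_le[OF s B(2)] by linarith
    also have "\<epsilon> * sq_int u \<le> - e / 2" using mult_left_mono[OF m less_imp_le[OF \<epsilon>(1)]] \<epsilon>(2) by simp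
    finally have "- e / 2 \<le> B * crit_int u" by linarith
    also have "\<dots> \<le> (B + 1) * crit_int u" by (intro mult_right_mono) auto
    finally show "- e / (2 * (B + 1)) \<le> crit_int u" using B by (simp add: field_simps)
  qed
qed

text \<open>
  In the Gagliardo--Nirenberg inequality, \<open>R\<close> is chosen so large that the term with \<open>R\<^bsup>-2\<^esup>\<close> accounts for at most
  half of the lower bound on the critical integral.
\<close>

lemma kinetic_lower_bound:
  assumes \<alpha>: "\<alpha> > 0" and e: "e < 0"
  shows "\<exists>\<kappa>>0. \<forall>(u :: real ^ 'n \<Rightarrow> complex) g. sobolev u g \<longrightarrow> sq_int u \<le> \<alpha> \<longrightarrow> energy f u \<le> e \<longrightarrow> \<kappa> \<le> sq_int g"
proof -
  obtain \<tau> where \<tau>: "\<tau> > 0" "\<And>(u :: real ^ 'n \<Rightarrow> complex) g. sobolev u g \<Longrightarrow> sq_int u \<le> \<alpha> \<Longrightarrow> energy f u \<le> e \<Longrightarrow> \<tau> \<le> crit_int u"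
    using crit_int_lower_bound[OF assms] by blast
  define K where "K = lions_const TYPE('n) * \<alpha> powr (2 / real CARD('n))"
  have K: "K > 0" using \<alpha> lions_const_pos[where 'n = 'n] by (simp add: K_def)
  define R where "R = sqrt (2 * K * \<alpha> / \<tau>)"
  have R: "R > 0" "\<alpha> / R\<^sup>2 = \<tau> / (2 * K)" using K \<alpha> \<tau> by (simp_all add: R_def)
  show ?thesis
  proof (intro exI[of _ "\<tau> / (2 * K)"] conjI allI impI)
    show "\<tau> / (2 * K) > 0" using \<tau> K by simp
    fix u :: "real ^ 'n \<Rightarrow> complex" and g assume s: "sobolev u g" and m: "sq_int u \<le> \<alpha>" and en: "energy f u \<le> e"
    have "\<tau> \<le> crit_int u" by (rule \<tau>(2)[OF s m en])
    also have "\<dots> \<le> K * (sq_int g + sq_int u / R\<^sup>2)"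
      unfolding K_def by (rule gagliardo_nirenberg(2)[OF s R(1) \<alpha> m])
    also have "\<dots> \<le> K * (sq_int g + \<alpha> / R\<^sup>2)"
      using m K R by (intro mult_left_mono add_left_mono divide_right_mono) auto
    also have "\<dots> = K * sq_int g + \<tau> / 2" unfolding R(2) using K by (simp add: field_simps)
    finally show "\<tau> / (2 * K) \<le> sq_int g" using K by (simp add: field_simps)
  qed
qed

text \<open>
  If every unit ball had mass at most \<open>\<delta>\<close>, the local inequality would make the critical integral smaller
  than its lower bound.
\<close>

lemma nonvanishing:
  assumes \<alpha>: "\<alpha> > 0" and e: "e < 0"
  shows "\<exists>\<delta>>0. \<forall>(u :: real ^ 'n \<Rightarrow> complex) g. sobolev u g \<longrightarrow> sq_int u \<le> \<alpha> \<longrightarrow> energy f u \<le> e \<longrightarrow>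
    (\<exists>y. ennreal \<delta> \<le> (\<integral>\<^sup>+x. indicator (cball y 1) x * ennreal ((norm (u x))\<^sup>2) \<partial>lborel))"
proof -
  obtain \<tau> where \<tau>: "\<tau> > 0" "\<And>(u :: real ^ 'n \<Rightarrow> complex) g. sobolev u g \<Longrightarrow> sq_int u \<le> \<alpha> \<Longrightarrow> energy f u \<le> e \<Longrightarrow> \<tau> \<le> crit_int u"
    using crit_int_lower_bound[OF assms] by blast
  obtain C where C: "\<And>(u :: real ^ 'n \<Rightarrow> complex) g. sobolev u g \<Longrightarrow> sq_int u \<le> \<alpha> \<Longrightarrow> sq_int g \<le> 4 * energy f u + C"
    using coercive[OF \<alpha>] by blast
  define p where "p = 2 / real CARD('n)"
  have p: "p > 0" by (simp add: p_def)
  define L where "L = lions_const TYPE('n) * (\<bar>C\<bar> + \<alpha>)"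
  have L: "L > 0" using \<alpha> lions_const_pos[where 'n = 'n] by (simp add: L_def)
  define \<delta> where "\<delta> = (\<tau> / (2 * L)) powr (1 / p)"
  have \<delta>: "\<delta> > 0" "\<delta> powr p = \<tau> / (2 * L)" using \<tau> L p by (simp_all add: \<delta>_def powr_powr)
  show ?thesis
  proof (intro exI[of _ \<delta>] conjI allI impI \<delta>(1), rule ccontr)
    fix u :: "real ^ 'n \<Rightarrow> complex" and g assume s: "sobolev u g" and m: "sq_int u \<le> \<alpha>" and en: "energy f u \<le> e"
    assume "\<nexists>y. ennreal \<delta> \<le> (\<integral>\<^sup>+x. indicator (cball y 1) x * ennreal ((norm (u x))\<^sup>2) \<partial>lborel)"
    then have loc: "(\<integral>\<^sup>+x. indicator (cball y 1) x * ennreal ((norm (u x))\<^sup>2) \<partial>lborel) \<le> ennreal \<delta>" for y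
      by (meson le_cases)
    have "\<tau> \<le> crit_int u" by (rule \<tau>(2)[OF s m en])
    also have "\<dots> \<le> lions_const TYPE('n) * \<delta> powr p * (sq_int g + sq_int u / 1\<^sup>2)"
      unfolding p_def by (rule lions_inequality(2)[OF s _ \<delta>(1) loc]) simp
    also have "\<dots> \<le> lions_const TYPE('n) * \<delta> powr p * (\<bar>C\<bar> + \<alpha>)"
    proof (rule mult_left_mono)
      show "sq_int g + sq_int u / 1\<^sup>2 \<le> \<bar>C\<bar> + \<alpha>" using C[OF s m] en e m by simp
      show "0 \<le> lions_const TYPE('n) * \<delta> powr p" using lions_const_pos[where 'n = 'n] by simp
    qed
    also have "\<dots> = L * \<delta> powr p" by (simp add: L_def)
    also have "\<dots> = \<tau> / 2" using L by (simp add: \<delta>(2))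
    finally show False using \<tau> by simp
  qed
qed

subsection \<open>Scaling and strict subadditivity\<close>

lemma energy_scaling:
  fixes u :: "real ^ 'n \<Rightarrow> complex"
  assumes s: "sobolev u g" and t: "t > 1"
  defines "c \<equiv> t powr (- (1 / real CARD('n)))"
  shows "sobolev (\<lambda>x. u (c *\<^sub>R x)) (\<lambda>x. c *\<^sub>R g (c *\<^sub>R x))"
    and "sq_int (\<lambda>x. u (c *\<^sub>R x)) = t * sq_int u"
    and "energy f (\<lambda>x. u (c *\<^sub>R x)) = t * energy f u - t * (1 - c\<^sup>2) / 2 * sq_int g"
    and "0 < 1 - c\<^sup>2"
proof -
  have c: "c > 0" using t by (simp add: c_def)
  have "c ^ CARD('n) = c powr real CARD('n)" using c by (simp add: powr_realpow)
  also have "\<dots> = t powr (- 1)" unfolding c_def powr_powr by simp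
  finally have cN: "c ^ CARD('n) = 1 / t" using t by (simp add: powr_minus_divide)
  have "c < 1" using t unfolding c_def by (intro powr_less_one) auto
  then show "0 < 1 - c\<^sup>2" using c by (simp add: power_less_one_iff)
  show s': "sobolev (\<lambda>x. u (c *\<^sub>R x)) (\<lambda>x. c *\<^sub>R g (c *\<^sub>R x))"
    using sobolev_affine[OF s c, of 0] by simp
  show "sq_int (\<lambda>x. u (c *\<^sub>R x)) = t * sq_int u"
    using L2_affine(2)[OF sobolev_L2(1)[OF s] c, of 0] cN t by (simp add: field_simps)
  have g: "sq_int (\<lambda>x. c *\<^sub>R g (c *\<^sub>R x)) = c\<^sup>2 * (t * sq_int g)"
    using L2_affine[OF sobolev_L2(2)[OF s] c, of 0] L2_scaleR(2)[of "\<lambda>x. g (c *\<^sub>R x)" c] cN t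
    by (simp add: field_simps)
  note [measurable] = L2_measurable[OF sobolev_L2(1)[OF s]]
  have "potential u = c ^ CARD('n) * potential (\<lambda>x. u (c *\<^sub>R x))"
    using integral_lborel_affine[of "\<lambda>x. F f (u x)" c 0] c by (simp add: potential_def)
  then have pot: "potential (\<lambda>x. u (c *\<^sub>R x)) = t * potential u" using cN t by (simp add: field_simps)
  show "energy f (\<lambda>x. u (c *\<^sub>R x)) = t * energy f u - t * (1 - c\<^sup>2) / 2 * sq_int g"
    unfolding energy_eq[OF s] energy_eq[OF s'] g pot by (simp add: field_simps)
qed

end

lemma M_iff: "u \<in> M \<alpha> \<longleftrightarrow> u \<in> H1 \<and> sq_int u = \<alpha>"
  by (simp add: M_def sq_int_def)

lemma sobolev_M: "sobolev u g \<Longrightarrow> sq_int u = \<alpha> \<Longrightarrow> u \<in> M \<alpha>"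
  by (simp add: M_iff sobolev_H1)

locale negative_infimum = mass_subcritical f dim
  for f :: "complex \<Rightarrow> complex" and dim :: "'n::finite itself" +
  assumes negative: "\<And>\<alpha>. \<alpha> > 0 \<Longrightarrow> E_inf TYPE('n) f \<alpha> < 0"
begin

definition E :: "real \<Rightarrow> real" where
  "E \<alpha> = real_of_ereal (E_inf TYPE('n) f \<alpha>)"

lemma E_inf_eq:
  assumes \<alpha>: "\<alpha> > 0"
  shows "E_inf TYPE('n) f \<alpha> = ereal (E \<alpha>)"
proof -
  obtain C where C: "\<And>(u :: real ^ 'n \<Rightarrow> complex) g. sobolev u g \<Longrightarrow> sq_int u \<le> \<alpha> \<Longrightarrow> sq_int g \<le> 4 * energy f u + C"
    using coercive[OF \<alpha>] by blast
  have "ereal (- C / 4) \<le> E_inf TYPE('n) f \<alpha>"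
    unfolding E_inf_def
  proof (rule INF_greatest)
    fix u :: "real ^ 'n \<Rightarrow> complex" assume "u \<in> M \<alpha>"
    then have "0 \<le> 4 * energy f u + C"
      using order_trans[OF sq_int_nonneg C[OF H1_sobolev, of u]] by (simp add: M_iff)
    then show "ereal (- C / 4) \<le> ereal (energy f u)" by simp
  qed
  then have "E_inf TYPE('n) f \<alpha> \<noteq> - \<infinity>" by auto
  moreover have "E_inf TYPE('n) f \<alpha> \<noteq> \<infinity>" using negative[OF \<alpha>] by auto
  ultimately show ?thesis unfolding E_def by (cases "E_inf TYPE('n) f \<alpha>") auto
qed

lemma E_negative: "\<alpha> > 0 \<Longrightarrow> E \<alpha> < 0"
  using negative[of \<alpha>] E_inf_eq[of \<alpha>] by simp

lemma E_le:
  fixes u :: "real ^ 'n \<Rightarrow> complex"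
  assumes "sobolev u g" "sq_int u > 0"
  shows "E (sq_int u) \<le> energy f u"
proof -
  have "E_inf TYPE('n) f (sq_int u) \<le> ereal (energy f u)"
    unfolding E_inf_def by (intro INF_lower sobolev_M[OF assms(1)]) simp
  then show ?thesis using E_inf_eq[OF assms(2)] by simp
qed

lemma E_approx:
  assumes "\<alpha> > 0" "\<epsilon> > 0"
  obtains u :: "real ^ 'n \<Rightarrow> complex" and g where "sobolev u g" "sq_int u = \<alpha>" "energy f u < E \<alpha> + \<epsilon>"
proof -
  have "E_inf TYPE('n) f \<alpha> < ereal (E \<alpha> + \<epsilon>)" using assms by (simp add: E_inf_eq)
  then obtain u :: "real ^ 'n \<Rightarrow> complex" where "u \<in> M \<alpha>" "energy f u < E \<alpha> + \<epsilon>"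
    unfolding E_inf_def by (auto simp: INF_less_iff)
  then show ?thesis using that[OF H1_sobolev, of u] by (simp add: M_iff)
qed

text \<open>
  The gain \<open>d\<close> of the scaling is the same for all \<open>u\<close> of energy at most \<open>E \<alpha> / 2\<close>, so it survives the passage
  to the infimum.
\<close>

lemma E_scaling_strict:
  assumes \<alpha>: "\<alpha> > 0" and t: "t > 1"
  shows "E (t * \<alpha>) < t * E \<alpha>"
proof -
  have e: "E \<alpha> / 2 < 0" using E_negative[OF \<alpha>] by simp
  obtain \<kappa> where \<kappa>: "\<kappa> > 0" "\<And>(u :: real ^ 'n \<Rightarrow> complex) g. sobolev u g \<Longrightarrow> sq_int u \<le> \<alpha> \<Longrightarrow> energy f u \<le> E \<alpha> / 2 \<Longrightarrow> \<kappa> \<le> sq_int g"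
    using kinetic_lower_bound[OF \<alpha> e] by blast
  define c where "c = t powr (- (1 / real CARD('n)))"
  define d where "d = t * (1 - c\<^sup>2) / 2 * \<kappa>"
  have c1: "0 < 1 - c\<^sup>2"
    using energy_scaling(4)[OF _ t] E_approx[OF \<alpha>, of 1] unfolding c_def by (metis zero_less_one)
  then have d: "d > 0" using t \<kappa> by (simp add: d_def)
  define \<epsilon> where "\<epsilon> = min (- E \<alpha> / 2) (d / t)"
  have \<epsilon>: "\<epsilon> > 0" using d t E_negative[OF \<alpha>] by (simp add: \<epsilon>_def)
  obtain u :: "real ^ 'n \<Rightarrow> complex" and g where u: "sobolev u g" "sq_int u = \<alpha>" "energy f u < E \<alpha> + \<epsilon>"
    using E_approx[OF \<alpha> \<epsilon>] by blast
  have "energy f u \<le> E \<alpha> / 2" using u(3) by (simp add: \<epsilon>_def min_def split: if_splits)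
  then have "\<kappa> \<le> sq_int g" using \<kappa>(2)[OF u(1)] u(2) by simp
  then have "t * (1 - c\<^sup>2) / 2 * \<kappa> \<le> t * (1 - c\<^sup>2) / 2 * sq_int g" using c1 t by (intro mult_left_mono) auto
  then have "energy f (\<lambda>x. u (c *\<^sub>R x)) \<le> t * energy f u - d"
    using energy_scaling(3)[OF u(1) t] by (simp add: c_def d_def)
  also have "\<dots> < t * (E \<alpha> + d / t) - d"
  proof -
    have "energy f u < E \<alpha> + d / t" using u(3) by (simp add: \<epsilon>_def)
    then show ?thesis using t by simp
  qed
  also have "\<dots> = t * E \<alpha>" using t by (simp add: field_simps)
  finally show ?thesis
    using E_le[OF energy_scaling(1)[OF u(1) t]] energy_scaling(2)[OF u(1) t] u(2) \<alpha> t by (simp add: c_def)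
qed

lemma E_ratio_decreasing:
  assumes "0 < \<alpha>" "\<alpha> < \<beta>"
  shows "E \<beta> / \<beta> < E \<alpha> / \<alpha>"
  using E_scaling_strict[of \<alpha> "\<beta> / \<alpha>"] assms by (simp add: field_simps)

lemma E_ratio_le:
  assumes "0 < \<alpha>" "\<alpha> \<le> \<beta>"
  shows "\<alpha> * (E \<beta> / \<beta>) \<le> E \<alpha>"
  using E_ratio_decreasing[of \<alpha> \<beta>] assms by (cases "\<alpha> = \<beta>") (auto simp: field_simps)

theorem strict_subadditivity:
  assumes "0 < \<alpha>" "0 < \<beta>"
  shows "E (\<alpha> + \<beta>) < E \<alpha> + E \<beta>"
proof -
  define e where "e = E (\<alpha> + \<beta>) / (\<alpha> + \<beta>)"
  have "\<alpha> * e < E \<alpha>" "\<beta> * e < E \<beta>"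
    using E_ratio_decreasing[of \<alpha> "\<alpha> + \<beta>"] E_ratio_decreasing[of \<beta> "\<alpha> + \<beta>"] assms
    by (auto simp: e_def pos_less_divide_eq mult.commute)
  moreover have "E (\<alpha> + \<beta>) = (\<alpha> + \<beta>) * e"
    using assms by (simp add: e_def)
  then have "E (\<alpha> + \<beta>) = \<alpha> * e + \<beta> * e"
    by (simp add: distrib_right)
  ultimately show ?thesis by linarith
qed

end

section \<open>Compactness in the space of square-integrable functions\<close>

subsection \<open>Completeness\<close>

text \<open>
  The weights \<open>4\<^sup>k\<close> still leave a convergent series of integrals, and where the weighted series of squares
  converges the differences decay geometrically.
\<close>

lemma geometric_subsequence_AE_convergent:
  fixes w :: "nat \<Rightarrow> real ^ 'n \<Rightarrow> 'b::euclidean_space"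
  assumes w: "\<And>k. w k \<in> L2"
    and fast: "\<And>k. sq_int (\<lambda>x. w (Suc k) x - w k x) \<le> (1 / 8) ^ k"
  shows "AE x in lborel. convergent (\<lambda>k. w k x)"
proof -
  note [measurable] = L2_measurable[OF w]
  have d: "(\<lambda>x. w (Suc k) x - w k x) \<in> L2" for k by (rule L2_diff(1)[OF w w])
  have "(\<integral>\<^sup>+x. (\<Sum>k. ennreal (4 ^ k * (norm (w (Suc k) x - w k x))\<^sup>2)) \<partial>lborel)
      = (\<Sum>k. ennreal (4 ^ k * sq_int (\<lambda>x. w (Suc k) x - w k x)))"
    by (subst nn_integral_suminf)
      (auto simp: ennreal_mult nn_integral_cmult nn_integral_L2[OF d])
  also have "\<dots> \<le> (\<Sum>k. ennreal ((1 / 2) ^ k))"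
  proof (intro suminf_le allI ennreal_leI)
    fix k
    have "4 ^ k * sq_int (\<lambda>x. w (Suc k) x - w k x) \<le> 4 ^ k * (1 / 8) ^ k"
      by (intro mult_left_mono fast) simp
    also have "\<dots> = (1 / 2) ^ k" by (simp flip: power_mult_distrib)
    finally show "4 ^ k * sq_int (\<lambda>x. w (Suc k) x - w k x) \<le> (1 / 2) ^ k" .
  qed auto
  also have "\<dots> = ennreal (\<Sum>k. (1 / 2) ^ k)"
    by (intro suminf_ennreal2 summable_geometric) auto
  also have "\<dots> < \<infinity>" by simp
  finally have "(\<integral>\<^sup>+x. (\<Sum>k. ennreal (4 ^ k * (norm (w (Suc k) x - w k x))\<^sup>2)) \<partial>lborel) \<noteq> \<infinity>" by simp
  then have "AE x in lborel. (\<Sum>k. ennreal (4 ^ k * (norm (w (Suc k) x - w k x))\<^sup>2)) \<noteq> \<infinity>"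
    by (intro nn_integral_PInf_AE) auto
  then show ?thesis
  proof eventually_elim
    case (elim x)
    define S where "S = enn2real (\<Sum>k. ennreal (4 ^ k * (norm (w (Suc k) x - w k x))\<^sup>2))"
    have S: "ennreal S = (\<Sum>k. ennreal (4 ^ k * (norm (w (Suc k) x - w k x))\<^sup>2))" "0 \<le> S"
      using elim by (auto simp: S_def less_top)
    have le: "norm (w (Suc k) x - w k x) \<le> sqrt S * (1 / 2) ^ k" for k
    proof -
      have "ennreal (4 ^ k * (norm (w (Suc k) x - w k x))\<^sup>2) \<le> ennreal S"
        unfolding S(1) by (rule order_trans[OF _ sum_le_suminf[of _ "{k}"]]) auto
      then have "4 ^ k * (norm (w (Suc k) x - w k x))\<^sup>2 \<le> S" using S(2) by simp
      moreover have pow4: "((2::real) ^ k)\<^sup>2 = 4 ^ k" by (simp add: power2_eq_square flip: power_mult_distrib)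
      ultimately have "(2 ^ k * norm (w (Suc k) x - w k x))\<^sup>2 \<le> S"
        by (simp add: power_mult_distrib pow4)
      then have "2 ^ k * norm (w (Suc k) x - w k x) \<le> sqrt S" by (rule real_le_rsqrt)
      then show ?thesis by (simp add: field_simps power_one_over)
    qed
    have "summable (\<lambda>k. sqrt S * (1 / 2) ^ k)" by (intro summable_mult summable_geometric) simp
    then have "summable (\<lambda>k. w (Suc k) x - w k x)"
      by (rule summable_comparison_test'[where N = 0]) (use le in auto)
    then have "convergent (\<lambda>k. \<Sum>j<k. w (Suc j) x - w j x)" by (simp add: summable_iff_convergent)
    then have "convergent (\<lambda>k. w 0 x + (w k x - w 0 x))"
      unfolding sum_lessThan_telescope[of "\<lambda>j. w j x"] by (intro convergent_add convergent_const)
    then show ?case by simp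
  qed
qed

text \<open>
  Fatou's lemma turns the Cauchy property into closeness to the pointwise limit of a rapidly converging
  subsequence.
\<close>

lemma L2_complete:
  fixes w :: "nat \<Rightarrow> real ^ 'n \<Rightarrow> 'b::euclidean_space"
  assumes w: "\<And>k. w k \<in> L2"
    and Cauchy: "\<And>\<epsilon>. \<epsilon> > 0 \<Longrightarrow> \<exists>n0. \<forall>n\<ge>n0. \<forall>m\<ge>n0. sq_int (\<lambda>x. w n x - w m x) \<le> \<epsilon>"
  obtains v where "v \<in> L2" "(\<lambda>n. sq_int (\<lambda>x. w n x - v x)) \<longlonglongrightarrow> 0"
proof -
  note [measurable] = L2_measurable[OF w]
  have "\<forall>k. \<exists>n0. \<forall>n\<ge>n0. \<forall>m\<ge>n0. sq_int (\<lambda>x. w n x - w m x) \<le> (1 / 8) ^ k"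
    using Cauchy by simp
  then obtain N where N: "\<And>k n m. n \<ge> N k \<Longrightarrow> m \<ge> N k \<Longrightarrow> sq_int (\<lambda>x. w n x - w m x) \<le> (1 / 8) ^ k"
    by metis
  define r where "r k = (\<Sum>j\<le>k. N j) + k" for k
  have r: "N k \<le> r k" "r k \<le> r (Suc k)" "k \<le> r k" for k
    using member_le_sum[of k "{..k}" N] by (auto simp: r_def)
  have "AE x in lborel. convergent (\<lambda>k. w (r k) x)"
    by (rule geometric_subsequence_AE_convergent[OF w])
      (use N[of _ "r (Suc _)" "r _"] r order_trans in blast)
  define v where "v x = lim (\<lambda>k. w (r k) x)" for x
  have v[measurable]: "v \<in> borel_measurable borel" unfolding v_def by measurable
  have lim: "AE x in lborel. (\<lambda>k. w (r k) x) \<longlonglongrightarrow> v x"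
    using \<open>AE x in lborel. convergent (\<lambda>k. w (r k) x)\<close>
    by eventually_elim (simp add: v_def convergent_LIMSEQ_iff)
  have close: "\<exists>n0. \<forall>n\<ge>n0. (\<lambda>x. w n x - v x) \<in> L2 \<and> sq_int (\<lambda>x. w n x - v x) \<le> \<epsilon>" if \<epsilon>: "\<epsilon> > 0" for \<epsilon>
  proof -
    obtain n0 where n0: "\<And>n m. n \<ge> n0 \<Longrightarrow> m \<ge> n0 \<Longrightarrow> sq_int (\<lambda>x. w n x - w m x) \<le> \<epsilon>"
      using Cauchy[OF \<epsilon>] by blast
    show ?thesis
    proof (intro exI allI impI)
      fix n assume n: "n \<ge> n0"
      have "(\<integral>\<^sup>+x. ennreal ((norm (w n x - v x))\<^sup>2) \<partial>lborel)
          = (\<integral>\<^sup>+x. liminf (\<lambda>k. ennreal ((norm (w n x - w (r k) x))\<^sup>2)) \<partial>lborel)"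
      proof (rule nn_integral_cong_AE)
        show "AE x in lborel. ennreal ((norm (w n x - v x))\<^sup>2) = liminf (\<lambda>k. ennreal ((norm (w n x - w (r k) x))\<^sup>2))"
          using lim
        proof eventually_elim
          case (elim x)
          then have "(\<lambda>k. ennreal ((norm (w n x - w (r k) x))\<^sup>2)) \<longlonglongrightarrow> ennreal ((norm (w n x - v x))\<^sup>2)"
            by (intro tendsto_intros)
          then show ?case by (rule lim_imp_Liminf[OF trivial_limit_sequentially, symmetric])
        qed
      qed
      also have "\<dots> \<le> liminf (\<lambda>k. \<integral>\<^sup>+x. ennreal ((norm (w n x - w (r k) x))\<^sup>2) \<partial>lborel)"
        by (rule nn_integral_liminf) measurable
      also have "\<dots> \<le> ennreal \<epsilon>"
      proof (rule Liminf_le)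
        show "\<forall>\<^sub>F k in sequentially. (\<integral>\<^sup>+x. ennreal ((norm (w n x - w (r k) x))\<^sup>2) \<partial>lborel) \<le> ennreal \<epsilon>"
          unfolding eventually_sequentially nn_integral_L2[OF L2_diff(1)[OF w w]]
          using n0[OF n] order_trans[OF _ r(3)] by (intro exI[of _ n0]) (auto intro!: ennreal_leI)
      qed simp
      finally show "(\<lambda>x. w n x - v x) \<in> L2 \<and> sq_int (\<lambda>x. w n x - v x) \<le> \<epsilon>"
        using \<epsilon> by (intro conjI L2_nn_integralI) auto
    qed
  qed
  show ?thesis
  proof (rule that)
    obtain n where n: "(\<lambda>x. w n x - v x) \<in> L2" using close[of 1] by auto
    show "v \<in> L2" using L2_diff(1)[OF w[of n] n] by simp
    show "(\<lambda>n. sq_int (\<lambda>x. w n x - v x)) \<longlonglongrightarrow> 0"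
    proof (rule LIMSEQ_I)
      fix \<epsilon> :: real assume "\<epsilon> > 0"
      then obtain n0 where "\<And>n. n \<ge> n0 \<Longrightarrow> sq_int (\<lambda>x. w n x - v x) \<le> \<epsilon> / 2"
        using close[of "\<epsilon> / 2"] by auto
      then show "\<exists>n0. \<forall>n\<ge>n0. norm (sq_int (\<lambda>x. w n x - v x) - 0) < \<epsilon>"
        using \<open>\<epsilon> > 0\<close> by (intro exI[of _ n0]) (fastforce intro: le_less_trans)
    qed
  qed
qed

lemma sq_int_norm: "(\<lambda>x. norm (u x)) \<in> L2 \<longleftrightarrow> (\<lambda>x. norm (u x)) \<in> borel_measurable borel \<and> integrable lborel (\<lambda>x. (norm (u x))\<^sup>2)"
  "sq_int (\<lambda>x. norm (u x)) = sq_int u"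
  by (simp_all add: L2_def sq_int_def)

lemma L2_norm: "u \<in> L2 \<Longrightarrow> (\<lambda>x. norm (u x)) \<in> L2"
  using L2_measurable[of u] L2_integrable[of u] by (simp add: sq_int_norm)

lemma sq_int_tendsto:
  fixes w :: "nat \<Rightarrow> real ^ 'n \<Rightarrow> 'b::euclidean_space"
  assumes w: "\<And>k. w k \<in> L2" and v: "v \<in> L2"
    and lim: "(\<lambda>k. sq_int (\<lambda>x. w k x - v x)) \<longlonglongrightarrow> 0"
  shows "(\<lambda>k. sq_int (w k)) \<longlonglongrightarrow> sq_int v"
proof -
  define s where "s k = sq_int (\<lambda>x. w k x - v x)" for k
  have bound: "(sq_int (w k) - sq_int v)\<^sup>2 \<le> s k * (4 * s k + 6 * sq_int v)" for k
  proof -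
    have d: "(\<lambda>x. w k x - v x) \<in> L2" by (rule L2_diff(1)[OF w v])
    let ?a = "\<lambda>x. norm (w k x - v x)" and ?b = "\<lambda>x. norm (w k x) + norm (v x)"
    have a: "?a \<in> L2" "sq_int ?a = s k" by (simp_all add: L2_norm[OF d] sq_int_norm s_def)
    have b: "?b \<in> L2" "sq_int ?b \<le> 2 * sq_int (w k) + 2 * sq_int v"
      using L2_add[OF L2_norm[OF w] L2_norm[OF v], of k] by (auto simp: sq_int_norm)
    have ab: "integrable lborel (\<lambda>x. ?a x * ?b x)" using L2_integrable_scaleR[OF a(1) b(1)] by simp
    have "\<bar>sq_int (w k) - sq_int v\<bar> = \<bar>LINT x|lborel. (norm (w k x))\<^sup>2 - (norm (v x))\<^sup>2\<bar>"
      using L2_integrable[OF w] L2_integrable[OF v] by (simp add: sq_int_def)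
    also have "\<dots> \<le> (LINT x|lborel. \<bar>(norm (w k x))\<^sup>2 - (norm (v x))\<^sup>2\<bar>)" by (rule integral_abs_bound)
    also have "\<dots> \<le> (LINT x|lborel. ?a x * ?b x)"
    proof (rule integral_mono[OF _ ab])
      show "integrable lborel (\<lambda>x. \<bar>(norm (w k x))\<^sup>2 - (norm (v x))\<^sup>2\<bar>)"
        using L2_integrable[OF w] L2_integrable[OF v] by simp
      fix x
      have "\<bar>(norm (w k x))\<^sup>2 - (norm (v x))\<^sup>2\<bar> = \<bar>norm (w k x) - norm (v x)\<bar> * ?b x"
        by (simp add: power2_eq_square square_diff_square_factored abs_mult mult.commute)
      also have "\<dots> \<le> ?a x * ?b x" by (intro mult_right_mono norm_triangle_ineq3) auto
      finally show "\<bar>(norm (w k x))\<^sup>2 - (norm (v x))\<^sup>2\<bar> \<le> ?a x * ?b x" .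
    qed
    finally have "\<bar>sq_int (w k) - sq_int v\<bar>\<^sup>2 \<le> (LINT x|lborel. ?a x * ?b x)\<^sup>2"
      by (intro power_mono) auto
    also have "\<dots> \<le> sq_int ?a * sq_int ?b" using L2_Cauchy_Schwarz[OF a(1) b(1)] by simp
    also have "\<dots> \<le> s k * (4 * s k + 6 * sq_int v)"
    proof -
      have "sq_int (w k) \<le> 2 * s k + 2 * sq_int v"
        using L2_add(2)[OF d v] by (simp add: s_def)
      then show ?thesis unfolding a(2) using b(2) by (intro mult_left_mono) (auto simp: s_def)
    qed
    finally show ?thesis by simp
  qed
  have s0: "s \<longlonglongrightarrow> 0" using lim by (simp add: s_def[abs_def])
  have "(\<lambda>k. (sq_int (w k) - sq_int v)\<^sup>2) \<longlonglongrightarrow> 0"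
  proof (rule tendsto_sandwich[OF _ _ tendsto_const])
    have "(\<lambda>k. s k * (4 * s k + 6 * sq_int v)) \<longlonglongrightarrow> 0 * (4 * 0 + 6 * sq_int v)"
      by (intro tendsto_intros s0)
    then show "(\<lambda>k. s k * (4 * s k + 6 * sq_int v)) \<longlonglongrightarrow> 0" by simp
  qed (use bound in auto)
  from tendsto_real_sqrt[OF this] have "(\<lambda>k. \<bar>sq_int (w k) - sq_int v\<bar>) \<longlonglongrightarrow> 0" by simp
  then show ?thesis by (intro LIM_zero_cancel[where l = "sq_int v"]) (rule tendsto_rabs_zero_cancel)
qed

subsection \<open>Piecewise constant approximation\<close>

definition cell :: "nat \<Rightarrow> ('n::finite \<Rightarrow> int) \<Rightarrow> (real ^ 'n) set" where
  "cell k z = {x. \<forall>i. \<lfloor>real (Suc k) * x $ i\<rfloor> = z i}"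

lemma cell_measurable [measurable]: "cell k z \<in> sets borel"
  unfolding cell_def by measurable

lemma cell_bounds:
  fixes z :: "'n::finite \<Rightarrow> int" and k :: nat
  defines "a \<equiv> (\<chi> i. real_of_int (z i) / real (Suc k))" and "b \<equiv> (\<chi> i. (real_of_int (z i) + 1) / real (Suc k))"
  shows "box a b \<subseteq> cell k z" "cell k z \<subseteq> cbox a b"
    "measure lborel (box a b) = (1 / real (Suc k)) ^ CARD('n)"
    "measure lborel (cbox a b) = (1 / real (Suc k)) ^ CARD('n)"
proof -
  have pos: "0 < real (Suc k)" by simp
  show "box a b \<subseteq> cell k z"
    unfolding cell_def a_def b_def
    by (auto simp: mem_box_cart floor_eq_iff pos_divide_less_eq[OF pos] pos_less_divide_eq[OF pos] mult.commute less_imp_le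
        simp del: of_nat_Suc)
  show "cell k z \<subseteq> cbox a b"
    unfolding cell_def a_def b_def
    by (auto simp: mem_box_cart floor_eq_iff pos_divide_le_eq[OF pos] pos_le_divide_eq[OF pos] mult.commute less_imp_le
        simp del: of_nat_Suc)
  have diff: "b $ i - a $ i = 1 / real (Suc k)" for i
    unfolding a_def b_def vec_lambda_beta diff_divide_distrib[symmetric] by simp
  have "a $ i \<le> b $ i" for i using diff[of i] pos by (smt (verit) divide_pos_pos)
  then have "cbox a b \<noteq> {}" by (simp add: interval_ne_empty_cart)
  then show *: "measure lborel (cbox a b) = (1 / real (Suc k)) ^ CARD('n)"
    unfolding content_cbox_cart[OF \<open>cbox a b \<noteq> {}\<close>] diff by simp
  have "measure lborel (box a b) = measure lborel (cbox a b)"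
    by (simp add: measure_lborel_box_eq measure_lborel_cbox_eq)
  then show "measure lborel (box a b) = (1 / real (Suc k)) ^ CARD('n)" using * by simp
qed

lemma cell_measure:
  fixes z :: "'n::finite \<Rightarrow> int"
  shows "emeasure lborel (cell k z) = ennreal ((1 / real (Suc k)) ^ CARD('n))"
proof (rule antisym)
  define a b :: "real ^ 'n" where "a = (\<chi> i. real_of_int (z i) / real (Suc k))" and "b = (\<chi> i. (real_of_int (z i) + 1) / real (Suc k))"
  note B = cell_bounds[where z = z and k = k, folded a_def b_def]
  have fin: "emeasure lborel (cbox a b) < \<infinity>" "emeasure lborel (box a b) < \<infinity>"
    by (intro emeasure_bounded_finite; simp add: bounded_cbox bounded_box)+
  have "emeasure lborel (cell k z) \<le> emeasure lborel (cbox a b)" by (intro emeasure_mono B(2)) simp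
  also have "\<dots> = ennreal ((1 / real (Suc k)) ^ CARD('n))"
    using fin(1) B(4) by (subst emeasure_eq_ennreal_measure) (auto simp: less_top)
  finally show "emeasure lborel (cell k z) \<le> ennreal ((1 / real (Suc k)) ^ CARD('n))" .
  have "ennreal ((1 / real (Suc k)) ^ CARD('n)) = emeasure lborel (box a b)"
    using fin(2) B(3) by (subst emeasure_eq_ennreal_measure) (auto simp: less_top)
  also have "\<dots> \<le> emeasure lborel (cell k z)" by (intro emeasure_mono B(1)) (simp add: cell_measurable)
  finally show "ennreal ((1 / real (Suc k)) ^ CARD('n)) \<le> emeasure lborel (cell k z)" .
qed

lemma cell_diameter:
  fixes z :: "'n::finite \<Rightarrow> int"
  assumes "x \<in> cell k z" "y \<in> cell k z"
  shows "norm (y - x) \<le> real CARD('n) / real (Suc k)"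
proof -
  have "\<bar>(y - x) $ i\<bar> \<le> 1 / real (Suc k)" for i
  proof -
    have "real_of_int \<lfloor>real (Suc k) * x $ i\<rfloor> = real_of_int \<lfloor>real (Suc k) * y $ i\<rfloor>"
      using assms by (simp add: cell_def)
    then have "\<bar>real (Suc k) * y $ i - real (Suc k) * x $ i\<bar> \<le> 1"
      using of_int_floor_le[of "real (Suc k) * x $ i"] of_int_floor_le[of "real (Suc k) * y $ i"]
        real_of_int_floor_add_one_gt[of "real (Suc k) * x $ i"] real_of_int_floor_add_one_gt[of "real (Suc k) * y $ i"]
      by linarith
    also have "real (Suc k) * y $ i - real (Suc k) * x $ i = real (Suc k) * (y - x) $ i" by (simp add: algebra_simps)
    finally have "real (Suc k) * \<bar>(y - x) $ i\<bar> \<le> 1" by (simp only: abs_mult abs_of_nat)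
    then show ?thesis by (simp add: field_simps)
  qed
  then have "(\<Sum>i\<in>UNIV. \<bar>(y - x) $ i\<bar>) \<le> (\<Sum>i\<in>(UNIV :: 'n set). 1 / real (Suc k))" by (intro sum_mono)
  then show ?thesis using norm_le_l1_cart[of "y - x"] by simp
qed

definition cell_int :: "nat \<Rightarrow> ('n::finite \<Rightarrow> int) \<Rightarrow> (real ^ 'n \<Rightarrow> complex) \<Rightarrow> complex" where
  "cell_int k z w = (LINT x|lborel. indicat_real (cell k z) x *\<^sub>R w x)"

lemma cell_integrable:
  assumes "w \<in> L2" shows "integrable lborel (\<lambda>x. indicat_real (cell k z) x *\<^sub>R w x)"
proof -
  have "cell k z \<subseteq> cbox (\<chi> i. real_of_int (z i) / real (Suc k)) (\<chi> i. (real_of_int (z i) + 1) / real (Suc k))"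
    by (rule cell_bounds(2))
  moreover have "set_integrable lborel (cbox (\<chi> i. real_of_int (z i) / real (Suc k)) (\<chi> i. (real_of_int (z i) + 1) / real (Suc k))) w"
    using L2_locally_integrable[OF assms] by (simp add: locally_integrable_def)
  ultimately have "set_integrable lborel (cell k z) w"
    by (intro set_integrable_subset[of lborel _ w "cell k z"]) auto
  then show ?thesis by (simp add: set_integrable_def)
qed

lemma cell_int_diff:
  "w \<in> L2 \<Longrightarrow> v \<in> L2 \<Longrightarrow> cell_int k z (\<lambda>x. w x - v x) = cell_int k z w - cell_int k z v"
  using cell_integrable[of w k z] cell_integrable[of v k z] by (simp add: cell_int_def scaleR_diff_right)

lemma cell_int_bound:
  assumes w: "w \<in> L2" shows "norm (cell_int k z w) \<le> 1 + sq_int w"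
proof -
  have ind: "integrable lborel (indicat_real (cell k z))"
    by (rule integrable_real_indicator) (auto simp: cell_measure cell_measurable)
  have m: "measure lborel (cell k z) \<le> 1"
    by (simp add: measure_def cell_measure power_le_one)
  have "norm (cell_int k z w) \<le> (LINT x|lborel. norm (indicat_real (cell k z) x *\<^sub>R w x))"
    unfolding cell_int_def by (rule integral_norm_bound)
  also have "\<dots> \<le> (LINT x|lborel. indicat_real (cell k z) x + (norm (w x))\<^sup>2)"
  proof (rule integral_mono)
    show "integrable lborel (\<lambda>x. norm (indicat_real (cell k z) x *\<^sub>R w x))"
      by (rule integrable_norm[OF cell_integrable[OF w]])
    show "integrable lborel (\<lambda>x. indicat_real (cell k z) x + (norm (w x))\<^sup>2)"
      by (rule Bochner_Integration.integrable_add[OF ind L2_integrable[OF w]])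
    have "t \<le> 1 + t\<^sup>2" for t :: real
      using zero_le_power2[of "t - 1/2"] by (simp add: power2_eq_square algebra_simps)
    then show "norm (indicat_real (cell k z) x *\<^sub>R w x) \<le> indicat_real (cell k z) x + (norm (w x))\<^sup>2" for x
      by (auto simp: indicator_def)
  qed
  also have "\<dots> = measure lborel (cell k z) + sq_int w"
    using ind L2_integrable[OF w] by (simp add: sq_int_def)
  finally show ?thesis using m by simp
qed

text \<open>
  On a cell, \<open>w\<close> differs from its mean by the mean of its increments inside the cell.
\<close>

lemma cell_variance:
  fixes w :: "real ^ 'n \<Rightarrow> complex" and z :: "'n \<Rightarrow> int" and k :: nat
  defines "c \<equiv> real (Suc k) ^ CARD('n)"
  assumes w: "w \<in> L2"
  shows "(\<integral>\<^sup>+x. indicator (cell k z) x * ennreal ((norm (w x))\<^sup>2) \<partial>lborel)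
    \<le> ennreal (2 * c * (norm (cell_int k z w))\<^sup>2)
      + ennreal (2 * c) * (\<integral>\<^sup>+x. \<integral>\<^sup>+y. indicator (cell k z) x * (indicator (cell k z) y * ennreal ((norm (w y - w x))\<^sup>2)) \<partial>lborel \<partial>lborel)"
proof -
  note [measurable] = L2_measurable[OF w]
  let ?Q = "cell k z"
  have c: "c > 0" by (simp add: c_def)
  have \<mu>: "measure lborel ?Q = 1 / c" "emeasure lborel ?Q = ennreal (1 / c)"
    by (simp_all add: measure_def cell_measure c_def power_one_over)
  define m where "m = c *\<^sub>R cell_int k z w"
  have point: "ennreal ((norm (w x))\<^sup>2) \<le> ennreal (2 * (norm m)\<^sup>2)
      + ennreal (2 * c) * (\<integral>\<^sup>+y. indicator ?Q y * ennreal ((norm (w y - w x))\<^sup>2) \<partial>lborel)" for x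
  proof -
    have ind: "integrable lborel (\<lambda>y. indicat_real ?Q y *\<^sub>R w x)"
      using \<mu>(2) by (intro integrable_scaleR_left integrable_real_indicator) auto
    have "(LINT y|lborel. indicat_real ?Q y *\<^sub>R (w y - w x)) = cell_int k z w - (1 / c) *\<^sub>R w x"
      using cell_integrable[OF w, of k z] ind \<mu> by (simp add: cell_int_def scaleR_diff_right)
    then have mean: "m - w x = c *\<^sub>R (LINT y|lborel. indicat_real ?Q y *\<^sub>R (w y - w x))"
      using c by (simp add: m_def scaleR_diff_right)
    have int: "integrable lborel (\<lambda>y. indicat_real ?Q y *\<^sub>R (w y - w x))"
      using cell_integrable[OF w, of k z] ind by (simp add: scaleR_diff_right)
    have "ennreal (norm (LINT y|lborel. indicat_real ?Q y *\<^sub>R (w y - w x)))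
        \<le> (\<integral>\<^sup>+y. norm (indicat_real ?Q y *\<^sub>R (w y - w x)) \<partial>lborel)"
      by (rule integral_norm_bound_ennreal[OF int])
    also have "\<dots> = (\<integral>\<^sup>+y. indicator ?Q y * (indicator ?Q y * ennreal (norm (w y - w x))) \<partial>lborel)"
      by (intro nn_integral_cong) (auto simp: indicator_def)
    finally have "(ennreal (norm (LINT y|lborel. indicat_real ?Q y *\<^sub>R (w y - w x))))\<^sup>2
      \<le> (\<integral>\<^sup>+y. indicator ?Q y * (indicator ?Q y * ennreal (norm (w y - w x))) \<partial>lborel)\<^sup>2"
      by (intro power_mono) auto
    also have "\<dots> \<le> (\<integral>\<^sup>+y. (indicator ?Q y)\<^sup>2 \<partial>lborel) * (\<integral>\<^sup>+y. (indicator ?Q y * ennreal (norm (w y - w x)))\<^sup>2 \<partial>lborel)"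
      by (rule Cauchy_Schwarz_nn_integral) auto
    also have "(\<integral>\<^sup>+y. (indicator ?Q y)\<^sup>2 \<partial>lborel) = (\<integral>\<^sup>+y. indicator ?Q y \<partial>lborel)"
      by (intro nn_integral_cong) (auto simp: indicator_def)
    also have "\<dots> = ennreal (1 / c)" using \<mu> by simp
    also have "(\<integral>\<^sup>+y. (indicator ?Q y * ennreal (norm (w y - w x)))\<^sup>2 \<partial>lborel)
      = (\<integral>\<^sup>+y. indicator ?Q y * ennreal ((norm (w y - w x))\<^sup>2) \<partial>lborel)"
      by (intro nn_integral_cong) (auto simp: indicator_def ennreal_power)
    finally have cs: "ennreal ((norm (LINT y|lborel. indicat_real ?Q y *\<^sub>R (w y - w x)))\<^sup>2)
        \<le> ennreal (1 / c) * (\<integral>\<^sup>+y. indicator ?Q y * ennreal ((norm (w y - w x))\<^sup>2) \<partial>lborel)"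
      by (simp add: ennreal_power)
    have "(norm (w x))\<^sup>2 \<le> 2 * (norm m)\<^sup>2 + 2 * (norm (m - w x))\<^sup>2"
      using power2_norm_add_le[of m "w x - m"] by (simp add: norm_minus_commute)
    also have "\<dots> = 2 * (norm m)\<^sup>2 + 2 * c\<^sup>2 * (norm (LINT y|lborel. indicat_real ?Q y *\<^sub>R (w y - w x)))\<^sup>2"
      unfolding mean by (simp add: power_mult_distrib)
    finally have "ennreal ((norm (w x))\<^sup>2) \<le> ennreal (2 * (norm m)\<^sup>2)
        + ennreal (2 * c\<^sup>2) * ennreal ((norm (LINT y|lborel. indicat_real ?Q y *\<^sub>R (w y - w x)))\<^sup>2)"
      by (simp add: ennreal_leI flip: ennreal_mult ennreal_plus)
    also have "\<dots> \<le> ennreal (2 * (norm m)\<^sup>2) + ennreal (2 * c\<^sup>2) *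
        (ennreal (1 / c) * (\<integral>\<^sup>+y. indicator ?Q y * ennreal ((norm (w y - w x))\<^sup>2) \<partial>lborel))"
      by (intro add_left_mono mult_left_mono cs) auto
    also have "ennreal (2 * c\<^sup>2) * (ennreal (1 / c) * X) = ennreal (2 * c) * X" for X
    proof -
      have "ennreal (2 * c\<^sup>2) * ennreal (1 / c) = ennreal (2 * c)"
        using c by (subst ennreal_mult[symmetric]) (auto simp: power2_eq_square)
      then show ?thesis by (simp flip: mult.assoc)
    qed
    finally show ?thesis .
  qed
  have "(\<integral>\<^sup>+x. indicator ?Q x * ennreal ((norm (w x))\<^sup>2) \<partial>lborel)
    \<le> (\<integral>\<^sup>+x. ennreal (2 * (norm m)\<^sup>2) * indicator ?Q x
        + ennreal (2 * c) * (\<integral>\<^sup>+y. indicator ?Q x * (indicator ?Q y * ennreal ((norm (w y - w x))\<^sup>2)) \<partial>lborel) \<partial>lborel)"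
  proof (rule nn_integral_mono)
    fix x
    show "indicator ?Q x * ennreal ((norm (w x))\<^sup>2) \<le> ennreal (2 * (norm m)\<^sup>2) * indicator ?Q x
        + ennreal (2 * c) * (\<integral>\<^sup>+y. indicator ?Q x * (indicator ?Q y * ennreal ((norm (w y - w x))\<^sup>2)) \<partial>lborel)"
      using point[of x] by (cases "x \<in> ?Q") auto
  qed
  also have "\<dots> = ennreal (2 * (norm m)\<^sup>2) * ennreal (1 / c)
      + ennreal (2 * c) * (\<integral>\<^sup>+x. \<integral>\<^sup>+y. indicator ?Q x * (indicator ?Q y * ennreal ((norm (w y - w x))\<^sup>2)) \<partial>lborel \<partial>lborel)"
    by (subst nn_integral_add) (auto simp: nn_integral_cmult \<mu>)
  also have "ennreal (2 * (norm m)\<^sup>2) * ennreal (1 / c) = ennreal (2 * c * (norm (cell_int k z w))\<^sup>2)"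
    using c by (subst ennreal_mult[symmetric]) (auto simp: m_def power_mult_distrib power2_eq_square)
  finally show ?thesis .
qed

text \<open>
  Two points of one cell are at distance at most \<open>\<rho>\<close>, so the increments inside all cells together are among
  the increments by vectors of length at most \<open>\<rho>\<close>. The factor \<open>(k + 1)\<^sup>N\<close>, the inverse volume of a cell, cancels
  against the volume of that ball of vectors; the error that remains is of order \<open>1 / (k + 1)\<^sup>2\<close>.
\<close>

lemma grid_poincare:
  fixes w :: "real ^ 'n \<Rightarrow> complex" and Z :: "('n \<Rightarrow> int) set" and k :: nat
  defines "N \<equiv> CARD('n)" and "\<rho> \<equiv> real CARD('n) / real (Suc k)"
  assumes w: "w \<in> L2" and incr: "\<And>h. increment h w \<le> ennreal ((norm h)\<^sup>2 * G)" and G: "0 \<le> G"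
    and Z: "finite Z"
  shows "(\<integral>\<^sup>+x. indicator (\<Union>z\<in>Z. cell k z) x * ennreal ((norm (w x))\<^sup>2) \<partial>lborel)
    \<le> ennreal ((\<Sum>z\<in>Z. 2 * real (Suc k) ^ N * (norm (cell_int k z w))\<^sup>2)
        + 2 * unit_ball_volume TYPE('n) * real N ^ N * \<rho>\<^sup>2 * G)"
proof -
  note [measurable] = L2_measurable[OF w]
  define c where "c = real (Suc k) ^ N"
  have c: "c > 0" by (simp add: c_def)
  have \<rho>: "\<rho> > 0" by (simp add: \<rho>_def)
  have [measurable]: "cball (0 :: real ^ 'n) \<rho> \<in> sets borel" by simp
  let ?J = "\<lambda>z x y. indicator (cell k z) x * (indicator (cell k z) y * ennreal ((norm (w y - w x))\<^sup>2))"
  have disj: "x \<in> cell k z \<Longrightarrow> x \<in> cell k z' \<Longrightarrow> z = z'" for x :: "real ^ 'n" and z z'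
    by (auto simp: cell_def)
  have J: "(\<Sum>z\<in>Z. ?J z x y) \<le> indicator (cball 0 \<rho>) (y - x) * ennreal ((norm (w y - w x))\<^sup>2)" for x y
  proof (cases "\<exists>z\<in>Z. x \<in> cell k z \<and> y \<in> cell k z")
    case True
    then obtain z where z: "z \<in> Z" "x \<in> cell k z" "y \<in> cell k z" by blast
    have "(\<Sum>z'\<in>Z. ?J z' x y) = (\<Sum>z'\<in>Z. if z' = z then ennreal ((norm (w y - w x))\<^sup>2) else 0)"
      using z disj by (intro sum.cong) (auto simp: indicator_def)
    also have "\<dots> = ennreal ((norm (w y - w x))\<^sup>2)" using z Z by simp
    finally show ?thesis using cell_diameter[OF z(2,3)] by (simp add: \<rho>_def)
  next
    case False
    then have "(\<Sum>z\<in>Z. ?J z x y) = 0" by (intro sum.neutral) (auto simp: indicator_def)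
    then show ?thesis by simp
  qed
  have "(\<integral>\<^sup>+x. indicator (\<Union>z\<in>Z. cell k z) x * ennreal ((norm (w x))\<^sup>2) \<partial>lborel)
    \<le> (\<integral>\<^sup>+x. (\<Sum>z\<in>Z. indicator (cell k z) x * ennreal ((norm (w x))\<^sup>2)) \<partial>lborel)"
  proof (rule nn_integral_mono)
    fix x
    show "indicator (\<Union>z\<in>Z. cell k z) x * ennreal ((norm (w x))\<^sup>2) \<le> (\<Sum>z\<in>Z. indicator (cell k z) x * ennreal ((norm (w x))\<^sup>2))"
    proof (cases "\<exists>z\<in>Z. x \<in> cell k z")
      case True
      then obtain z where z: "z \<in> Z" "x \<in> cell k z" by blast
      then show ?thesis using member_le_sum[OF z(1) _ Z, of "\<lambda>z. indicator (cell k z) x * ennreal ((norm (w x))\<^sup>2)"]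
        by (auto simp: indicator_def)
    qed (auto simp: indicator_def)
  qed
  also have "\<dots> = (\<Sum>z\<in>Z. \<integral>\<^sup>+x. indicator (cell k z) x * ennreal ((norm (w x))\<^sup>2) \<partial>lborel)"
    by (rule nn_integral_sum) measurable
  also have "\<dots> \<le> (\<Sum>z\<in>Z. ennreal (2 * c * (norm (cell_int k z w))\<^sup>2)
      + ennreal (2 * c) * (\<integral>\<^sup>+x. \<integral>\<^sup>+y. ?J z x y \<partial>lborel \<partial>lborel))"
    unfolding c_def N_def by (intro sum_mono cell_variance w)
  also have "\<dots> = ennreal (\<Sum>z\<in>Z. 2 * c * (norm (cell_int k z w))\<^sup>2)
      + ennreal (2 * c) * (\<Sum>z\<in>Z. \<integral>\<^sup>+x. \<integral>\<^sup>+y. ?J z x y \<partial>lborel \<partial>lborel)"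
    unfolding sum.distrib sum_distrib_left using c by (subst sum_ennreal) auto
  also have "(\<Sum>z\<in>Z. \<integral>\<^sup>+x. \<integral>\<^sup>+y. ?J z x y \<partial>lborel \<partial>lborel) = (\<integral>\<^sup>+x. \<integral>\<^sup>+y. (\<Sum>z\<in>Z. ?J z x y) \<partial>lborel \<partial>lborel)"
    by (subst nn_integral_sum[symmetric], measurable)
      (intro nn_integral_cong nn_integral_sum[symmetric], measurable)
  also have "\<dots> \<le> (\<integral>\<^sup>+x. \<integral>\<^sup>+y. indicator (cball 0 \<rho>) (y - x) * ennreal ((norm (w y - w x))\<^sup>2) \<partial>lborel \<partial>lborel)"
    by (intro nn_integral_mono J)
  also have "\<dots> = (\<integral>\<^sup>+x. \<integral>\<^sup>+h. indicator (cball 0 \<rho>) h * ennreal ((norm (w (x + h) - w x))\<^sup>2) \<partial>lborel \<partial>lborel)"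
  proof (rule nn_integral_cong)
    fix x
    show "(\<integral>\<^sup>+y. indicator (cball 0 \<rho>) (y - x) * ennreal ((norm (w y - w x))\<^sup>2) \<partial>lborel)
        = (\<integral>\<^sup>+h. indicator (cball 0 \<rho>) h * ennreal ((norm (w (x + h) - w x))\<^sup>2) \<partial>lborel)"
      using nn_integral_lborel_translation[of "\<lambda>y. indicator (cball 0 \<rho>) (y - x) * ennreal ((norm (w y - w x))\<^sup>2)" x]
      by (simp add: add.commute)
  qed
  also have "\<dots> = (\<integral>\<^sup>+h. \<integral>\<^sup>+x. indicator (cball 0 \<rho>) h * ennreal ((norm (w (x + h) - w x))\<^sup>2) \<partial>lborel \<partial>lborel)"
    by (rule lborel_pair.Fubini') measurable
  also have "\<dots> = (\<integral>\<^sup>+h. indicator (cball 0 \<rho>) h * increment h w \<partial>lborel)"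
    unfolding increment_def by (intro nn_integral_cong nn_integral_cmult) measurable
  also have "\<dots> \<le> (\<integral>\<^sup>+h. ennreal (\<rho>\<^sup>2 * G) * indicator (cball (0 :: real ^ 'n) \<rho>) h \<partial>lborel)"
  proof (rule nn_integral_mono)
    fix h :: "real ^ 'n"
    show "indicator (cball 0 \<rho>) h * increment h w \<le> ennreal (\<rho>\<^sup>2 * G) * indicator (cball 0 \<rho>) h"
    proof (cases "h \<in> cball 0 \<rho>")
      case True
      then have "(norm h)\<^sup>2 * G \<le> \<rho>\<^sup>2 * G" using G by (intro mult_right_mono power_mono) auto
      then have "increment h w \<le> ennreal (\<rho>\<^sup>2 * G)" using incr[of h] by (meson ennreal_leI order_trans)
      then show ?thesis using True by simp
    qed simp
  qed
  also have "\<dots> = ennreal (\<rho>\<^sup>2 * G) * emeasure lborel (cball (0 :: real ^ 'n) \<rho>)"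
    by (rule nn_integral_cmult_indicator) simp
  also have "emeasure lborel (cball (0 :: real ^ 'n) \<rho>) = ennreal (\<rho> ^ N * unit_ball_volume TYPE('n))"
  proof -
    have "emeasure lborel (cball (0 :: real ^ 'n) \<rho>) = (\<integral>\<^sup>+x. indicator (cball (0 :: real ^ 'n) \<rho>) x \<partial>lborel)"
      by simp
    also have "\<dots> = ennreal (\<rho> ^ N) * (\<integral>\<^sup>+h. indicator (cball (0 :: real ^ 'n) \<rho>) (0 + \<rho> *\<^sub>R h) \<partial>lborel)"
      using \<rho> by (subst nn_integral_lborel_affine[where c = \<rho> and t = 0]) (auto simp: N_def)
    also have "(\<integral>\<^sup>+h. indicator (cball (0 :: real ^ 'n) \<rho>) (0 + \<rho> *\<^sub>R h) \<partial>lborel)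
        = (\<integral>\<^sup>+h. indicator (cball (0 :: real ^ 'n) 1) h \<partial>lborel)"
      using \<rho> by (intro nn_integral_cong) (auto simp: indicator_def)
    also have "\<dots> = ennreal (unit_ball_volume TYPE('n))" by (simp add: emeasure_unit_ball)
    finally show ?thesis using \<rho> by (simp add: ennreal_mult)
  qed
  also have "ennreal (2 * c) * (ennreal (\<rho>\<^sup>2 * G) * ennreal (\<rho> ^ N * unit_ball_volume TYPE('n)))
      = ennreal (2 * unit_ball_volume TYPE('n) * real N ^ N * \<rho>\<^sup>2 * G)"
  proof -
    have "c * \<rho> ^ N = real N ^ N" by (simp add: c_def \<rho>_def N_def power_divide)
    then have "(2 * c) * ((\<rho>\<^sup>2 * G) * (\<rho> ^ N * unit_ball_volume TYPE('n)))
        = 2 * unit_ball_volume TYPE('n) * real N ^ N * \<rho>\<^sup>2 * G"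
      by (simp add: mult_ac)
    then show ?thesis using c \<rho> G by (simp add: ennreal_mult[symmetric] del: ennreal_mult'')
  qed
  also have "ennreal (\<Sum>z\<in>Z. 2 * c * (norm (cell_int k z w))\<^sup>2) + ennreal (2 * unit_ball_volume TYPE('n) * real N ^ N * \<rho>\<^sup>2 * G)
    = ennreal ((\<Sum>z\<in>Z. 2 * c * (norm (cell_int k z w))\<^sup>2) + 2 * unit_ball_volume TYPE('n) * real N ^ N * \<rho>\<^sup>2 * G)"
    using c G by (intro ennreal_plus[symmetric] sum_nonneg) auto
  finally show ?thesis using c by (simp add: c_def mult_left_mono)
qed

subsection \<open>Tight sequences with bounded gradients\<close>

definition mass_on :: "(real ^ 'n) set \<Rightarrow> (real ^ 'n \<Rightarrow> 'b::euclidean_space) \<Rightarrow> real" where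
  "mass_on A u = (LINT x|lborel. indicat_real A x * (norm (u x))\<^sup>2)"

lemma mass_on_integrable:
  assumes "u \<in> L2" "A \<in> sets borel"
  shows "integrable lborel (\<lambda>x. indicat_real A x * (norm (u x))\<^sup>2)"
  using integrable_mult_indicator[OF _ L2_integrable[OF assms(1)], of A] assms(2) by simp

lemma nn_integral_mass_on:
  assumes "u \<in> L2" "A \<in> sets borel"
  shows "(\<integral>\<^sup>+x. indicator A x * ennreal ((norm (u x))\<^sup>2) \<partial>lborel) = ennreal (mass_on A u)"
proof -
  have "(\<integral>\<^sup>+x. indicator A x * ennreal ((norm (u x))\<^sup>2) \<partial>lborel)
      = (\<integral>\<^sup>+x. ennreal (indicat_real A x * (norm (u x))\<^sup>2) \<partial>lborel)"
    by (intro nn_integral_cong) (auto simp: indicator_def)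
  also have "\<dots> = ennreal (mass_on A u)"
    unfolding mass_on_def by (intro nn_integral_eq_integral mass_on_integrable assms) auto
  finally show ?thesis .
qed

lemma mass_on_le:
  assumes "u \<in> L2" "v \<in> L2" "A \<in> sets borel" "\<And>x. x \<in> A \<Longrightarrow> norm (u x) \<le> norm (v x)"
  shows "mass_on A u \<le> sq_int v"
  unfolding mass_on_def sq_int_def
  using assms by (intro integral_mono mass_on_integrable L2_integrable) (auto simp: indicator_def power_mono)

lemma mass_on_diff_le:
  assumes "u \<in> L2" "v \<in> L2" "A \<in> sets borel"
  shows "mass_on A (\<lambda>x. u x - v x) \<le> 2 * mass_on A u + 2 * mass_on A v"
proof -
  have "mass_on A (\<lambda>x. u x - v x)
      \<le> (LINT x|lborel. 2 * (indicat_real A x * (norm (u x))\<^sup>2) + 2 * (indicat_real A x * (norm (v x))\<^sup>2))"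
    unfolding mass_on_def
  proof (rule integral_mono)
    show "integrable lborel (\<lambda>x. indicat_real A x * (norm (u x - v x))\<^sup>2)"
      by (rule mass_on_integrable[OF L2_diff(1)[OF assms(1,2)] assms(3)])
    show "integrable lborel (\<lambda>x. 2 * (indicat_real A x * (norm (u x))\<^sup>2) + 2 * (indicat_real A x * (norm (v x))\<^sup>2))"
      using mass_on_integrable[OF assms(1,3)] mass_on_integrable[OF assms(2,3)] by simp
    show "indicat_real A x * (norm (u x - v x))\<^sup>2
        \<le> 2 * (indicat_real A x * (norm (u x))\<^sup>2) + 2 * (indicat_real A x * (norm (v x))\<^sup>2)" for x
      using power2_norm_add_le[of "u x" "- v x"] by (auto simp: indicator_def)
  qed
  also have "\<dots> = 2 * mass_on A u + 2 * mass_on A v"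
    using mass_on_integrable[OF assms(1,3)] mass_on_integrable[OF assms(2,3)] by (simp add: mass_on_def)
  finally show ?thesis .
qed

lemma sq_int_split:
  assumes "u \<in> L2" "A \<in> sets borel"
  shows "sq_int u = mass_on A u + mass_on (- A) u"
proof -
  have "(norm (u x))\<^sup>2 = indicat_real A x * (norm (u x))\<^sup>2 + indicat_real (- A) x * (norm (u x))\<^sup>2" for x
    by (auto simp: indicator_def)
  then have "sq_int u = (LINT x|lborel. indicat_real A x * (norm (u x))\<^sup>2 + indicat_real (- A) x * (norm (u x))\<^sup>2)"
    unfolding sq_int_def by simp
  then show ?thesis
    using mass_on_integrable[OF assms] mass_on_integrable[OF assms(1), of "- A"] assms(2)
    by (simp add: mass_on_def)
qed

text \<open>
  The Kolmogorov--Riesz argument. A diagonal subsequence makes the integrals over all cells of all grids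
  converge. Given \<open>\<epsilon>\<close>, the mass outside a large ball is small by tightness, a fine grid makes the
  Poincare error small, and finitely many cell means remain.
\<close>

theorem L2_compactness:
  fixes u :: "nat \<Rightarrow> real ^ 'n \<Rightarrow> complex"
  assumes s: "\<And>n. sobolev (u n) (g n)" and \<alpha>: "\<And>n. sq_int (u n) \<le> \<alpha>" and K: "\<And>n. sq_int (g n) \<le> K"
    and tight: "\<And>c. c > 0 \<Longrightarrow> \<exists>R. \<forall>\<^sub>F n in sequentially. mass_on {x. R < norm x} (u n) \<le> c"
  obtains r :: "nat \<Rightarrow> nat" where "strict_mono r"
    "\<And>\<epsilon>. \<epsilon> > 0 \<Longrightarrow> \<exists>n0. \<forall>n\<ge>n0. \<forall>m\<ge>n0. sq_int (\<lambda>x. u (r n) x - u (r m) x) \<le> \<epsilon>"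
proof -
  have u: "u n \<in> L2" for n using s by (rule sobolev_L2)
  have K0: "0 \<le> K" using K[of 0] sq_int_nonneg[of "g 0"] by linarith
  obtain r :: "nat \<Rightarrow> nat" where r: "strict_mono r"
    and conv: "\<And>p. p \<in> UNIV \<Longrightarrow> \<exists>l. (\<lambda>n. (\<lambda>(k, z). cell_int k z (u (r n))) p) \<longlonglongrightarrow> l"
  proof (rule function_convergent_subsequence[of "UNIV :: (nat \<times> ('n \<Rightarrow> int)) set" "\<lambda>n (k, z). cell_int k z (u n)" "1 + \<alpha>"])
    show "norm ((\<lambda>(k, z). cell_int k z (u n)) p) \<le> 1 + \<alpha>" for n p
      using cell_int_bound[OF u, of "fst p" "snd p" n] \<alpha>[of n] by (simp add: case_prod_unfold)
  qed auto
  have "\<forall>k z. \<exists>l. (\<lambda>n. cell_int k z (u (r n))) \<longlonglongrightarrow> l" using conv by auto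
  then obtain l where l: "\<And>k z. (\<lambda>n. cell_int k z (u (r n))) \<longlonglongrightarrow> l k z" by metis
  show ?thesis
  proof (rule that[OF r])
    fix \<epsilon> :: real assume \<epsilon>: "\<epsilon> > 0"
    define N where "N = CARD('n)"
    define C where "C = 2 * unit_ball_volume TYPE('n) * real N ^ N"
    obtain R where R: "\<forall>\<^sub>F n in sequentially. mass_on {x. R < norm x} (u n) \<le> \<epsilon> / 16"
      using tight[of "\<epsilon> / 16"] \<epsilon> by auto
    have "\<forall>\<^sub>F n in sequentially. mass_on {x. R < norm x} (u (r n)) \<le> \<epsilon> / 16"
      by (rule eventually_compose_filterlim[OF R filterlim_subseq[OF r]])
    then obtain n1 where n1: "\<And>n. n \<ge> n1 \<Longrightarrow> mass_on {x. R < norm x} (u (r n)) \<le> \<epsilon> / 16"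
      by (auto simp: eventually_sequentially)
    have "(\<lambda>k. C * (real N * inverse (real (Suc k)))\<^sup>2 * (4 * K)) \<longlonglongrightarrow> C * (real N * 0)\<^sup>2 * (4 * K)"
      by (intro tendsto_intros LIMSEQ_inverse_real_of_nat)
    then have "\<forall>\<^sub>F k in sequentially. C * (real N * inverse (real (Suc k)))\<^sup>2 * (4 * K) < \<epsilon> / 4"
      using \<epsilon> by (intro order_tendstoD(2)) auto
    then obtain k where k: "C * (real N * inverse (real (Suc k)))\<^sup>2 * (4 * K) < \<epsilon> / 4"
      by (auto simp: eventually_sequentially)
    define B where "B = \<lceil>real (Suc k) * R\<rceil> + 1"
    define Z where "Z = {z :: 'n \<Rightarrow> int. \<forall>i. z i \<in> {- B..B}}"
    have "Z = Pi\<^sub>E UNIV (\<lambda>_. {- B..B})" by (auto simp: Z_def PiE_def Pi_def)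
    then have Z: "finite Z" by (simp add: finite_PiE)
    have cover: "{x. norm x \<le> R} \<subseteq> (\<Union>z\<in>Z. cell k z)"
    proof
      fix x :: "real ^ 'n" assume "x \<in> {x. norm x \<le> R}"
      then have x: "\<bar>x $ i\<bar> \<le> R" for i using component_le_norm_cart[of x i] by auto
      have "\<lfloor>real (Suc k) * x $ i\<rfloor> \<in> {- B..B}" for i
      proof -
        have "\<bar>real (Suc k) * x $ i\<bar> \<le> real (Suc k) * R"
          using x[of i] by (simp only: abs_mult abs_of_nat) (intro mult_left_mono, auto)
        then show ?thesis unfolding B_def by (auto simp: le_floor_iff floor_le_iff) linarith+
      qed
      then show "x \<in> (\<Union>z\<in>Z. cell k z)"
        by (intro UN_I[of "\<lambda>i. \<lfloor>real (Suc k) * x $ i\<rfloor>"]) (auto simp: Z_def cell_def)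
    qed
    define S where "S n = (\<Sum>z\<in>Z. 2 * real (Suc k) ^ N * (norm (cell_int k z (u (r n)) - l k z))\<^sup>2)" for n
    have "S \<longlonglongrightarrow> (\<Sum>z\<in>Z. 2 * real (Suc k) ^ N * (norm (l k z - l k z))\<^sup>2)"
      unfolding S_def[abs_def] by (intro tendsto_intros l)
    then have "\<forall>\<^sub>F n in sequentially. S n < \<epsilon> / 16" using \<epsilon> by (intro order_tendstoD(2)) auto
    then obtain n2 where n2: "\<And>n. n \<ge> n2 \<Longrightarrow> S n \<le> \<epsilon> / 16"
      by (auto simp: eventually_sequentially intro: less_imp_le)
    show "\<exists>n0. \<forall>n\<ge>n0. \<forall>m\<ge>n0. sq_int (\<lambda>x. u (r n) x - u (r m) x) \<le> \<epsilon>"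
    proof (intro exI allI impI)
      fix n m assume "max n1 n2 \<le> n" "max n1 n2 \<le> m"
      then have nm: "n \<ge> n1" "n \<ge> n2" "m \<ge> n1" "m \<ge> n2" by auto
      define w where "w = (\<lambda>x. u (r n) x - u (r m) x)"
      have sw: "sobolev w (\<lambda>x. g (r n) x - g (r m) x)" unfolding w_def by (rule sobolev_diff[OF s s])
      have w: "w \<in> L2" by (rule sobolev_L2(1)[OF sw])
      have "sq_int (\<lambda>x. g (r n) x - g (r m) x) \<le> 4 * K"
        using L2_diff(2)[OF sobolev_L2(2)[OF s] sobolev_L2(2)[OF s], of "r n" "r m"] K[of "r n"] K[of "r m"] by linarith
      then have incr: "increment h w \<le> ennreal ((norm h)\<^sup>2 * (4 * K))" for h
        by (intro order_trans[OF translation_estimate[OF sw]] ennreal_leI mult_left_mono) auto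
      define U where "U = (\<Union>z\<in>Z. cell k z)"
      have Um[measurable]: "U \<in> sets borel" unfolding U_def using Z by (intro sets.finite_UN) (auto simp: cell_measurable)
      have "ennreal (mass_on U w) \<le> ennreal ((\<Sum>z\<in>Z. 2 * real (Suc k) ^ CARD('n) * (norm (cell_int k z w))\<^sup>2)
        + 2 * unit_ball_volume TYPE('n) * real CARD('n) ^ CARD('n) * (real CARD('n) / real (Suc k))\<^sup>2 * (4 * K))"
      proof (rule order_trans[OF eq_refl])
        show "ennreal (mass_on U w) = (\<integral>\<^sup>+x. indicator (\<Union>z\<in>Z. cell k z) x * ennreal ((norm (w x))\<^sup>2) \<partial>lborel)"
          using nn_integral_mass_on[OF w Um, symmetric] by (simp add: U_def)
      qed (use K0 in \<open>intro grid_poincare w incr Z, auto\<close>)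
      then have "mass_on U w \<le> (\<Sum>z\<in>Z. 2 * real (Suc k) ^ CARD('n) * (norm (cell_int k z w))\<^sup>2)
        + 2 * unit_ball_volume TYPE('n) * real CARD('n) ^ CARD('n) * (real CARD('n) / real (Suc k))\<^sup>2 * (4 * K)"
        using K0 by (subst (asm) ennreal_le_iff) (auto intro!: add_nonneg_nonneg sum_nonneg)
      also have "2 * unit_ball_volume TYPE('n) * real CARD('n) ^ CARD('n) * (real CARD('n) / real (Suc k))\<^sup>2 * (4 * K) \<le> \<epsilon> / 4"
        using k unfolding C_def N_def divide_inverse by (rule less_imp_le)
      also have "(\<Sum>z\<in>Z. 2 * real (Suc k) ^ CARD('n) * (norm (cell_int k z w))\<^sup>2) \<le> 2 * S n + 2 * S m"
        unfolding S_def N_def sum_distrib_left sum.distrib[symmetric]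
      proof (rule sum_mono)
        fix z
        have "cell_int k z w = (cell_int k z (u (r n)) - l k z) + (l k z - cell_int k z (u (r m)))"
          unfolding w_def by (simp add: cell_int_diff[OF u u])
        then have "(norm (cell_int k z w))\<^sup>2 \<le> 2 * (norm (cell_int k z (u (r n)) - l k z))\<^sup>2 + 2 * (norm (cell_int k z (u (r m)) - l k z))\<^sup>2"
          using power2_norm_add_le[of "cell_int k z (u (r n)) - l k z" "l k z - cell_int k z (u (r m))"]
          by (simp add: norm_minus_commute)
        from mult_left_mono[OF this, of "2 * real (Suc k) ^ CARD('n)"]
        show "2 * real (Suc k) ^ CARD('n) * (norm (cell_int k z w))\<^sup>2
          \<le> 2 * (2 * real (Suc k) ^ CARD('n) * (norm (cell_int k z (u (r n)) - l k z))\<^sup>2)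
            + 2 * (2 * real (Suc k) ^ CARD('n) * (norm (cell_int k z (u (r m)) - l k z))\<^sup>2)"
          by (simp only: distrib_left mult_ac) simp
      qed
      finally have inner: "mass_on U w \<le> \<epsilon> / 2" using n2[OF nm(2)] n2[OF nm(4)] by linarith
      have tail: "{x :: real ^ 'n. R < norm x} \<in> sets borel" by measurable
      have "mass_on (- U) w \<le> mass_on {x. R < norm x} w"
        unfolding mass_on_def
      proof (rule integral_mono[OF mass_on_integrable[OF w] mass_on_integrable[OF w tail]])
        show "- U \<in> sets borel" using Um by simp
        show "indicat_real (- U) x * (norm (w x))\<^sup>2 \<le> indicat_real {x. R < norm x} x * (norm (w x))\<^sup>2" for x
          using cover by (intro mult_right_mono) (auto simp: indicator_def U_def subset_iff not_le)
      qed
      also have "\<dots> \<le> 2 * mass_on {x. R < norm x} (u (r n)) + 2 * mass_on {x. R < norm x} (u (r m))"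
        unfolding w_def by (rule mass_on_diff_le[OF u u tail])
      also have "\<dots> \<le> \<epsilon> / 4" using n1[OF nm(1)] n1[OF nm(3)] by linarith
      finally show "sq_int (\<lambda>x. u (r n) x - u (r m) x) \<le> \<epsilon>"
        using sq_int_split[OF w Um] inner \<epsilon> by (simp add: w_def)
    qed
  qed
qed

section \<open>Splitting the energy\<close>

subsection \<open>Cutoff functions\<close>

text \<open>
  A smooth transition from 0 on the negative half line to 1 beyond the point 1.
\<close>

definition smooth_step :: "real \<Rightarrow> real" where
  "smooth_step t = exp_flat 0 t * inverse (exp_flat 0 t + exp_flat 0 (1 - t))"

lemma smooth_step_denominator: "exp_flat 0 t + exp_flat 0 (1 - t) > 0"
  using exp_flat_nonneg[of t] exp_flat_nonneg[of "1 - t"] exp_flat_pos_iff[of t] exp_flat_pos_iff[of "1 - t"]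
  by linarith

lemma smooth_step_bounds: "0 \<le> smooth_step t" "smooth_step t \<le> 1"
  using smooth_step_denominator[of t] exp_flat_nonneg[of t] exp_flat_nonneg[of "1 - t"]
  by (auto simp: smooth_step_def field_simps)

lemma smooth_step_0_iff: "smooth_step t = 0 \<longleftrightarrow> t \<le> 0"
  using smooth_step_denominator[of t] exp_flat_nonneg[of t] exp_flat_pos_iff[of t]
  by (auto simp: smooth_step_def)

lemma smooth_step_1_iff: "smooth_step t = 1 \<longleftrightarrow> 1 \<le> t"
  using smooth_step_denominator[of t] exp_flat_nonneg[of "1 - t"] exp_flat_pos_iff[of "1 - t"]
  by (auto simp: smooth_step_def field_simps)

definition smooth_step_deriv :: "real \<Rightarrow> real" where
  "smooth_step_deriv t = (exp_flat 2 t * exp_flat 0 (1 - t) + exp_flat 0 t * exp_flat 2 (1 - t))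
    / (exp_flat 0 t + exp_flat 0 (1 - t))\<^sup>2"

lemma DERIV_smooth_step: "(smooth_step has_real_derivative smooth_step_deriv t) (at t)"
proof -
  have 1: "(exp_flat 0 has_real_derivative exp_flat 2 t) (at t)" for t
    using DERIV_exp_flat[of 0 t] by (simp add: numeral_2_eq_2)
  have 2: "((\<lambda>t. exp_flat 0 (1 - t)) has_real_derivative - exp_flat 2 (1 - t)) (at t)"
  proof -
    have "((\<lambda>t. 1 - t) has_real_derivative - 1) (at t)" by (auto intro!: derivative_eq_intros)
    from DERIV_chain2[where f = "exp_flat 0" and g = "\<lambda>t. 1 - t" and x = t, OF 1 this]
    show ?thesis by simp
  qed
  have D: "exp_flat 0 t + exp_flat 0 (1 - t) \<noteq> 0" using smooth_step_denominator[of t] by simp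
  have "((\<lambda>t. exp_flat 0 t / (exp_flat 0 t + exp_flat 0 (1 - t))) has_real_derivative
      (exp_flat 2 t * (exp_flat 0 t + exp_flat 0 (1 - t)) - exp_flat 0 t * (exp_flat 2 t + - exp_flat 2 (1 - t)))
        / ((exp_flat 0 t + exp_flat 0 (1 - t)) * (exp_flat 0 t + exp_flat 0 (1 - t)))) (at t)"
    by (rule DERIV_divide[OF 1 DERIV_add[OF 1 2] D])
  moreover have "exp_flat 2 t * (exp_flat 0 t + exp_flat 0 (1 - t)) - exp_flat 0 t * (exp_flat 2 t + - exp_flat 2 (1 - t))
      = exp_flat 2 t * exp_flat 0 (1 - t) + exp_flat 0 t * exp_flat 2 (1 - t)"
    by (simp add: algebra_simps)
  ultimately show ?thesis
    unfolding smooth_step_def[abs_def] smooth_step_deriv_def by (simp add: power2_eq_square divide_inverse)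
qed

lemma smooth_step_deriv_bounded: "\<exists>S>0. \<forall>t. \<bar>smooth_step_deriv t\<bar> \<le> S"
proof -
  have cont: "continuous_on A (exp_flat m)" for m A
    using DERIV_exp_flat[of m] by (meson DERIV_continuous continuous_at_imp_continuous_on)
  have cont1: "continuous_on {0..1} (\<lambda>t. exp_flat m (1 - t))" for m
    by (rule continuous_on_compose2[OF cont[of UNIV]]) (auto intro: continuous_intros)
  have "continuous_on {0..1} smooth_step_deriv"
    unfolding smooth_step_deriv_def[abs_def] using smooth_step_denominator
    by (intro continuous_intros cont cont1) (auto simp: less_imp_neq[symmetric])
  then have "compact (smooth_step_deriv ` {0..1})" by (intro compact_continuous_image) auto
  then obtain S where S: "S > 0" "\<And>t. t \<in> {0..1} \<Longrightarrow> \<bar>smooth_step_deriv t\<bar> \<le> S"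
    by (metis bounded_pos compact_imp_bounded image_eqI real_norm_def)
  have "smooth_step_deriv t = 0" if "t \<notin> {0..1}" for t
    using that by (auto simp: smooth_step_deriv_def exp_flat_def)
  then have "\<bar>smooth_step_deriv t\<bar> \<le> S" for t using S by (cases "t \<in> {0..1}") auto
  then show ?thesis using S(1) by blast
qed

text \<open>
  The cutoff depends on \<open>|x|\<^sup>2\<close>, which keeps it smooth at the origin. It falls from 1 to 0 on the shell
  \<open>k \<le> |x|\<^sup>2 / L\<^sup>2 \<le> k + 1\<close>; for different \<open>k\<close> the open shells are disjoint.
\<close>

definition cutoff :: "real \<Rightarrow> nat \<Rightarrow> real ^ 'n \<Rightarrow> real" where
  "cutoff L k x = smooth_step (real k + 1 - (norm x)\<^sup>2 / L\<^sup>2)"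

lemma smooth_cutoff: "smooth (cutoff L k :: real ^ 'n \<Rightarrow> real)"
proof -
  define A where "A x = (real k + 1) - (\<Sum>i\<in>UNIV. x $ i * x $ i) * (1 / L\<^sup>2)" for x :: "real ^ 'n"
  have sq: "smooth (\<lambda>x :: real ^ 'n. \<Sum>i\<in>UNIV. x $ i * x $ i)"
    by (rule smooth_sum[OF finite_class.finite_UNIV smooth_mult[OF smooth_coord smooth_coord]])
  have a: "smooth A"
    unfolding A_def by (rule smooth_diff[OF smooth_const smooth_mult[OF sq smooth_const]])
  note e = smooth_exp_flat[OF a, of 0] smooth_exp_flat[OF smooth_diff[OF smooth_const a], of 0 1]
  have "smooth (\<lambda>x. smooth_step (A x))"
    unfolding smooth_step_def
    by (rule smooth_mult[OF e(1) smooth_inverse[OF smooth_add[OF e]]])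
      (rule less_imp_neq[OF smooth_step_denominator, symmetric])
  moreover have "(norm x)\<^sup>2 = (\<Sum>i\<in>UNIV. x $ i * x $ i)" for x :: "real ^ 'n"
    by (simp add: power2_norm_eq_inner inner_vec_def)
  ultimately show ?thesis by (simp add: cutoff_def[abs_def] A_def)
qed

lemma cutoff_bounds: "0 \<le> cutoff L k x" "cutoff L k x \<le> 1"
  by (simp_all add: cutoff_def smooth_step_bounds)

lemma cutoff_1_iff: "L > 0 \<Longrightarrow> cutoff L k x = 1 \<longleftrightarrow> (norm x)\<^sup>2 \<le> real k * L\<^sup>2"
  unfolding cutoff_def smooth_step_1_iff by (simp add: field_simps)

lemma cutoff_0_iff: "L > 0 \<Longrightarrow> cutoff L k x = 0 \<longleftrightarrow> (real k + 1) * L\<^sup>2 \<le> (norm x)\<^sup>2"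
  unfolding cutoff_def smooth_step_0_iff by (simp add: field_simps)

text \<open>
  The derivative of \<open>|x|\<^sup>2 / L\<^sup>2\<close> is of order \<open>\<surd>(K + 1) / L\<close> on the shells with \<open>k \<le> K\<close>.
\<close>

lemma cutoff_gradient:
  "\<exists>L\<ge>1. \<forall>k\<le>K. \<forall>x :: real ^ 'n. (\<Sum>i\<in>UNIV. (frechet_derivative (cutoff L k) (at x) (axis i 1))\<^sup>2) \<le> 1"
proof -
  obtain S where S: "S > 0" "\<And>t. \<bar>smooth_step_deriv t\<bar> \<le> S" using smooth_step_deriv_bounded by blast
  define L where "L = max 1 (2 * S * sqrt (real K + 1))"
  have L: "L \<ge> 1" "4 * S\<^sup>2 * (real K + 1) \<le> L\<^sup>2"
  proof -
    show "L \<ge> 1" by (simp add: L_def)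
    have "(2 * S * sqrt (real K + 1))\<^sup>2 \<le> L\<^sup>2" using S by (intro power_mono) (auto simp: L_def)
    then show "4 * S\<^sup>2 * (real K + 1) \<le> L\<^sup>2" by (simp add: power_mult_distrib)
  qed
  show ?thesis
  proof (intro exI conjI allI impI)
    show "1 \<le> L" by (rule L)
    fix k and x :: "real ^ 'n" assume k: "k \<le> K"
    let ?a = "real k + 1 - (norm x)\<^sup>2 / L\<^sup>2"
    have "((\<lambda>x. real k + 1 - (x \<bullet> x) * c) has_derivative (\<lambda>v. - (2 * (x \<bullet> v)) * c)) (at x)" for c
      by (auto intro!: derivative_eq_intros simp: inner_commute)
    from this[of "1 / L\<^sup>2"] have "((\<lambda>x. real k + 1 - (norm x)\<^sup>2 / L\<^sup>2) has_derivative (\<lambda>v. - (2 * (x \<bullet> v)) / L\<^sup>2)) (at x)"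
      by (simp add: power2_norm_eq_inner)
    from has_derivative_compose[OF this DERIV_smooth_step[of ?a, unfolded has_field_derivative_def]]
    have "(cutoff L k has_derivative (\<lambda>v. smooth_step_deriv ?a * (- (2 * (x \<bullet> v)) / L\<^sup>2))) (at x)"
      by (simp add: cutoff_def[abs_def])
    then have D: "frechet_derivative (cutoff L k) (at x) (axis i 1) = smooth_step_deriv ?a * (- (2 * x $ i) / L\<^sup>2)" for i
      using fun_cong[OF frechet_derivative_at, of _ _ _ "axis i 1"] by (fastforce simp: inner_axis)
    have "(\<Sum>i\<in>UNIV. (frechet_derivative (cutoff L k) (at x) (axis i 1))\<^sup>2)
        = (smooth_step_deriv ?a)\<^sup>2 * (4 / L ^ 4) * (\<Sum>i\<in>UNIV. x $ i * x $ i)"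
      unfolding D sum_distrib_left
      by (intro sum.cong refl) (simp add: power_mult_distrib power_divide power2_eq_square power4_eq_xxxx mult_ac)
    also have "(\<Sum>i\<in>UNIV. x $ i * x $ i) = (norm x)\<^sup>2" by (simp add: power2_norm_eq_inner inner_vec_def)
    also have "(smooth_step_deriv ?a)\<^sup>2 * (4 / L ^ 4) * (norm x)\<^sup>2 \<le> 1"
    proof (cases "?a \<ge> 0")
      case False
      then have "smooth_step_deriv ?a = 0" by (auto simp: smooth_step_deriv_def exp_flat_def)
      then show ?thesis by simp
    next
      case True
      have "(norm x)\<^sup>2 \<le> (real k + 1) * L\<^sup>2" using True L by (simp add: field_simps)
      also have "\<dots> \<le> (real K + 1) * L\<^sup>2" using k by (intro mult_right_mono) auto
      finally have x: "(norm x)\<^sup>2 \<le> (real K + 1) * L\<^sup>2" .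
      have "(smooth_step_deriv ?a)\<^sup>2 \<le> S\<^sup>2" using power_mono[OF S(2)[of ?a], of 2] by simp
      then have "(smooth_step_deriv ?a)\<^sup>2 * (4 / L ^ 4) * (norm x)\<^sup>2 \<le> S\<^sup>2 * (4 / L ^ 4) * ((real K + 1) * L\<^sup>2)"
        using x L by (intro mult_mono) auto
      also have "\<dots> = (4 * S\<^sup>2 * (real K + 1)) / L\<^sup>2"
        using L by (simp add: field_simps power4_eq_xxxx power2_eq_square)
      also have "\<dots> \<le> 1" using L by (simp add: divide_le_eq)
      finally show ?thesis .
    qed
    finally show "(\<Sum>i\<in>UNIV. (frechet_derivative (cutoff L k) (at x) (axis i 1))\<^sup>2) \<le> 1" .
  qed
qed

lemma derivative_zero_at_extremum:
  fixes \<eta> :: "real ^ 'n \<Rightarrow> real"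
  assumes \<eta>: "smooth \<eta>" "\<And>x. 0 \<le> \<eta> x" "\<And>x. \<eta> x \<le> 1" and x: "\<eta> x = 0 \<or> \<eta> x = 1"
  shows "frechet_derivative \<eta> (at x) v = 0"
proof -
  have "frechet_derivative \<eta> (at x) = (\<lambda>v. 0)"
    by (rule differential_zero_maxmin[of x UNIV, OF _ _ smooth_has_derivative[OF \<eta>(1)]]) (use \<eta> x in auto)
  then show ?thesis by simp
qed

context mass_subcritical
begin

definition total_density :: "(real ^ 'n \<Rightarrow> complex) \<Rightarrow> (real ^ 'n \<Rightarrow> complex ^ 'n) \<Rightarrow> real ^ 'n \<Rightarrow> real" where
  "total_density u g x = (norm (g x))\<^sup>2 + (norm (u x))\<^sup>2 + norm (u x) powr crit_exp TYPE('n)"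

lemma total_density_nonneg: "0 \<le> total_density u g x"
  by (simp add: total_density_def)

lemma total_density_integrable:
  fixes u :: "real ^ 'n \<Rightarrow> complex"
  assumes "sobolev u g"
  shows "integrable lborel (total_density u g)" "(LINT x|lborel. total_density u g x) = sq_int g + sq_int u + crit_int u"
  using L2_integrable[OF sobolev_L2(1)[OF assms]] L2_integrable[OF sobolev_L2(2)[OF assms]] sobolev_crit_integrable[OF assms]
  by (simp_all add: total_density_def[abs_def] sq_int_def crit_int_def)

text \<open>
  Off the transition set the cutoff takes an extreme value, so its gradient vanishes: one of the two pieces is
  zero with zero gradient, the other agrees with \<open>u\<close>, and the densities add up exactly. On the transition set everything is bounded by a multiple of
  \<open>total_density\<close>.
\<close>

lemma energy_splitting:
  "\<exists>C\<ge>0. \<forall>(u :: real ^ 'n \<Rightarrow> complex) g \<eta>. sobolev u g \<longrightarrow> smooth \<eta> \<longrightarrow> (\<forall>x. 0 \<le> \<eta> x \<and> \<eta> x \<le> 1) \<longrightarrow>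
    (\<forall>x. (\<Sum>i\<in>UNIV. (frechet_derivative \<eta> (at x) (axis i 1))\<^sup>2) \<le> 1) \<longrightarrow>
    (\<exists>g1 g2. sobolev (\<lambda>x. \<eta> x *\<^sub>R u x) g1 \<and> sobolev (\<lambda>x. (1 - \<eta> x) *\<^sub>R u x) g2 \<and>
      energy f (\<lambda>x. \<eta> x *\<^sub>R u x) + energy f (\<lambda>x. (1 - \<eta> x) *\<^sub>R u x)
        \<le> energy f u + C * (LINT x|lborel. indicat_real {x. 0 < \<eta> x \<and> \<eta> x < 1} x * total_density u g x))"
proof -
  obtain A0 where A0: "A0 \<ge> 0" "\<And>z. \<bar>F f z\<bar> \<le> A0 * (norm z)\<^sup>2 + 1 * norm z powr crit_exp TYPE('n)"
    using F_bound_large[of 1] by auto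
  define C1 where "C1 = A0 + 1"
  have C1: "C1 \<ge> 0" "\<bar>F f z\<bar> \<le> C1 * ((norm z)\<^sup>2 + norm z powr crit_exp TYPE('n))" for z
  proof -
    show "C1 \<ge> 0" using A0 by (simp add: C1_def)
    have "A0 * (norm z)\<^sup>2 + 1 * norm z powr crit_exp TYPE('n) \<le> C1 * (norm z)\<^sup>2 + C1 * norm z powr crit_exp TYPE('n)"
      using A0(1) by (intro add_mono mult_right_mono) (auto simp: C1_def)
    then show "\<bar>F f z\<bar> \<le> C1 * ((norm z)\<^sup>2 + norm z powr crit_exp TYPE('n))"
      using A0(2)[of z] by (simp add: distrib_left)
  qed
  show ?thesis
  proof (intro exI[of _ "2 + 3 * C1"] conjI allI impI)
    show "0 \<le> 2 + 3 * C1" using C1 by simp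
    fix u :: "real ^ 'n \<Rightarrow> complex" and g and \<eta> :: "real ^ 'n \<Rightarrow> real"
    assume s: "sobolev u g" and sm: "smooth \<eta>" and \<eta>': "\<forall>x. 0 \<le> \<eta> x \<and> \<eta> x \<le> 1"
      and grad: "\<forall>x. (\<Sum>i\<in>UNIV. (frechet_derivative \<eta> (at x) (axis i 1))\<^sup>2) \<le> 1"
    have \<eta>: "0 \<le> \<eta> x" "\<eta> x \<le> 1" for x using \<eta>' by auto
    have d: "\<bar>frechet_derivative \<eta> (at x) (axis i 1)\<bar> \<le> 1" for x i
    proof -
      have "(frechet_derivative \<eta> (at x) (axis i 1))\<^sup>2 \<le> (\<Sum>i\<in>UNIV. (frechet_derivative \<eta> (at x) (axis i 1))\<^sup>2)"
        by (rule member_le_sum) auto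
      then have "(frechet_derivative \<eta> (at x) (axis i 1))\<^sup>2 \<le> 1" using grad order_trans by blast
      then show ?thesis by (simp add: abs_square_le_1)
    qed
    define w where "w x = (\<chi> i. frechet_derivative \<eta> (at x) (axis i 1) *\<^sub>R u x)" for x
    define A where "A = {x. 0 < \<eta> x \<and> \<eta> x < 1}"
    have [measurable]: "\<eta> \<in> borel_measurable borel"
      using sm by (intro borel_measurable_continuous_onI smooth_continuous)
    have A: "A \<in> sets borel" unfolding A_def by measurable
    have offA: "\<eta> x = 0 \<or> \<eta> x = 1" if "x \<notin> A" for x using that \<eta>[of x] by (auto simp: A_def)
    have w_le: "(norm (w x))\<^sup>2 \<le> (norm (u x))\<^sup>2" for x
    proof -
      have "(norm (w x))\<^sup>2 = (\<Sum>i\<in>UNIV. (frechet_derivative \<eta> (at x) (axis i 1))\<^sup>2) * (norm (u x))\<^sup>2"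
        by (simp add: w_def norm_vec_def L2_set_def sum_nonneg power_mult_distrib sum_distrib_right)
      also have "\<dots> \<le> 1 * (norm (u x))\<^sup>2" using grad by (intro mult_right_mono) auto
      finally show ?thesis by simp
    qed
    have w0: "w x = 0" if "x \<notin> A" for x
      using derivative_zero_at_extremum[OF sm \<eta> offA[OF that]] by (simp add: w_def vec_eq_iff)
    let ?g1 = "\<lambda>x. \<eta> x *\<^sub>R g x + w x" and ?g2 = "\<lambda>x. (1 - \<eta> x) *\<^sub>R g x - w x"
    have s1: "sobolev (\<lambda>x. \<eta> x *\<^sub>R u x) ?g1"
      unfolding w_def by (rule sobolev_mult_smooth[OF s sm _ d]) (use \<eta> in \<open>simp add: abs_le_iff order_trans[of _ 0]\<close>)
    have s2: "sobolev (\<lambda>x. (1 - \<eta> x) *\<^sub>R u x) ?g2"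
      using sobolev_diff[OF s s1] by (simp add: algebra_simps)
    have int: "integrable lborel (\<lambda>x. indicat_real A x * total_density u g x)"
      using integrable_mult_indicator[OF _ total_density_integrable(1)[OF s], of A] A by simp
    have point: "1/2 * (norm (?g1 x))\<^sup>2 - F f (\<eta> x *\<^sub>R u x) + (1/2 * (norm (?g2 x))\<^sup>2 - F f ((1 - \<eta> x) *\<^sub>R u x))
        \<le> 1/2 * (norm (g x))\<^sup>2 - F f (u x) + (2 + 3 * C1) * (indicat_real A x * total_density u g x)" for x
    proof (cases "x \<in> A")
      case False
      then show ?thesis using offA[OF False] w0[OF False] by (auto simp: F_0)
    next
      case True
      have scale: "(norm (c *\<^sub>R y))\<^sup>2 \<le> (norm y)\<^sup>2" if "0 \<le> c" "c \<le> 1" for c and y :: "'z::real_normed_vector"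
        using that by (intro power_mono) (auto intro: mult_left_le_one_le)
      have G1: "(norm (?g1 x))\<^sup>2 \<le> 2 * (norm (g x))\<^sup>2 + 2 * (norm (u x))\<^sup>2"
        using power2_norm_add_le[of "\<eta> x *\<^sub>R g x" "w x"] scale[of "\<eta> x" "g x"] w_le[of x] \<eta>[of x] by linarith
      have G2: "(norm (?g2 x))\<^sup>2 \<le> 2 * (norm (g x))\<^sup>2 + 2 * (norm (u x))\<^sup>2"
      proof -
        have "(norm ((1 - \<eta> x) *\<^sub>R g x + - w x))\<^sup>2 \<le> 2 * (norm (g x))\<^sup>2 + 2 * (norm (u x))\<^sup>2"
          using power2_norm_add_le[of "(1 - \<eta> x) *\<^sub>R g x" "- w x"] scale[of "1 - \<eta> x" "g x"] w_le[of x] \<eta>[of x]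
          unfolding norm_minus_cancel by linarith
        then show ?thesis by simp
      qed
      have Fs: "\<bar>F f (c *\<^sub>R u x)\<bar> \<le> C1 * ((norm (u x))\<^sup>2 + norm (u x) powr crit_exp TYPE('n))" if "0 \<le> c" "c \<le> 1" for c
      proof -
        have n: "norm (c *\<^sub>R u x) \<le> norm (u x)" using that by (auto intro: mult_left_le_one_le)
        have "(norm (c *\<^sub>R u x))\<^sup>2 + norm (c *\<^sub>R u x) powr crit_exp TYPE('n) \<le> (norm (u x))\<^sup>2 + norm (u x) powr crit_exp TYPE('n)"
          using n by (intro add_mono power_mono powr_mono2) auto
        then show ?thesis using C1(2)[of "c *\<^sub>R u x"] mult_left_mono[OF _ C1(1)] order_trans by blast
      qed
      have F1: "\<bar>F f (\<eta> x *\<^sub>R u x)\<bar> \<le> C1 * ((norm (u x))\<^sup>2 + norm (u x) powr crit_exp TYPE('n))"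
        and F2: "\<bar>F f ((1 - \<eta> x) *\<^sub>R u x)\<bar> \<le> C1 * ((norm (u x))\<^sup>2 + norm (u x) powr crit_exp TYPE('n))"
        and F3: "\<bar>F f (u x)\<bar> \<le> C1 * ((norm (u x))\<^sup>2 + norm (u x) powr crit_exp TYPE('n))"
        using Fs[of "\<eta> x"] Fs[of "1 - \<eta> x"] Fs[of 1] \<eta>[of x] by auto
      have "1/2 * (norm (?g1 x))\<^sup>2 - F f (\<eta> x *\<^sub>R u x) + (1/2 * (norm (?g2 x))\<^sup>2 - F f ((1 - \<eta> x) *\<^sub>R u x))
        \<le> 2 * ((norm (g x))\<^sup>2 + (norm (u x))\<^sup>2) - F f (u x) + 3 * (C1 * ((norm (u x))\<^sup>2 + norm (u x) powr crit_exp TYPE('n)))"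
      proof -
        define X where "X = C1 * ((norm (u x))\<^sup>2 + norm (u x) powr crit_exp TYPE('n))"
        have "- F f (\<eta> x *\<^sub>R u x) \<le> X" "- F f ((1 - \<eta> x) *\<^sub>R u x) \<le> X" "F f (u x) \<le> X"
          using F1 F2 F3 unfolding X_def[symmetric] by linarith+
        then show ?thesis unfolding X_def[symmetric] using G1 G2 by (simp add: field_simps)
      qed
      also have "\<dots> \<le> 2 * total_density u g x - F f (u x) + 3 * (C1 * total_density u g x)"
        using C1(1) by (intro add_mono diff_right_mono mult_left_mono) (auto simp: total_density_def)
      also have "\<dots> \<le> 1/2 * (norm (g x))\<^sup>2 - F f (u x) + (2 + 3 * C1) * total_density u g x"
        by (simp add: algebra_simps)
      finally show ?thesis using True by simp
    qed
    have i1: "integrable lborel (\<lambda>x. 1/2 * (norm (?g1 x))\<^sup>2 - F f (\<eta> x *\<^sub>R u x))"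
      using L2_integrable[OF sobolev_L2(2)[OF s1]] potential_integrable[OF s1] by simp
    have i2: "integrable lborel (\<lambda>x. 1/2 * (norm (?g2 x))\<^sup>2 - F f ((1 - \<eta> x) *\<^sub>R u x))"
      using L2_integrable[OF sobolev_L2(2)[OF s2]] potential_integrable[OF s2] by simp
    have i0: "integrable lborel (\<lambda>x. 1/2 * (norm (g x))\<^sup>2 - F f (u x))"
      using L2_integrable[OF sobolev_L2(2)[OF s]] potential_integrable[OF s] by simp
    have en: "energy f v = (LINT x|lborel. 1/2 * (norm (h x))\<^sup>2 - F f (v x))" if "sobolev v h" for v :: "real ^ 'n \<Rightarrow> complex" and h
      using energy_eq[OF that] L2_integrable[OF sobolev_L2(2)[OF that]] potential_integrable[OF that]
      by (simp add: potential_def sq_int_def)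
    have "energy f (\<lambda>x. \<eta> x *\<^sub>R u x) + energy f (\<lambda>x. (1 - \<eta> x) *\<^sub>R u x)
      = (LINT x|lborel. 1/2 * (norm (?g1 x))\<^sup>2 - F f (\<eta> x *\<^sub>R u x) + (1/2 * (norm (?g2 x))\<^sup>2 - F f ((1 - \<eta> x) *\<^sub>R u x)))"
      unfolding en[OF s1] en[OF s2] by (rule Bochner_Integration.integral_add[OF i1 i2, symmetric])
    also have "\<dots> \<le> (LINT x|lborel. (1/2 * (norm (g x))\<^sup>2 - F f (u x)) + (2 + 3 * C1) * (indicat_real A x * total_density u g x))"
      by (rule integral_mono[OF Bochner_Integration.integrable_add[OF i1 i2] Bochner_Integration.integrable_add[OF i0 integrable_mult_right[OF int]]])
        (use point in simp)
    also have "\<dots> = energy f u + (2 + 3 * C1) * (LINT x|lborel. indicat_real A x * total_density u g x)"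
      unfolding en[OF s] using i0 int by simp
    finally show "\<exists>g1 g2. sobolev (\<lambda>x. \<eta> x *\<^sub>R u x) g1 \<and> sobolev (\<lambda>x. (1 - \<eta> x) *\<^sub>R u x) g2 \<and>
      energy f (\<lambda>x. \<eta> x *\<^sub>R u x) + energy f (\<lambda>x. (1 - \<eta> x) *\<^sub>R u x)
        \<le> energy f u + (2 + 3 * C1) * (LINT x|lborel. indicat_real {x. 0 < \<eta> x \<and> \<eta> x < 1} x * total_density u g x)"
      using s1 s2 unfolding A_def by blast
  qed
qed

end

section \<open>Compactness of minimizing sequences\<close>

context negative_infimum
begin

subsection \<open>Tightness\<close>

text \<open>
  Suppose that mass \<open>\<delta>\<close> lies in the unit ball and mass \<open>c\<close> outside the ball of radius \<open>R\<close>. Among \<open>K\<close> disjoint shells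
  between the two, one carries at most the fraction \<open>1 / K\<close> of the total density. Cutting \<open>u\<close> there gives two
  pieces of mass at most \<open>\<alpha>' < \<alpha>\<close>. Their energies are bounded below through \<open>E \<alpha>' / \<alpha>'\<close>, which
  exceeds \<open>E \<alpha> / \<alpha>\<close>; as \<open>E\<close> is negative, the mass lost in the shell only helps.
\<close>

lemma tightness:
  assumes \<alpha>: "\<alpha> > 0" and \<delta>: "\<delta> > 0" and c: "c > 0"
  shows "\<exists>R. \<exists>d>0. \<forall>(u :: real ^ 'n \<Rightarrow> complex) g. sobolev u g \<longrightarrow> sq_int u = \<alpha> \<longrightarrow> energy f u < E \<alpha> + d \<longrightarrow>
    \<delta> \<le> mass_on (cball 0 1) u \<longrightarrow> mass_on {x. R < norm x} u < c"
proof -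
  \<comment> \<open>a bound for the masses of both pieces; the minimum with \<open>\<alpha> / 2\<close> keeps it positive\<close>
  define \<alpha>' where "\<alpha>' = \<alpha> - min (min c \<delta>) (\<alpha> / 2)"
  have \<alpha>': "0 < \<alpha>'" "\<alpha>' < \<alpha>" "\<alpha> - c \<le> \<alpha>'" "\<alpha> - \<delta> \<le> \<alpha>'"
    using \<alpha> \<delta> c by (auto simp: \<alpha>'_def min_def)
  define e where "e = E \<alpha>' / \<alpha>'"
  have e: "e < 0" using E_negative[OF \<alpha>'(1)] \<alpha>'(1) by (simp add: e_def divide_neg_pos)
  define d where "d = (\<alpha> * e - E \<alpha>) / 2"
  have "E \<alpha> < \<alpha> * e" using E_ratio_decreasing[OF \<alpha>'(1,2)] \<alpha> by (simp add: e_def pos_divide_less_eq mult.commute)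
  then have d: "d > 0" "\<alpha> * e = E \<alpha> + 2 * d" unfolding d_def by (simp_all add: algebra_simps add_divide_distrib diff_divide_distrib)
  obtain C where C: "\<And>(u :: real ^ 'n \<Rightarrow> complex) g. sobolev u g \<Longrightarrow> sq_int u \<le> \<alpha> \<Longrightarrow> sq_int g \<le> 4 * energy f u + C"
    using coercive[OF \<alpha>] by blast
  obtain D where D: "D \<ge> 0" "\<And>(u :: real ^ 'n \<Rightarrow> complex) g \<eta>. sobolev u g \<Longrightarrow> smooth \<eta> \<Longrightarrow> \<forall>x. 0 \<le> \<eta> x \<and> \<eta> x \<le> 1 \<Longrightarrow>
    \<forall>x. (\<Sum>i\<in>UNIV. (frechet_derivative \<eta> (at x) (axis i 1))\<^sup>2) \<le> 1 \<Longrightarrow>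
    \<exists>g1 g2. sobolev (\<lambda>x. \<eta> x *\<^sub>R u x) g1 \<and> sobolev (\<lambda>x. (1 - \<eta> x) *\<^sub>R u x) g2 \<and>
      energy f (\<lambda>x. \<eta> x *\<^sub>R u x) + energy f (\<lambda>x. (1 - \<eta> x) *\<^sub>R u x)
        \<le> energy f u + D * (LINT x|lborel. indicat_real {x. 0 < \<eta> x \<and> \<eta> x < 1} x * total_density u g x)"
    using energy_splitting by blast
  define G0 where "G0 = \<bar>4 * (E \<alpha> + d) + C\<bar>"
  define L0 where "L0 = lions_const TYPE('n) * \<alpha> powr (2 / real CARD('n))"
  have L0: "L0 \<ge> 0" using lions_const_pos[where 'n = 'n] by (simp add: L0_def)
  define T where "T = G0 + \<alpha> + L0 * (G0 + \<alpha>)"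
  obtain K0 :: nat where "D * T / d < real K0" using reals_Archimedean2 by blast
  define K where "K = Suc K0"
  have K: "K \<ge> 1" "D * (T / real K) < d"
  proof -
    have "D * T / d < real K" using \<open>D * T / d < real K0\<close> by (simp add: K_def)
    then show "D * (T / real K) < d" using d(1) by (simp add: K_def field_simps)
  qed (simp add: K_def)
  obtain L where L: "L \<ge> 1" "\<And>k x. k \<le> K \<Longrightarrow> (\<Sum>i\<in>UNIV. (frechet_derivative (cutoff L k) (at (x :: real ^ 'n)) (axis i 1))\<^sup>2) \<le> 1"
    using cutoff_gradient[of K] by blast
  define R where "R = sqrt (real K + 1) * L"
  show ?thesis
  proof (rule exI[of _ R], rule exI[of _ d], intro conjI allI impI d(1), rule ccontr)
    fix u :: "real ^ 'n \<Rightarrow> complex" and g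
    assume s: "sobolev u g" and m: "sq_int u = \<alpha>" and en: "energy f u < E \<alpha> + d"
      and inside: "\<delta> \<le> mass_on (cball 0 1) u" and "\<not> mass_on {x. R < norm x} u < c"
    then have outside: "c \<le> mass_on {x. R < norm x} u" by simp
    have u: "u \<in> L2" using s by (rule sobolev_L2)
    have G: "sq_int g \<le> G0" using C[OF s] m en by (simp add: G0_def)
    have "crit_int u \<le> L0 * (sq_int g + sq_int u / 1\<^sup>2)"
      unfolding L0_def by (rule gagliardo_nirenberg(2)[OF s _ \<alpha>]) (simp_all add: m)
    also have "\<dots> \<le> L0 * (G0 + \<alpha>)" using G m L0 by (intro mult_left_mono) auto
    finally have T: "(LINT x|lborel. total_density u g x) \<le> T"
      using total_density_integrable(2)[OF s] G m by (simp add: T_def)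
    define A where "A k = {x :: real ^ 'n. 0 < cutoff L k x \<and> cutoff L k x < 1}" for k
    have cm: "cutoff L k \<in> borel_measurable (borel :: (real ^ 'n) measure)" for k
      by (intro borel_measurable_continuous_onI smooth_continuous smooth_cutoff)
    have A: "A k \<in> sets borel" for k unfolding A_def using cm[of k] by measurable
    have int: "integrable lborel (\<lambda>x. indicat_real (A k) x * total_density u g x)" for k
      using integrable_mult_indicator[OF _ total_density_integrable(1)[OF s], of "A k"] A[of k] by simp
    define I where "I k = (LINT x|lborel. indicat_real (A k) x * total_density u g x)" for k
    have A_range: "real k < (norm x)\<^sup>2 / L\<^sup>2 \<and> (norm x)\<^sup>2 / L\<^sup>2 < real k + 1" if "x \<in> A k" for x k
    proof -
      have "L > 0" using L(1) by simp
      then have "\<not> (norm x)\<^sup>2 \<le> real k * L\<^sup>2" "\<not> (real k + 1) * L\<^sup>2 \<le> (norm x)\<^sup>2"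
        using that cutoff_1_iff[of L k x] cutoff_0_iff[of L k x] by (auto simp: A_def)
      then show ?thesis using \<open>L > 0\<close> by (simp add: field_simps)
    qed
    have disjoint: "j = k" if "x \<in> A j" "x \<in> A k" for x j k
      using A_range[OF that(1)] A_range[OF that(2)] by linarith
    \<comment> \<open>one of the \<open>K\<close> disjoint shells carries little energy\<close>
    have "(\<Sum>k\<in>{1..K}. I k) = (LINT x|lborel. (\<Sum>k\<in>{1..K}. indicat_real (A k) x) * total_density u g x)"
      unfolding I_def sum_distrib_right by (rule Bochner_Integration.integral_sum[symmetric]) (rule int)
    also have "\<dots> \<le> (LINT x|lborel. total_density u g x)"
    proof (rule integral_mono[OF _ total_density_integrable(1)[OF s]])
      show "integrable lborel (\<lambda>x. (\<Sum>k\<in>{1..K}. indicat_real (A k) x) * total_density u g x)"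
        unfolding sum_distrib_right by (intro Bochner_Integration.integrable_sum int)
      fix x
      have "(\<Sum>k\<in>{1..K}. indicat_real (A k) x) \<le> 1"
      proof (cases "\<exists>j\<in>{1..K}. x \<in> A j")
        case True
        then obtain j where j: "j \<in> {1..K}" "x \<in> A j" by blast
        then have "(\<Sum>k\<in>{1..K}. indicat_real (A k) x) = (\<Sum>k\<in>{1..K}. if k = j then 1 else 0)"
          using disjoint by (intro sum.cong) (auto simp: indicator_def)
        then show ?thesis using j by simp
      next
        case False
        then have "(\<Sum>k\<in>{1..K}. indicat_real (A k) x) = 0" by (intro sum.neutral) (auto simp: indicator_def)
        then show ?thesis by simp
      qed
      from mult_right_mono[OF this total_density_nonneg[of u g x]]
      show "(\<Sum>k\<in>{1..K}. indicat_real (A k) x) * total_density u g x \<le> total_density u g x" by simp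
    qed
    also have "\<dots> \<le> T" by (rule T)
    finally have sum: "(\<Sum>k\<in>{1..K}. I k) \<le> T" .
    have "\<exists>k\<in>{1..K}. I k \<le> T / real K"
    proof (rule ccontr)
      assume "\<not> (\<exists>k\<in>{1..K}. I k \<le> T / real K)"
      then have "(\<Sum>k\<in>{1..K}. T / real K) < (\<Sum>k\<in>{1..K}. I k)"
        using K(1) by (intro sum_strict_mono) (auto simp: not_le)
      then show False using sum K(1) by simp
    qed
    then obtain k where k: "1 \<le> k" "k \<le> K" "I k \<le> T / real K" by auto
    define \<eta> where "\<eta> = (cutoff L k :: real ^ 'n \<Rightarrow> real)"
    have \<eta>: "0 \<le> \<eta> x" "\<eta> x \<le> 1" for x by (simp_all add: \<eta>_def cutoff_bounds)
    obtain g1 g2 where s1: "sobolev (\<lambda>x. \<eta> x *\<^sub>R u x) g1" and s2: "sobolev (\<lambda>x. (1 - \<eta> x) *\<^sub>R u x) g2"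
      and split: "energy f (\<lambda>x. \<eta> x *\<^sub>R u x) + energy f (\<lambda>x. (1 - \<eta> x) *\<^sub>R u x) \<le> energy f u + D * I k"
      using D(2)[OF s, of \<eta>] \<eta> smooth_cutoff[of L k] L(2)[OF k(2)] unfolding \<eta>_def I_def A_def by blast
    define \<beta> \<gamma> where "\<beta> = sq_int (\<lambda>x. \<eta> x *\<^sub>R u x)" and "\<gamma> = sq_int (\<lambda>x. (1 - \<eta> x) *\<^sub>R u x)"
    have "mass_on (cball 0 1) u \<le> \<beta>"
      unfolding \<beta>_def
    proof (rule mass_on_le[OF u sobolev_L2(1)[OF s1]])
      fix x :: "real ^ 'n" assume "x \<in> cball 0 1"
      then have "(norm x)\<^sup>2 \<le> 1" by (simp add: power_le_one)
      also have "1 \<le> real k * L\<^sup>2"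
        using mult_mono[of 1 "real k" 1 "L\<^sup>2"] k(1) one_le_power[OF L(1), of 2] by simp
      finally have "\<eta> x = 1" using L(1) unfolding \<eta>_def by (subst cutoff_1_iff) auto
      then show "norm (u x) \<le> norm (\<eta> x *\<^sub>R u x)" by simp
    qed simp
    then have \<beta>: "\<delta> \<le> \<beta>" using inside by simp
    have tail: "{x :: real ^ 'n. R < norm x} \<in> sets borel" by measurable
    have "mass_on {x. R < norm x} u \<le> \<gamma>"
      unfolding \<gamma>_def
    proof (rule mass_on_le[OF u sobolev_L2(1)[OF s2] tail])
      fix x :: "real ^ 'n" assume "x \<in> {x. R < norm x}"
      moreover have "R \<ge> 0" using L(1) by (simp add: R_def)
      ultimately have "R\<^sup>2 \<le> (norm x)\<^sup>2" by (intro power_mono) auto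
      moreover have "(real k + 1) * L\<^sup>2 \<le> (real K + 1) * L\<^sup>2" using k(2) by (intro mult_right_mono) auto
      moreover have "(real K + 1) * L\<^sup>2 = R\<^sup>2" by (simp add: R_def power_mult_distrib)
      ultimately have "\<eta> x = 0" using L(1) unfolding \<eta>_def by (subst cutoff_0_iff) auto
      then show "norm (u x) \<le> norm ((1 - \<eta> x) *\<^sub>R u x)" by simp
    qed
    then have \<gamma>: "c \<le> \<gamma>" using outside by simp
    have "\<beta> + \<gamma> = (LINT x|lborel. (norm (\<eta> x *\<^sub>R u x))\<^sup>2 + (norm ((1 - \<eta> x) *\<^sub>R u x))\<^sup>2)"
      unfolding \<beta>_def \<gamma>_def sq_int_def
      by (rule Bochner_Integration.integral_add[symmetric]) (intro L2_integrable sobolev_L2(1)[OF s1] sobolev_L2(1)[OF s2])+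
    also have "\<dots> \<le> (LINT x|lborel. (norm (u x))\<^sup>2)"
    proof (rule integral_mono[OF _ L2_integrable[OF u]])
      show "integrable lborel (\<lambda>x. (norm (\<eta> x *\<^sub>R u x))\<^sup>2 + (norm ((1 - \<eta> x) *\<^sub>R u x))\<^sup>2)"
        by (intro Bochner_Integration.integrable_add L2_integrable sobolev_L2(1)[OF s1] sobolev_L2(1)[OF s2])
      fix x
      have "(\<eta> x)\<^sup>2 + (1 - \<eta> x)\<^sup>2 \<le> \<eta> x * 1 + (1 - \<eta> x) * 1"
        unfolding power2_eq_square using \<eta>[of x] by (intro add_mono mult_left_mono) auto
      then have "((\<eta> x)\<^sup>2 + (1 - \<eta> x)\<^sup>2) * (norm (u x))\<^sup>2 \<le> 1 * (norm (u x))\<^sup>2" by (intro mult_right_mono) auto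
      then show "(norm (\<eta> x *\<^sub>R u x))\<^sup>2 + (norm ((1 - \<eta> x) *\<^sub>R u x))\<^sup>2 \<le> (norm (u x))\<^sup>2"
        by (simp add: power_mult_distrib distrib_right)
    qed
    finally have mass: "\<beta> + \<gamma> \<le> \<alpha>" using m by (simp add: sq_int_def)
    have pos: "0 < \<beta>" "0 < \<gamma>" "\<beta> \<le> \<alpha>'" "\<gamma> \<le> \<alpha>'" using \<beta> \<gamma> \<delta> c mass \<alpha>' by linarith+
    have "\<alpha> * e \<le> (\<beta> + \<gamma>) * e" using mass e by (intro mult_right_mono_neg) auto
    also have "\<dots> = \<beta> * e + \<gamma> * e" by (simp add: distrib_right)
    also have "\<dots> \<le> E \<beta> + E \<gamma>" unfolding e_def using pos by (intro add_mono E_ratio_le) auto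
    also have "\<dots> \<le> energy f (\<lambda>x. \<eta> x *\<^sub>R u x) + energy f (\<lambda>x. (1 - \<eta> x) *\<^sub>R u x)"
      using pos unfolding \<beta>_def \<gamma>_def by (intro add_mono E_le[OF s1] E_le[OF s2]) auto
    also have "\<dots> \<le> energy f u + D * I k" by (rule split)
    also have "\<dots> \<le> energy f u + D * (T / real K)" using k(3) D(1) by (intro add_left_mono mult_left_mono)
    also have "\<dots> < E \<alpha> + d + d" using en K(2) by linarith
    also have "\<dots> = \<alpha> * e" using d(2) by simp
    finally show False by simp
  qed
qed

subsection \<open>Continuity of the potential\<close>

lemma potential_continuous:
  assumes \<alpha>: "\<alpha> > 0" and K: "K \<ge> 0" and \<epsilon>: "\<epsilon> > 0"
  shows "\<exists>\<eta>>0. \<forall>(u :: real ^ 'n \<Rightarrow> complex) g v h. sobolev u g \<longrightarrow> sobolev v h \<longrightarrow> sq_int u \<le> \<alpha> \<longrightarrow> sq_int v \<le> \<alpha> \<longrightarrow>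
    sq_int g \<le> K \<longrightarrow> sq_int h \<le> K \<longrightarrow> sq_int (\<lambda>x. u x - v x) \<le> \<eta> \<longrightarrow> \<bar>potential u - potential v\<bar> \<le> \<epsilon>"
proof -
  define p where "p = 2 / real CARD('n)"
  have p: "p > 0" by (simp add: p_def)
  define L where "L = lions_const TYPE('n)"
  have L: "L > 0" unfolding L_def by (rule lions_const_pos)
  define \<Lambda> where "\<Lambda> = L * \<alpha> powr p * (K + \<alpha>)"
  have \<Lambda>: "\<Lambda> \<ge> 0" using L \<alpha> K by (simp add: \<Lambda>_def)
  define \<epsilon>' where "\<epsilon>' = \<epsilon> / (2 * (2 * \<alpha> + 2 * \<Lambda>))"
  have \<epsilon>': "\<epsilon>' > 0" "\<epsilon>' * (2 * \<alpha> + 2 * \<Lambda>) = \<epsilon> / 2"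
  proof -
    define X where "X = 2 * \<alpha> + 2 * \<Lambda>"
    have "X > 0" using \<alpha> \<Lambda> unfolding X_def by linarith
    then show "\<epsilon>' > 0" "\<epsilon>' * (2 * \<alpha> + 2 * \<Lambda>) = \<epsilon> / 2"
      unfolding \<epsilon>'_def X_def[symmetric] using \<epsilon> by simp_all
  qed
  obtain B where B: "B \<ge> 0" "\<And>(z::complex) (w::complex). \<bar>F f z - F f w\<bar>
    \<le> \<epsilon>' * ((norm z)\<^sup>2 + norm z powr crit_exp TYPE('n) + (norm w)\<^sup>2 + norm w powr crit_exp TYPE('n))
      + B * ((norm (z - w))\<^sup>2 + norm (z - w) powr crit_exp TYPE('n))"
    using F_diff_bound[OF \<epsilon>'(1)] by blast
  define c where "c = L * (4 * K + 4 * \<alpha>)"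
  have c: "c \<ge> 0" using L K \<alpha> by (simp add: c_def)
  define \<eta> where "\<eta> = min (\<epsilon> / (4 * (B + 1))) ((\<epsilon> / (4 * (B * c + 1))) powr (1 / p))"
  have q: "\<epsilon> / (4 * (B + 1)) > 0" "\<epsilon> / (4 * (B * c + 1)) > 0"
    using \<epsilon> B(1) c by (auto intro!: divide_pos_pos add_nonneg_pos)
  have \<eta>: "\<eta> > 0"
    unfolding \<eta>_def min_less_iff_conj
    by (rule conjI[OF q(1) powr_gt_zero[THEN iffD2, OF less_imp_neq[OF q(2), symmetric]]])
  have "B * \<eta> \<le> B * (\<epsilon> / (4 * (B + 1)))" using B(1) by (intro mult_left_mono) (auto simp: \<eta>_def)
  also have "\<dots> \<le> \<epsilon> / 4" using B(1) \<epsilon> by (simp add: field_simps)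
  finally have B1: "B * \<eta> \<le> \<epsilon> / 4" .
  have "\<eta> powr p \<le> ((\<epsilon> / (4 * (B * c + 1))) powr (1 / p)) powr p"
    using \<eta> p by (intro powr_mono2) (auto simp: \<eta>_def)
  also have "\<dots> = \<epsilon> / (4 * (B * c + 1))"
  proof -
    have "(X powr (1 / p)) powr p = X" if "X > 0" for X :: real using that p by (simp add: powr_powr)
    then show ?thesis using q(2) by blast
  qed
  finally have "(B * c) * \<eta> powr p \<le> (B * c) * (\<epsilon> / (4 * (B * c + 1)))" using B(1) c by (intro mult_left_mono) auto
  also have "\<dots> \<le> \<epsilon> / 4"
  proof -
    have "B * c / (B * c + 1) \<le> 1" using B(1) c by (simp add: divide_le_eq_1 add_nonneg_pos)
    from mult_right_mono[OF this, of "\<epsilon> / 4"] show ?thesis using \<epsilon> by (simp add: mult_ac)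
  qed
  finally have B2: "B * c * \<eta> powr p \<le> \<epsilon> / 4" .
  show ?thesis
  proof (intro exI conjI allI impI)
    show "\<eta> > 0" by (rule \<eta>)
    fix u v :: "real ^ 'n \<Rightarrow> complex" and g h
    assume s: "sobolev u g" "sobolev v h" and m: "sq_int u \<le> \<alpha>" "sq_int v \<le> \<alpha>"
      and G: "sq_int g \<le> K" "sq_int h \<le> K" and close: "sq_int (\<lambda>x. u x - v x) \<le> \<eta>"
    have crit: "crit_int w \<le> \<Lambda>" if "sobolev w k" "sq_int w \<le> \<alpha>" "sq_int k \<le> K" for w :: "real ^ 'n \<Rightarrow> complex" and k
    proof -
      have "crit_int w \<le> L * \<alpha> powr p * (sq_int k + sq_int w / 1\<^sup>2)"
        unfolding L_def p_def by (rule gagliardo_nirenberg(2)[OF that(1) _ \<alpha> that(2)]) simp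
      also have "\<dots> \<le> L * \<alpha> powr p * (K + \<alpha>)" using that L by (intro mult_left_mono) auto
      finally show ?thesis by (simp add: \<Lambda>_def)
    qed
    have sd: "sobolev (\<lambda>x. u x - v x) (\<lambda>x. g x - h x)" by (rule sobolev_diff[OF s])
    have "sq_int (\<lambda>x. u x - v x) \<le> 4 * \<alpha>" "sq_int (\<lambda>x. g x - h x) \<le> 4 * K"
      using L2_diff(2)[OF sobolev_L2(1)[OF s(1)] sobolev_L2(1)[OF s(2)]]
        L2_diff(2)[OF sobolev_L2(2)[OF s(1)] sobolev_L2(2)[OF s(2)]] m G by linarith+
    then have "L * \<eta> powr p * (sq_int (\<lambda>x. g x - h x) + sq_int (\<lambda>x. u x - v x) / 1\<^sup>2) \<le> L * \<eta> powr p * (4 * K + 4 * \<alpha>)"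
      using L by (intro mult_left_mono) auto
    then have critd: "crit_int (\<lambda>x. u x - v x) \<le> c * \<eta> powr p"
      using gagliardo_nirenberg(2)[OF sd _ \<eta> close, of 1] by (simp add: L_def p_def c_def mult_ac)
    note i = L2_integrable[OF sobolev_L2(1)[OF s(1)]] L2_integrable[OF sobolev_L2(1)[OF s(2)]]
      L2_integrable[OF sobolev_L2(1)[OF sd]] sobolev_crit_integrable[OF s(1)] sobolev_crit_integrable[OF s(2)]
      sobolev_crit_integrable[OF sd]
    have "\<bar>potential u - potential v\<bar> = \<bar>LINT x|lborel. F f (u x) - F f (v x)\<bar>"
      using potential_integrable[OF s(1)] potential_integrable[OF s(2)] by (simp add: potential_def)
    also have "\<dots> \<le> (LINT x|lborel. \<bar>F f (u x) - F f (v x)\<bar>)" by (rule integral_abs_bound)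
    also have "\<dots> \<le> (LINT x|lborel. \<epsilon>' * ((norm (u x))\<^sup>2 + norm (u x) powr crit_exp TYPE('n) + (norm (v x))\<^sup>2 + norm (v x) powr crit_exp TYPE('n))
      + B * ((norm (u x - v x))\<^sup>2 + norm (u x - v x) powr crit_exp TYPE('n)))"
      using potential_integrable[OF s(1)] potential_integrable[OF s(2)] B(2) i by (intro integral_mono) auto
    also have "\<dots> = \<epsilon>' * (sq_int u + crit_int u + sq_int v + crit_int v) + B * (sq_int (\<lambda>x. u x - v x) + crit_int (\<lambda>x. u x - v x))"
      using i by (simp add: sq_int_def crit_int_def)
    also have "\<dots> \<le> \<epsilon>' * (2 * \<alpha> + 2 * \<Lambda>) + B * (\<eta> + c * \<eta> powr p)"
    proof (intro add_mono[OF mult_left_mono mult_left_mono])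
      show "sq_int u + crit_int u + sq_int v + crit_int v \<le> 2 * \<alpha> + 2 * \<Lambda>"
        using m crit[OF s(1) m(1) G(1)] crit[OF s(2) m(2) G(2)] by linarith
    qed (use close critd \<epsilon>'(1) B(1) in auto)
    also have "B * (\<eta> + c * \<eta> powr p) \<le> \<epsilon> / 2" using B1 B2 by (simp add: distrib_left mult.assoc)
    finally show "\<bar>potential u - potential v\<bar> \<le> \<epsilon>" using \<epsilon>'(2) by simp
  qed
qed

subsection \<open>Convergence of minimizing sequences\<close>

lemma energy_translation:
  fixes u :: "real ^ 'n \<Rightarrow> complex"
  assumes s: "sobolev u g"
  shows "energy f (\<lambda>x. u (x + y)) = energy f u" "sq_int (\<lambda>x. u (x + y)) = sq_int u"
    "sq_int (\<lambda>x. g (x + y)) = sq_int g"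
proof -
  note [measurable] = L2_measurable[OF sobolev_L2(1)[OF s]]
  have "potential (\<lambda>x. u (x + y)) = potential u"
    unfolding potential_def by (rule integral_lborel_translation) measurable
  moreover show *: "sq_int (\<lambda>x. g (x + y)) = sq_int g"
    using L2_affine(2)[OF sobolev_L2(2)[OF s], of 1 y] by simp
  ultimately show "energy f (\<lambda>x. u (x + y)) = energy f u"
    unfolding energy_eq[OF s] energy_eq[OF sobolev_translation[OF s]] by simp
  show "sq_int (\<lambda>x. u (x + y)) = sq_int u"
    using L2_affine(2)[OF sobolev_L2(1)[OF s], of 1 y] by simp
qed

text \<open>
  By the parallelogram identity, the kinetic energy of the midpoint \<open>w\<close> falls short of the average of those of
  \<open>u\<close> and \<open>v\<close> by a multiple of \<open>\<integral>|g - h|\<^sup>2\<close>. The energy of \<open>w\<close> is nevertheless at least \<open>E \<alpha>\<close>, although the mass of \<open>w\<close>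
  may be smaller than \<open>\<alpha>\<close>, because \<open>E\<close> is negative and \<open>E \<alpha> / \<alpha>\<close> is decreasing.
\<close>

lemma gradient_difference_le:
  fixes u v :: "real ^ 'n \<Rightarrow> complex"
  assumes s: "sobolev u g" "sobolev v h" and m: "sq_int u = \<alpha>" "sq_int v = \<alpha>" and \<alpha>: "\<alpha> > 0"
    and close: "sq_int (\<lambda>x. u x - v x) < 4 * \<alpha>"
  defines "w \<equiv> \<lambda>x. (1 / 2) *\<^sub>R (u x + v x)"
  shows "sq_int (\<lambda>x. g x - h x) \<le> 4 * (energy f u - E \<alpha>) + 4 * (energy f v - E \<alpha>)
    + 4 * (potential u - potential w) + 4 * (potential v - potential w)"
proof -
  note L2 = sobolev_L2(1)[OF s(1)] sobolev_L2(1)[OF s(2)] sobolev_L2(2)[OF s(1)] sobolev_L2(2)[OF s(2)]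
  have sw: "sobolev w (\<lambda>x. (1 / 2) *\<^sub>R (g x + h x))"
    unfolding w_def by (rule sobolev_scaleR[OF sobolev_add[OF s]])
  have mw: "sq_int w = \<alpha> - sq_int (\<lambda>x. u x - v x) / 4"
    using sq_int_parallelogram[OF L2(1,2)] L2_scaleR(2)[OF L2_add(1)[OF L2(1,2)], of "1 / 2"] m
    by (simp add: w_def power2_eq_square)
  then have w: "0 < sq_int w" "sq_int w \<le> \<alpha>" using close sq_int_nonneg[of "\<lambda>x. u x - v x"] by linarith+
  have "E \<alpha> / \<alpha> < 0" using E_negative[OF \<alpha>] \<alpha> by (simp add: divide_neg_pos)
  then have "\<alpha> * (E \<alpha> / \<alpha>) \<le> sq_int w * (E \<alpha> / \<alpha>)" using w by (intro mult_right_mono_neg) auto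
  also have "\<dots> \<le> E (sq_int w)" by (rule E_ratio_le[OF w])
  also have "\<dots> \<le> energy f w" by (rule E_le[OF sw w(1)])
  finally have "E \<alpha> \<le> energy f w" using \<alpha> by simp
  moreover have "energy f w = 1 / 8 * sq_int (\<lambda>x. g x + h x) - potential w"
    using L2_scaleR(2)[OF L2_add(1)[OF L2(3,4)], of "1 / 2"] by (simp add: energy_eq[OF sw] power2_eq_square)
  moreover note sq_int_parallelogram[OF L2(3,4)] energy_eq[OF s(1)] energy_eq[OF s(2)]
  ultimately show ?thesis by argo
qed

theorem minimizing_sequence_compact:
  fixes u :: "nat \<Rightarrow> real ^ 'n \<Rightarrow> complex"
  assumes \<alpha>: "\<alpha> > 0" and M: "\<And>n. u n \<in> M \<alpha>" and min: "(\<lambda>n. energy f (u n)) \<longlonglongrightarrow> E \<alpha>"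
  shows "\<exists>(r :: nat \<Rightarrow> nat) v (y :: nat \<Rightarrow> real ^ 'n). strict_mono r \<and> v \<in> M \<alpha> \<and>
    (\<lambda>n. H1_norm (\<lambda>x. u (r n) (x - y n) - v x)) \<longlonglongrightarrow> 0 \<and> energy f v = E \<alpha>"
proof -
  have neg: "E \<alpha> / 2 < 0" "E \<alpha> < E \<alpha> / 2" using E_negative[OF \<alpha>] by auto
  have su: "sobolev (u n) (weak_gradient (u n))" and mu: "sq_int (u n) = \<alpha>" for n
    using M[of n] by (auto simp: M_iff H1_sobolev)
  obtain \<delta> where \<delta>: "\<delta> > 0" "\<And>(u :: real ^ 'n \<Rightarrow> complex) g. sobolev u g \<Longrightarrow> sq_int u \<le> \<alpha> \<Longrightarrow> energy f u \<le> E \<alpha> / 2 \<Longrightarrow>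
    \<exists>y. ennreal \<delta> \<le> (\<integral>\<^sup>+x. indicator (cball y 1) x * ennreal ((norm (u x))\<^sup>2) \<partial>lborel)"
    using nonvanishing[OF \<alpha> neg(1)] by blast
  have "\<forall>n. \<exists>y. energy f (u n) \<le> E \<alpha> / 2 \<longrightarrow>
      ennreal \<delta> \<le> (\<integral>\<^sup>+x. indicator (cball y 1) x * ennreal ((norm (u n x))\<^sup>2) \<partial>lborel)"
  proof
    fix n
    show "\<exists>y. energy f (u n) \<le> E \<alpha> / 2 \<longrightarrow>
      ennreal \<delta> \<le> (\<integral>\<^sup>+x. indicator (cball y 1) x * ennreal ((norm (u n x))\<^sup>2) \<partial>lborel)"
      using \<delta>(2)[OF su[of n] eq_refl[OF mu[of n]]] by (cases "energy f (u n) \<le> E \<alpha> / 2") blast+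
  qed
  then obtain Y where Y: "\<And>n. energy f (u n) \<le> E \<alpha> / 2 \<Longrightarrow>
      ennreal \<delta> \<le> (\<integral>\<^sup>+x. indicator (cball (Y n) 1) x * ennreal ((norm (u n x))\<^sup>2) \<partial>lborel)"
    by metis
  \<comment> \<open>from here on, almost all members keep the mass \<open>\<delta>\<close> in the unit ball at the origin\<close>
  define w where "w n x = u n (x + Y n)" for n x
  define g where "g n x = weak_gradient (u n) (x + Y n)" for n x
  have s: "sobolev (w n) (g n)" for n unfolding w_def g_def by (rule sobolev_translation[OF su])
  have m: "sq_int (w n) = \<alpha>" and en: "energy f (w n) = energy f (u n)" for n
    using energy_translation[OF su] mu by (simp_all add: w_def[abs_def])
  have low: "\<forall>\<^sub>F n in sequentially. energy f (w n) \<le> E \<alpha> / 2"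
    using order_tendstoD(2)[OF min neg(2)] unfolding en by eventually_elim simp
  have inside: "\<delta> \<le> mass_on (cball 0 1) (w n)" if "energy f (w n) \<le> E \<alpha> / 2" for n
  proof -
    note [measurable] = L2_measurable[OF sobolev_L2(1)[OF su[of n]]]
    have "(\<lambda>x. indicator (cball (Y n) 1) x :: ennreal) \<in> borel_measurable borel"
      by (intro borel_measurable_indicator) simp
    then have bm: "(\<lambda>x. indicator (cball (Y n) 1) x * ennreal ((norm (u n x))\<^sup>2)) \<in> borel_measurable borel"
      by measurable
    have "ennreal \<delta> \<le> (\<integral>\<^sup>+x. indicator (cball (Y n) 1) x * ennreal ((norm (u n x))\<^sup>2) \<partial>lborel)"
      using Y[of n] that en[of n] by simp
    also have "\<dots> = (\<integral>\<^sup>+x. indicator (cball (Y n) 1) (x + Y n) * ennreal ((norm (u n (x + Y n)))\<^sup>2) \<partial>lborel)"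
      by (rule nn_integral_lborel_translation[OF bm, symmetric])
    also have "\<dots> = (\<integral>\<^sup>+x. indicator (cball 0 1) x * ennreal ((norm (w n x))\<^sup>2) \<partial>lborel)"
      by (intro nn_integral_cong) (simp add: indicator_def dist_norm w_def)
    also have "\<dots> = ennreal (mass_on (cball 0 1) (w n))"
      by (rule nn_integral_mass_on[OF sobolev_L2(1)[OF s]]) simp
    finally show ?thesis
      by (subst (asm) ennreal_le_iff) (auto simp: mass_on_def intro!: integral_nonneg_AE)
  qed
  obtain C where C: "\<And>(u :: real ^ 'n \<Rightarrow> complex) g. sobolev u g \<Longrightarrow> sq_int u \<le> \<alpha> \<Longrightarrow> sq_int g \<le> 4 * energy f u + C"
    using coercive[OF \<alpha>] by blast
  obtain B where B: "\<And>n. \<bar>energy f (u n)\<bar> \<le> B"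
    using convergent_imp_Bseq[OF convergentI[OF min]] by (auto simp: Bseq_def)
  define K where "K = 4 * B + \<bar>C\<bar>"
  have K: "sq_int (g n) \<le> K" for n
    using C[OF s[of n]] m[of n] B[of n] en[of n] by (simp add: K_def)
  have K0: "0 \<le> K" using K[of 0] sq_int_nonneg[of "g 0"] by linarith
  have tight: "\<exists>R. \<forall>\<^sub>F n in sequentially. mass_on {x. R < norm x} (w n) \<le> c" if c: "c > 0" for c
  proof -
    obtain R d where d: "d > 0" and R: "\<And>(u :: real ^ 'n \<Rightarrow> complex) g. sobolev u g \<Longrightarrow> sq_int u = \<alpha> \<Longrightarrow> energy f u < E \<alpha> + d \<Longrightarrow>
      \<delta> \<le> mass_on (cball 0 1) u \<Longrightarrow> mass_on {x. R < norm x} u < c"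
      using tightness[OF \<alpha> \<delta>(1) c] by blast
    have "\<forall>\<^sub>F n in sequentially. energy f (w n) < E \<alpha> + d"
      using order_tendstoD(2)[OF min, of "E \<alpha> + d"] d unfolding en by simp
    then have "\<forall>\<^sub>F n in sequentially. mass_on {x. R < norm x} (w n) \<le> c"
      using low
    proof eventually_elim
      case (elim n)
      show ?case by (rule less_imp_le[OF R[OF s m elim(1) inside[OF elim(2)]]])
    qed
    then show ?thesis by blast
  qed
  obtain r :: "nat \<Rightarrow> nat" where r: "strict_mono r"
    and Cauchy: "\<And>\<epsilon>. \<epsilon> > 0 \<Longrightarrow> \<exists>n0. \<forall>n\<ge>n0. \<forall>m\<ge>n0. sq_int (\<lambda>x. w (r n) x - w (r m) x) \<le> \<epsilon>"
    using L2_compactness[OF s eq_refl[OF m] K tight] by blast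
  have energy_lim: "(\<lambda>n. energy f (w (r n))) \<longlonglongrightarrow> E \<alpha>"
    using LIMSEQ_subseq_LIMSEQ[OF min r] by (simp add: en o_def)
  have Cauchy_grad: "\<exists>n0. \<forall>n\<ge>n0. \<forall>m\<ge>n0. sq_int (\<lambda>x. g (r n) x - g (r m) x) \<le> \<epsilon>" if \<epsilon>: "\<epsilon> > 0" for \<epsilon>
  proof -
    obtain \<eta> where \<eta>: "\<eta> > 0" and pot: "\<And>(u :: real ^ 'n \<Rightarrow> complex) g v h. sobolev u g \<Longrightarrow> sobolev v h \<Longrightarrow> sq_int u \<le> \<alpha> \<Longrightarrow> sq_int v \<le> \<alpha> \<Longrightarrow>
      sq_int g \<le> K \<Longrightarrow> sq_int h \<le> K \<Longrightarrow> sq_int (\<lambda>x. u x - v x) \<le> \<eta> \<Longrightarrow> \<bar>potential u - potential v\<bar> \<le> \<epsilon> / 16"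
      using potential_continuous[OF \<alpha> K0, of "\<epsilon> / 16"] \<epsilon> by auto
    obtain n1 where n1: "\<And>n m. n \<ge> n1 \<Longrightarrow> m \<ge> n1 \<Longrightarrow> sq_int (\<lambda>x. w (r n) x - w (r m) x) \<le> min (4 * \<eta>) (2 * \<alpha>)"
      using Cauchy[of "min (4 * \<eta>) (2 * \<alpha>)"] \<eta> \<alpha> by auto
    have "\<forall>\<^sub>F n in sequentially. energy f (w (r n)) < E \<alpha> + \<epsilon> / 16"
      using \<epsilon> by (intro order_tendstoD(2)[OF energy_lim]) simp
    then obtain n2 where n2: "\<And>n. n \<ge> n2 \<Longrightarrow> energy f (w (r n)) < E \<alpha> + \<epsilon> / 16"
      by (auto simp: eventually_sequentially)
    show ?thesis
    proof (intro exI allI impI)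
      fix n k assume "max n1 n2 \<le> n" "max n1 n2 \<le> k"
      then have nk: "n \<ge> n1" "n \<ge> n2" "k \<ge> n1" "k \<ge> n2" by auto
      define a b where "a = w (r n)" and "b = w (r k)"
      define ga gb where "ga = g (r n)" and "gb = g (r k)"
      have sa: "sobolev a ga" and sb: "sobolev b gb" by (simp_all add: a_def b_def ga_def gb_def s)
      have ma: "sq_int a = \<alpha>" and mb: "sq_int b = \<alpha>" by (simp_all add: a_def b_def m)
      have Ga: "sq_int ga \<le> K" and Gb: "sq_int gb \<le> K" by (simp_all add: ga_def gb_def K)
      define h where "h = (\<lambda>x. (1 / 2) *\<^sub>R (a x + b x))"
      define gh where "gh = (\<lambda>x. (1 / 2) *\<^sub>R (ga x + gb x))"
      note L2 = sobolev_L2(1)[OF sa] sobolev_L2(1)[OF sb] sobolev_L2(2)[OF sa] sobolev_L2(2)[OF sb]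
      have sh: "sobolev h gh" unfolding h_def gh_def by (rule sobolev_scaleR[OF sobolev_add[OF sa sb]])
      have ab: "sq_int (\<lambda>x. a x - b x) \<le> 4 * \<eta>" "sq_int (\<lambda>x. a x - b x) < 4 * \<alpha>"
        using n1[OF nk(1,3)] \<alpha> by (auto simp: a_def b_def)
      have ba: "sq_int (\<lambda>x. b x - a x) = sq_int (\<lambda>x. a x - b x)" by (simp add: sq_int_def norm_minus_commute)
      have mh: "sq_int h \<le> \<alpha>" and Gh: "sq_int gh \<le> K"
        using L2_scaleR(2)[OF L2_add(1)[OF L2(1,2)], of "1 / 2"] L2_add(2)[OF L2(1,2)] ma mb
          L2_scaleR(2)[OF L2_add(1)[OF L2(3,4)], of "1 / 2"] L2_add(2)[OF L2(3,4)] Ga Gb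
        by (simp_all add: h_def gh_def power2_eq_square)
      have "(\<lambda>x. a x - h x) = (\<lambda>x. (1 / 2) *\<^sub>R (a x - b x))" "(\<lambda>x. b x - h x) = (\<lambda>x. (1 / 2) *\<^sub>R (b x - a x))"
        unfolding h_def by (auto simp: fun_eq_iff algebra_simps simp flip: scaleR_add_left)
      then have "sq_int (\<lambda>x. a x - h x) \<le> \<eta>" "sq_int (\<lambda>x. b x - h x) \<le> \<eta>"
        using L2_scaleR(2)[OF L2_diff(1)[OF L2(1,2)], of "1 / 2"] L2_scaleR(2)[OF L2_diff(1)[OF L2(2,1)], of "1 / 2"] ab(1) ba
        by (simp_all add: power2_eq_square)
      then have "potential a - potential h \<le> \<epsilon> / 16" "potential b - potential h \<le> \<epsilon> / 16"
        using abs_le_D1[OF pot[OF sa sh _ mh Ga Gh]] abs_le_D1[OF pot[OF sb sh _ mh Gb Gh]] ma mb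
        by auto
      moreover have "energy f a < E \<alpha> + \<epsilon> / 16" "energy f b < E \<alpha> + \<epsilon> / 16"
        using n2[OF nk(2)] n2[OF nk(4)] by (simp_all add: a_def b_def)
      moreover note gradient_difference_le[OF sa sb ma mb \<alpha> ab(2), folded h_def]
      ultimately have "sq_int (\<lambda>x. ga x - gb x) \<le> \<epsilon>" by argo
      then show "sq_int (\<lambda>x. g (r n) x - g (r k) x) \<le> \<epsilon>" by (simp add: ga_def gb_def)
    qed
  qed
  obtain v where v: "v \<in> L2" and wv: "(\<lambda>n. sq_int (\<lambda>x. w (r n) x - v x)) \<longlonglongrightarrow> 0"
    using L2_complete[of "\<lambda>n. w (r n)", OF sobolev_L2(1)[OF s] Cauchy] by blast
  obtain gv where gv: "gv \<in> L2" and ggv: "(\<lambda>n. sq_int (\<lambda>x. g (r n) x - gv x)) \<longlonglongrightarrow> 0"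
    using L2_complete[of "\<lambda>n. g (r n)", OF sobolev_L2(2)[OF s] Cauchy_grad] by blast
  have sv: "sobolev v gv" by (rule sobolev_closed[OF s v gv wv ggv])
  have "(\<lambda>n. sq_int (w (r n))) \<longlonglongrightarrow> sq_int v" by (rule sq_int_tendsto[OF sobolev_L2(1)[OF s] v wv])
  then have mv: "sq_int v = \<alpha>" by (simp add: m LIMSEQ_const_iff)
  have grad_lim: "(\<lambda>n. sq_int (g (r n))) \<longlonglongrightarrow> sq_int gv" by (rule sq_int_tendsto[OF sobolev_L2(2)[OF s] gv ggv])
  have pot_lim: "(\<lambda>n. potential (w (r n))) \<longlonglongrightarrow> potential v"
  proof (rule LIMSEQ_I)
    fix \<epsilon> :: real assume \<epsilon>: "\<epsilon> > 0"
    have K': "max K (sq_int gv) \<ge> 0" using K0 by simp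
    obtain \<eta> where \<eta>: "\<eta> > 0" and pot: "\<And>(u :: real ^ 'n \<Rightarrow> complex) g v h. sobolev u g \<Longrightarrow> sobolev v h \<Longrightarrow> sq_int u \<le> \<alpha> \<Longrightarrow> sq_int v \<le> \<alpha> \<Longrightarrow>
      sq_int g \<le> max K (sq_int gv) \<Longrightarrow> sq_int h \<le> max K (sq_int gv) \<Longrightarrow> sq_int (\<lambda>x. u x - v x) \<le> \<eta> \<Longrightarrow> \<bar>potential u - potential v\<bar> \<le> \<epsilon> / 2"
      using potential_continuous[OF \<alpha> K', of "\<epsilon> / 2"] \<epsilon> by auto
    have "\<forall>\<^sub>F n in sequentially. sq_int (\<lambda>x. w (r n) x - v x) < \<eta>" by (rule order_tendstoD(2)[OF wv \<eta>])
    then obtain n0 where n0: "\<And>n. n \<ge> n0 \<Longrightarrow> sq_int (\<lambda>x. w (r n) x - v x) < \<eta>"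
      by (auto simp: eventually_sequentially)
    show "\<exists>n0. \<forall>n\<ge>n0. norm (potential (w (r n)) - potential v) < \<epsilon>"
    proof (intro exI allI impI)
      fix n assume "n0 \<le> n"
      then have "\<bar>potential (w (r n)) - potential v\<bar> \<le> \<epsilon> / 2"
        using K[of "r n"] n0[of n] m[of "r n"] mv by (intro pot[OF s sv]) auto
      then show "norm (potential (w (r n)) - potential v) < \<epsilon>" using \<epsilon> by simp
    qed
  qed
  have "(\<lambda>n. 1/2 * sq_int (g (r n)) - potential (w (r n))) \<longlonglongrightarrow> 1/2 * sq_int gv - potential v"
    by (intro tendsto_intros grad_lim pot_lim)
  then have "(\<lambda>n. energy f (w (r n))) \<longlonglongrightarrow> energy f v" by (simp only: energy_eq[OF s] energy_eq[OF sv])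
  then have ev: "energy f v = E \<alpha>" using energy_lim LIMSEQ_unique by blast
  have "(\<lambda>n. H1_norm (\<lambda>x. w (r n) x - v x)) \<longlonglongrightarrow> 0"
  proof -
    have "H1_norm (\<lambda>x. w (r n) x - v x) = sqrt (sq_int (\<lambda>x. w (r n) x - v x) + sq_int (\<lambda>x. g (r n) x - gv x))" for n
      using sobolev_weak_gradient[OF sobolev_diff[OF s sv]] by (simp add: H1_norm_def sq_int_def)
    moreover have "(\<lambda>n. sqrt (sq_int (\<lambda>x. w (r n) x - v x) + sq_int (\<lambda>x. g (r n) x - gv x))) \<longlonglongrightarrow> sqrt (0 + 0)"
      by (intro tendsto_intros wv ggv)
    ultimately show ?thesis by simp
  qed
  then have "(\<lambda>n. H1_norm (\<lambda>x. u (r n) (x - (- Y (r n))) - v x)) \<longlonglongrightarrow> 0" by (simp add: w_def)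
  then show ?thesis
    by (intro exI[of _ r] exI[of _ v] exI[of _ "\<lambda>n. - Y (r n)"] conjI r sobolev_M[OF sv mv] ev)
qed

end

section \<open>The growth conditions\<close>

text \<open>
  Near the origin and near infinity the limits apply; the compact region in between is absorbed by either of
  the two powers of \<open>|z|\<close>, as both are bounded below there.
\<close>

lemma growth_bounds:
  fixes f :: "complex \<Rightarrow> complex" and q :: real
  assumes cont: "continuous_on UNIV f" and f0: "f 0 = 0" and q: "q > 0"
    and F3: "((\<lambda>z. f z / of_real (norm z)) \<longlongrightarrow> 0) (at 0)"
    and F4: "((\<lambda>z. f z / of_real (norm z powr q)) \<longlongrightarrow> 0) at_infinity"
    and \<epsilon>: "\<epsilon> > 0" "\<epsilon>' > 0"
  shows "\<exists>A\<ge>0. \<forall>z. norm (f z) \<le> \<epsilon> * norm z + (\<epsilon>' + A) * norm z powr q"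
    and "\<exists>A\<ge>0. \<forall>z. norm (f z) \<le> (\<epsilon> + A) * norm z + \<epsilon>' * norm z powr q"
proof -
  have "\<forall>\<^sub>F z in at 0. norm (f z / of_real (norm z)) < \<epsilon>" using tendstoD[OF F3 \<epsilon>(1)] by simp
  then obtain d where d: "d > 0" "\<And>z. z \<noteq> 0 \<Longrightarrow> norm z < d \<Longrightarrow> norm (f z / of_real (norm z)) < \<epsilon>"
    by (auto simp: eventually_at)
  have near: "norm (f z) \<le> \<epsilon> * norm z" if "norm z < d" for z
    using d(2)[OF _ that] f0 by (cases "z = 0") (auto simp: norm_divide field_simps)
  have "\<forall>\<^sub>F z in at_infinity. norm (f z / of_real (norm z powr q)) < \<epsilon>'" using tendstoD[OF F4 \<epsilon>(2)] by simp
  then obtain b0 where b0: "\<And>z. b0 \<le> norm z \<Longrightarrow> norm (f z / of_real (norm z powr q)) < \<epsilon>'"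
    by (auto simp: eventually_at_infinity)
  define b where "b = max b0 d"
  have far: "norm (f z) \<le> \<epsilon>' * norm z powr q" if "b \<le> norm z" for z
  proof -
    have "d \<le> norm z" using that by (simp add: b_def)
    then have "norm z > 0" using d(1) by linarith
    moreover have "norm (f z / of_real (norm z powr q)) < \<epsilon>'" using that by (intro b0) (simp add: b_def)
    ultimately show ?thesis by (simp add: norm_divide field_simps)
  qed
  have "compact (f ` cball 0 b)"
    by (intro compact_continuous_image continuous_on_subset[OF cont]) auto
  then obtain B where B: "B > 0" "\<And>z. norm z \<le> b \<Longrightarrow> norm (f z) \<le> B"
    using compact_imp_bounded[THEN bounded_pos[THEN iffD1]] by (metis image_eqI mem_cball_0)
  show "\<exists>A\<ge>0. \<forall>z. norm (f z) \<le> \<epsilon> * norm z + (\<epsilon>' + A) * norm z powr q"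
  proof (intro exI[of _ "B / d powr q"] conjI allI)
    show "0 \<le> B / d powr q" using B by simp
    fix z :: complex
    have nn: "0 \<le> \<epsilon> * norm z" "0 \<le> \<epsilon>' * norm z powr q" "0 \<le> (B / d powr q) * norm z powr q"
      using \<epsilon> B by auto
    consider "norm z < d" | "b \<le> norm z" | "d \<le> norm z" "norm z \<le> b" by linarith
    then have "norm (f z) \<le> \<epsilon> * norm z + (\<epsilon>' * norm z powr q + (B / d powr q) * norm z powr q)"
    proof cases
      case 1 then show ?thesis using near[OF 1] nn by linarith
    next
      case 2 then show ?thesis using far[OF 2] nn by linarith
    next
      case 3
      have "B = (B / d powr q) * d powr q" using d by simp
      also have "\<dots> \<le> (B / d powr q) * norm z powr q"
        using 3 B d q by (intro mult_left_mono powr_mono2) auto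
      finally show ?thesis using B(2)[OF 3(2)] nn by linarith
    qed
    then show "norm (f z) \<le> \<epsilon> * norm z + (\<epsilon>' + B / d powr q) * norm z powr q" by (simp add: distrib_right)
  qed
  show "\<exists>A\<ge>0. \<forall>z. norm (f z) \<le> (\<epsilon> + A) * norm z + \<epsilon>' * norm z powr q"
  proof (intro exI[of _ "B / d"] conjI allI)
    show "0 \<le> B / d" using B d by simp
    fix z :: complex
    have nn: "0 \<le> \<epsilon> * norm z" "0 \<le> \<epsilon>' * norm z powr q" "0 \<le> (B / d) * norm z"
      using \<epsilon> B d by auto
    consider "norm z < d" | "b \<le> norm z" | "d \<le> norm z" "norm z \<le> b" by linarith
    then have "norm (f z) \<le> \<epsilon> * norm z + (B / d) * norm z + \<epsilon>' * norm z powr q"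
    proof cases
      case 1 then show ?thesis using near[OF 1] nn by linarith
    next
      case 2 then show ?thesis using far[OF 2] nn by linarith
    next
      case 3
      have "B = (B / d) * d" using d by simp
      also have "\<dots> \<le> (B / d) * norm z" using 3 B d by (intro mult_left_mono) auto
      finally show ?thesis using B(2)[OF 3(2)] nn by linarith
    qed
    then show "norm (f z) \<le> (\<epsilon> + B / d) * norm z + \<epsilon>' * norm z powr q" by (simp add: distrib_right)
  qed
qed

lemma mass_subcriticalI:
  fixes f :: "complex \<Rightarrow> complex"
  assumes cont: "continuous_on UNIV f" and f0: "f 0 = 0"
    and F3: "((\<lambda>z. f z / of_real (norm z)) \<longlongrightarrow> 0) (at 0)"
    and F4: "((\<lambda>z. f z / of_real (norm z powr (crit_exp TYPE('n::finite) - 1))) \<longlongrightarrow> 0) at_infinity"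
  shows "mass_subcritical TYPE('n) f"
proof
  have q: "crit_exp TYPE('n) - 1 > 0" by (simp add: add_pos_nonneg)
  note bounds = growth_bounds[OF cont f0 q F3 F4]
  have Re: "\<bar>Re (f (of_real \<tau>))\<bar> \<le> norm (f (of_real \<tau>))" for \<tau> by (rule abs_Re_le_cmod)
  show "continuous_on UNIV f" by (rule cont)
  fix \<epsilon> :: real assume \<epsilon>: "\<epsilon> > 0"
  obtain A where A: "A \<ge> 0" "\<And>z. norm (f z) \<le> \<epsilon> * norm z + (1 + A) * norm z powr (crit_exp TYPE('n) - 1)"
    using bounds(1)[OF \<epsilon>, of 1] by auto
  have "\<bar>Re (f (of_real \<tau>))\<bar> \<le> \<epsilon> * \<tau> + (1 + A) * \<tau> powr (crit_exp TYPE('n) - 1)" if "\<tau> \<ge> 0" for \<tau>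
    using order_trans[OF Re A(2)[of "of_real \<tau>"]] that by simp
  then show "\<exists>B\<ge>0. \<forall>\<tau>\<ge>0. \<bar>Re (f (of_real \<tau>))\<bar> \<le> \<epsilon> * \<tau> + B * \<tau> powr (crit_exp TYPE('n) - 1)"
    using A(1) by (intro exI[of _ "1 + A"]) auto
  obtain A' where A': "A' \<ge> 0" "\<And>z. norm (f z) \<le> (1 + A') * norm z + \<epsilon> * norm z powr (crit_exp TYPE('n) - 1)"
    using bounds(2)[OF _ \<epsilon>, of 1] by auto
  have "\<bar>Re (f (of_real \<tau>))\<bar> \<le> (1 + A') * \<tau> + \<epsilon> * \<tau> powr (crit_exp TYPE('n) - 1)" if "\<tau> \<ge> 0" for \<tau>
    using order_trans[OF Re A'(2)[of "of_real \<tau>"]] that by simp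
  then show "\<exists>A\<ge>0. \<forall>\<tau>\<ge>0. \<bar>Re (f (of_real \<tau>))\<bar> \<le> A * \<tau> + \<epsilon> * \<tau> powr (crit_exp TYPE('n) - 1)"
    using A'(1) by (intro exI[of _ "1 + A'"]) auto
qed

section \<open>Subadditivity and compactness\<close>

theorem proposition3p3:
  fixes f :: "complex \<Rightarrow> complex" and l :: real
  assumes l: "l = 2 + 4 / real CARD('n::finite)"
    and F1: "continuous_on UNIV f" "f 0 = 0"
    and F2: "\<And>r::real. f (of_real r) \<in> \<real>"
            "\<And>(\<theta>::real) z. f (exp (\<i> * of_real \<theta>) * z) = exp (\<i> * of_real \<theta>) * f z"
    and F3: "((\<lambda>z. f z / of_real (norm z)) \<longlongrightarrow> 0) (at 0)"
    and F4: "((\<lambda>z. f z / of_real (norm z powr (l - 1))) \<longlongrightarrow> 0) at_infinity"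
    and E1: "\<And>\<alpha>. \<alpha> > 0 \<Longrightarrow> E_inf TYPE('n) f \<alpha> < 0"
  shows "(\<forall>\<alpha> \<beta>. \<alpha> > 0 \<longrightarrow> \<beta> > 0 \<longrightarrow>
            E_inf TYPE('n) f (\<alpha> + \<beta>) < E_inf TYPE('n) f \<alpha> + E_inf TYPE('n) f \<beta>) \<and>
         (\<forall>\<alpha> > 0. \<forall>u :: nat \<Rightarrow> real ^ 'n \<Rightarrow> complex. minimizing_sequence f \<alpha> u \<longrightarrow>
            (\<exists>(r :: nat \<Rightarrow> nat) (v :: real ^ 'n \<Rightarrow> complex) (y :: nat \<Rightarrow> real ^ 'n).
               strict_mono r \<and> v \<in> M \<alpha> \<and>
               (\<lambda>n. H1_norm (\<lambda>x. u (r n) (x - y n) - v x)) \<longlonglongrightarrow> 0 \<and>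
               ereal (energy f v) = E_inf TYPE('n) f \<alpha>))"
proof -
  interpret mass_subcritical f "TYPE('n)"
    using mass_subcriticalI[OF F1 F3] F4 unfolding l by blast
  interpret negative_infimum f "TYPE('n)"
    by unfold_locales (rule E1)
  show ?thesis
  proof (intro conjI allI impI)
    fix \<alpha> \<beta> :: real assume pos: "\<alpha> > 0" "\<beta> > 0"
    then show "E_inf TYPE('n) f (\<alpha> + \<beta>) < E_inf TYPE('n) f \<alpha> + E_inf TYPE('n) f \<beta>"
      using strict_subadditivity[OF pos] by (simp add: E_inf_eq)
  next
    fix \<alpha> :: real and u :: "nat \<Rightarrow> real ^ 'n \<Rightarrow> complex"
    assume \<alpha>: "\<alpha> > 0" and "minimizing_sequence f \<alpha> u"
    then have M: "\<And>n. u n \<in> M \<alpha>" and min: "(\<lambda>n. energy f (u n)) \<longlonglongrightarrow> E \<alpha>"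
      by (auto simp: minimizing_sequence_def E_inf_eq)
    show "\<exists>(r :: nat \<Rightarrow> nat) (v :: real ^ 'n \<Rightarrow> complex) (y :: nat \<Rightarrow> real ^ 'n).
        strict_mono r \<and> v \<in> M \<alpha> \<and> (\<lambda>n. H1_norm (\<lambda>x. u (r n) (x - y n) - v x)) \<longlonglongrightarrow> 0 \<and>
        ereal (energy f v) = E_inf TYPE('n) f \<alpha>"
      unfolding E_inf_eq[OF \<alpha>] ereal.inject by (rule minimizing_sequence_compact[OF \<alpha> M min])
  qed
qed

end
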